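(* Assume that $k_2\neq k_3$. Let $N,\ell\in\mathbb{N}^*$ be such that $\ell\le N$, let $U_0\in H^N(\mathbb{R})\cap L^1(\mathbb{R})$ (componentwise), and let $U=(v,u,z,y,\phi,\theta,\eta)^T$ be the solution of the Cauchy problem $$\begin{cases} v_t-u_x-y-\theta=0,\\ u_t-k_1v_x+\gamma\eta_x=0,\\ z_t-y_x=0,\\ y_t-k_2z_x+k_1v=0,\\ \phi_t-\theta_x=0,\\ \theta_t-k_3\phi_x+k_1v=0,\\ \eta_t-k_4\eta_{xx}+\gamma u_x=0,\end{cases}\qquad x\in\mathbb{R},\ t>0,\qquad U(\cdot,0)=U_0 .$$ Then, for any $j\in\{0,\dots,N-\ell\}$, there exists $c_0>0$ such that $$\|\partial_x^jU(\cdot,t)\|_{L^2(\mathbb{R})}\le c_0(1+t)^{-1/12-j/6}\|U_0\|_{L^1(\mathbb{R})}+c_0(1+t)^{-\ell/2}\|\partial_x^{j+\ell}U_0\|_{L^2(\mathbb{R})},\qquad\forall t\in\mathbb{R}_+ .$$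
   Context: $k_1,k_2,k_3,k_4,\gamma>0$ are constants; $\mathbb{N}^*$ is the set of positive integers and $\mathbb{R}_+=[0,\infty)$. The system is the first-order form (with $u=\varphi_t$, $y=\psi_t$, $\theta=w_t$, $v=\varphi_x+\psi+w$, $z=\psi_x$, $\phi=w_x$) of the laminated Timoshenko system with interfacial slip coupled to Fourier heat conduction acting through the first (transversal displacement) equation. The solution $U$ is the one whose Fourier transform in $x$, $\widehat U(\xi,t)$, solves for each $\xi\in\mathbb{R}$ the linear ODE system obtained by replacing $\partial_x$ by $i\xi$, with initial value $\widehat U_0(\xi)$ (i.e. a matrix exponential applied to $\widehat U_0(\xi)$). Norms of vector-valued functions are the usual ones. *)

theory Defs
  imports "HOL-Analysis.Analysis"
begin

section \<open>Lebesgue and Sobolev spaces on the real line\<close>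

text \<open>
  Functions on the line are complex-vector-valued (so real-valued ones are included), and all
  integrals are with respect to \<^const>\<open>lborel\<close>. Every class of Lebesgue measurable functions
  modulo equality almost everywhere has a Borel representative, so this is no restriction.
\<close>

definition L2 :: "(real \<Rightarrow> 'a::euclidean_space) set" where
  "L2 = {f. f \<in> borel_measurable lborel \<and> integrable lborel (\<lambda>x. (norm (f x))\<^sup>2)}"

definition L2norm :: "(real \<Rightarrow> 'a::euclidean_space) \<Rightarrow> real" where
  "L2norm f = sqrt (LINT x|lborel. (norm (f x))\<^sup>2)"

definition L1 :: "(real \<Rightarrow> 'a::euclidean_space) set" where
  "L1 = {f. integrable lborel f}"

definition L1norm :: "(real \<Rightarrow> 'a::euclidean_space) \<Rightarrow> real" where
  "L1norm f = (LINT x|lborel. norm (f x))"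

definition test_function :: "(real \<Rightarrow> real) \<Rightarrow> bool" where
  "test_function \<phi> \<longleftrightarrow>
     (\<forall>n x. (deriv ^^ n) \<phi> field_differentiable at x) \<and> compact (closure {x. \<phi> x \<noteq> 0})"

definition locally_integrable :: "(real \<Rightarrow> 'a::euclidean_space) \<Rightarrow> bool" where
  "locally_integrable f \<longleftrightarrow> (\<forall>a b. set_integrable lborel {a..b} f)"

definition has_weak_deriv ::
    "nat \<Rightarrow> (real \<Rightarrow> 'a::euclidean_space) \<Rightarrow> (real \<Rightarrow> 'a) \<Rightarrow> bool" where
  "has_weak_deriv n f g \<longleftrightarrow> locally_integrable f \<and> locally_integrable g \<and>
     (\<forall>\<phi>. test_function \<phi> \<longrightarrow>
        (LINT x|lborel. (deriv ^^ n) \<phi> x *\<^sub>R f x) = (-1) ^ n *\<^sub>R (LINT x|lborel. \<phi> x *\<^sub>R g x))"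

text \<open>
  A representative of the \<open>n\<close>-th weak derivative, which is unique up to equality almost
  everywhere when it exists; the value is meaningful only in that case.
\<close>

definition weak_deriv :: "nat \<Rightarrow> (real \<Rightarrow> 'a::euclidean_space) \<Rightarrow> real \<Rightarrow> 'a" where
  "weak_deriv n f = (SOME g. has_weak_deriv n f g)"

text \<open>The Sobolev space \<open>H\<^sup>N\<close> of the line.\<close>

definition sobolev :: "nat \<Rightarrow> (real \<Rightarrow> 'a::euclidean_space) set" where
  "sobolev N = {f \<in> L2. \<forall>n\<le>N. \<exists>g \<in> L2. has_weak_deriv n f g}"


section \<open>Fourier transform\<close>

definition fourier :: "(real \<Rightarrow> complex ^ 'n) \<Rightarrow> real \<Rightarrow> complex ^ 'n" where
  "fourier f \<xi> = (LINT x|lborel. exp (- (\<i> * of_real (\<xi> * x))) *s f x)"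

text \<open>
  The Fourier transform of a square-integrable function, which need not be integrable: the limit
  in \<^const>\<open>L2\<close> of the Fourier integrals over \<open>[-R, R]\<close>. The squared distance is an integral in
  \<^typ>\<open>ennreal\<close>, so that it cannot vanish for want of integrability.
\<close>

definition has_fourier_L2 :: "(real \<Rightarrow> complex ^ 'n) \<Rightarrow> (real \<Rightarrow> complex ^ 'n) \<Rightarrow> bool" where
  "has_fourier_L2 f g \<longleftrightarrow> f \<in> L2 \<and> g \<in> L2 \<and>
     ((\<lambda>R. \<integral>\<^sup>+ \<xi>. ennreal ((norm (fourier (\<lambda>x. indicator {-R..R} x *\<^sub>R f x) \<xi> - g \<xi>))\<^sup>2) \<partial>lborel)
        \<longlongrightarrow> 0) at_top"


section \<open>The laminated Timoshenko system with heat conduction in the first equation\<close>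

text \<open>
  The components \<open>1, \<dots>, 7\<close> of the state are \<open>v, u, z, y, \<phi>, \<theta>, \<eta>\<close>. The equations are those of
  the system with \<open>\<partial>\<^sub>x\<close> replaced by multiplication by \<open>D = \<i> \<xi>\<close>, solved for the time derivatives.
\<close>

definition fourier_system ::
    "real \<Rightarrow> real \<Rightarrow> real \<Rightarrow> real \<Rightarrow> real \<Rightarrow> real \<Rightarrow> (real \<Rightarrow> complex ^ 7) \<Rightarrow> bool" where
  "fourier_system k1 k2 k3 k4 \<gamma> \<xi> W \<longleftrightarrow> (\<forall>t\<ge>0.
     let D = \<i> * of_real \<xi>;
         v = (\<lambda>s. W s $ 1); u = (\<lambda>s. W s $ 2); z = (\<lambda>s. W s $ 3); y = (\<lambda>s. W s $ 4);
         \<phi> = (\<lambda>s. W s $ 5); \<theta> = (\<lambda>s. W s $ 6); \<eta> = (\<lambda>s. W s $ 7)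
     in (v has_vector_derivative D * u t + y t + \<theta> t) (at t within {0..}) \<and>
        (u has_vector_derivative of_real k1 * (D * v t) - of_real \<gamma> * (D * \<eta> t))
          (at t within {0..}) \<and>
        (z has_vector_derivative D * y t) (at t within {0..}) \<and>
        (y has_vector_derivative of_real k2 * (D * z t) - of_real k1 * v t)
          (at t within {0..}) \<and>
        (\<phi> has_vector_derivative D * \<theta> t) (at t within {0..}) \<and>
        (\<theta> has_vector_derivative of_real k3 * (D * \<phi> t) - of_real k1 * v t)
          (at t within {0..}) \<and>
        (\<eta> has_vector_derivative of_real k4 * (D\<^sup>2 * \<eta> t) - of_real \<gamma> * (D * u t))
          (at t within {0..}))"

text \<open>
  \<open>U t x\<close> is the state at time \<open>t\<close> and position \<open>x\<close>. The initial value is integrable, so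
  its Fourier transform is defined at every frequency.
\<close>

definition is_solution ::
    "real \<Rightarrow> real \<Rightarrow> real \<Rightarrow> real \<Rightarrow> real \<Rightarrow> (real \<Rightarrow> complex ^ 7) \<Rightarrow> (real \<Rightarrow> real \<Rightarrow> complex ^ 7)
      \<Rightarrow> bool" where
  "is_solution k1 k2 k3 k4 \<gamma> U0 U \<longleftrightarrow>
     (\<exists>W :: real \<Rightarrow> real \<Rightarrow> complex ^ 7.
        (\<forall>\<xi>. W \<xi> 0 = fourier U0 \<xi> \<and> fourier_system k1 k2 k3 k4 \<gamma> \<xi> (W \<xi>)) \<and>
        (\<forall>t\<ge>0. has_fourier_L2 (U t) (\<lambda>\<xi>. W \<xi> t)))"

end

theory Submission
  imports Defs "HOL-Probability.Probability"
begin

text \<open>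
  In Fourier space the energy is dissipated only through \<open>\<eta>\<close>, and the dissipation has to be carried to the
  other components. In the variables \<open>w = y + \<theta>\<close>, \<open>p = k2 z + k3 \<phi>\<close>, \<open>m = d (y - \<theta>)\<close>,
  \<open>n = d (k2 z - k3 \<phi>)\<close> with \<open>d = (k2 - k3) / 2\<close>, which are coordinates because \<open>k2 \<noteq> k3\<close>, the system is
  a chain \<open>\<eta> - u - v - w - p - m - n\<close>. A Lyapunov functional that adds to the energy the products of
  consecutive members of the chain, with weights depending on \<open>\<xi>\<close>, decays at the rate \<open>\<xi>\<^sup>6 / (1 + \<xi>\<^sup>2)\<^sup>4\<close>.
  At low frequencies this is \<open>\<xi>\<^sup>6\<close>: the transform of the initial value is bounded by its \<open>L\<^sup>1\<close> norm, and scaling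
  of \<open>\<integral> \<xi>\<^bsup>2j\<^esup> exp (- c \<xi>\<^sup>6 t) d\<xi>\<close> gives the first term. At high frequencies it is \<open>\<xi>\<^bsup>-2\<^esup>\<close>, and decay in
  time is bought with \<open>l\<close> derivatives.

  The passage between a function and its transform rests on the regularization of the pairing of two transforms by a
  Gaussian. It yields Bessel's inequality, and Parseval's identity against test functions; Plancherel's
  identity is not needed. Weak derivatives of the initial value are tested against smoothly truncated
  characters, and those of the solution are obtained by inverting the transform in \<open>L\<^sup>2\<close>.
\<close>

section \<open>The Fourier transform of integrable functions\<close>

text \<open>Were \<open>k2\<close> equal to \<open>k3\<close>, the differences
  \<open>y - \<theta>\<close> and \<open>z - \<phi>\<close> would solve an undamped wave equation of
  their own; for \<open>k2 \<noteq> k3\<close> the derivative of \<open>p\<close> involves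
  \<open>k2 y + k3 \<theta>\<close>, which is not a multiple of \<open>w\<close>, and through it the
  dissipation reaches \<open>m\<close> and then \<open>n\<close>. The obstacle is the choice of the
  weights. Each product contributes the negative square of the next member, but also products of
  other members, which must be absorbed at small and at large \<open>\<xi>\<close> alike. Powers of
  \<open>\<xi>\<close> and of \<open>1 + \<xi>^2\<close> bring every error into the form of a
  product of two controlled quantities, and powers of a small parameter \<open>\<tau>\<close> make
  its coefficient small. From \<open>v\<close> onward only \<open>|\<xi>|^3\<close> times a member
  is controlled near 0, and from \<open>w\<close> onward only \<open>1 / |\<xi>|\<close> times it at
  infinity; the squares are the two regimes of the rate. The exponents in the theorem are half of
  those for squared norms: scaling gives \<open>(1 + 2 j) / 6\<close>, the high frequencies give
  \<open>l\<close>. Only upper bounds are wanted, so inequalities suffice in passing to frequencies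
  and back.\<close>

abbreviation square_integrable :: "(real \<Rightarrow> 'a::real_normed_vector) \<Rightarrow> bool" where
  "square_integrable f \<equiv> integrable lborel (\<lambda>x. (norm (f x))\<^sup>2)"

abbreviation energy :: "(real \<Rightarrow> 'a::real_normed_vector) \<Rightarrow> real" where
  "energy f \<equiv> LBINT x. (norm (f x))\<^sup>2"

abbreviation nn_moment :: "nat \<Rightarrow> (real \<Rightarrow> 'a::real_normed_vector) \<Rightarrow> ennreal" where
  "nn_moment n f \<equiv> \<integral>\<^sup>+\<xi>. ennreal ((\<bar>\<xi>\<bar> ^ n * norm (f \<xi>))\<^sup>2) \<partial>lborel"

abbreviation decay_rate :: "real \<Rightarrow> real" where
  "decay_rate \<xi> \<equiv> \<xi> ^ 6 / (1 + \<xi>\<^sup>2) ^ 4"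

abbreviation nn_energy :: "(real \<Rightarrow> 'a::real_normed_vector) \<Rightarrow> ennreal" where
  "nn_energy f \<equiv> \<integral>\<^sup>+x. ennreal ((norm (f x))\<^sup>2) \<partial>lborel"

text \<open>The scalar counterpart of \<open>fourier\<close>, to which vectors are reduced
  componentwise. No factor stands in front of the integral, so the inverse carries
  \<open>1 / (2 * pi)\<close> and energies are compared with a factor \<open>2 * pi\<close>.\<close>

definition ft :: "(real \<Rightarrow> complex) \<Rightarrow> real \<Rightarrow> complex" where
  "ft f \<xi> = (LBINT x. iexp (- (\<xi> * x)) * f x)"

lemma ft_measurable [measurable]:
  assumes [measurable]: "f \<in> borel_measurable borel"
  shows "ft f \<in> borel_measurable borel"
  unfolding ft_def by measurable

lemma integrable_iexp_mult:
  fixes f :: "real \<Rightarrow> complex"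
  assumes "integrable lborel f"
  shows "integrable lborel (\<lambda>x. iexp (c * x) * f x)" "integrable lborel (\<lambda>x. iexp (- (c * x)) * f x)"
proof -
  show "integrable lborel (\<lambda>x. iexp (c * x) * f x)" for c
    by (rule Bochner_Integration.integrable_bound[OF assms])
       (use borel_measurable_integrable[OF assms] in \<open>auto simp: norm_mult\<close>)
  from this[of "-c"] show "integrable lborel (\<lambda>x. iexp (- (c * x)) * f x)" by simp
qed

lemma norm_ft_le:
  shows "norm (ft f \<xi>) \<le> (LBINT x. norm (f x))"
proof -
  have "norm (ft f \<xi>) \<le> (LBINT x. norm (iexp (- (\<xi> * x)) * f x))"
    unfolding ft_def by (rule integral_norm_bound)
  also have "\<dots> = (LBINT x. norm (f x))" by (simp add: norm_mult)
  finally show ?thesis .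
qed

text \<open>Every exchange of two integrals of complex functions below is justified by such a
  product majorant, usually a Gaussian or a test function times an integrable function.\<close>

lemma integrable_pair_dominated:
  fixes a b :: "real \<Rightarrow> complex" and h :: "real \<Rightarrow> real \<Rightarrow> complex"
  assumes a: "integrable lborel a" and b: "integrable lborel b"
    and [measurable]: "case_prod h \<in> borel_measurable (borel \<Otimes>\<^sub>M borel)"
    and le: "\<And>x y. norm (h x y) \<le> norm (a x) * norm (b y)"
  shows "integrable (lborel \<Otimes>\<^sub>M lborel) (case_prod h)"
proof -
  have [measurable]: "a \<in> borel_measurable borel" "b \<in> borel_measurable borel"
    using a b by (auto dest: borel_measurable_integrable)
  have "integrable (lborel \<Otimes>\<^sub>M lborel) (\<lambda>(x,y). a x * b y)"
  proof (rule lborel_pair.Fubini_integrable)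
    show "integrable lborel (\<lambda>x. LBINT y. norm (case (x, y) of (x, y) \<Rightarrow> a x * b y))"
      using a by (simp add: norm_mult)
    show "AE x in lborel. integrable lborel (\<lambda>y. case (x, y) of (x, y) \<Rightarrow> a x * b y)"
      using b by simp
  qed simp
  then show ?thesis
    by (rule Bochner_Integration.integrable_bound) (use le in \<open>auto simp: norm_mult\<close>)
qed

section \<open>Gaussian weights: regularized inversion and pairing of transforms\<close>

lemma integral_std_normal_iexp:
  "(LBINT x. of_real (std_normal_density x) * iexp (t * x)) = of_real (exp (- t\<^sup>2 / 2))"
proof -
  have "char std_normal_distribution t = (LBINT x. std_normal_density x *\<^sub>R iexp (t * x))"
    unfolding char_def by (rule integral_density) auto
  then show ?thesis by (simp add: char_std_normal_distribution scaleR_conv_of_real)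
qed

lemma integral_scaled_normal_iexp:
  assumes "e > 0"
  shows "(LBINT x. of_real (std_normal_density (e * x)) * iexp (- (x * a)))
    = of_real (sqrt (2 * pi) / e * std_normal_density (a / e))"
proof -
  have "(LBINT x. of_real (std_normal_density (e * x)) * iexp (- (x * a)))
    = \<bar>1/e\<bar> *\<^sub>R (LBINT x. of_real (std_normal_density (e * (0 + 1/e * x))) * iexp (- ((0 + 1/e * x) * a)))"
    by (rule lborel_integral_real_affine) (use assms in auto)
  also have "(LBINT x. of_real (std_normal_density (e * (0 + 1/e * x))) * iexp (- ((0 + 1/e * x) * a)))
     = (LBINT x. of_real (std_normal_density x) * iexp ((- a / e) * x))"
    using assms by (intro Bochner_Integration.integral_cong) (auto simp: field_simps)
  also have "\<dots> = of_real (exp (- (a/e)\<^sup>2 / 2))"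
    by (subst integral_std_normal_iexp) (simp add: power_divide)
  finally show ?thesis
    using assms by (simp add: std_normal_density_def scaleR_conv_of_real real_sqrt_mult)
qed

lemma integrable_scaled_normal:
  assumes "e > 0" shows "integrable lborel (\<lambda>x. complex_of_real (std_normal_density (e * x)))"
proof -
  have "integrable lborel (\<lambda>x. std_normal_density (0 + e * x))"
    by (rule lborel_integrable_real_affine) (use assms in auto)
  then show ?thesis by (simp add: integrable_of_real)
qed

text \<open>Inserting the definition of \<open>ft f\<close> and exchanging the integrals leaves the
  transform of the weight, which is again a Gaussian, concentrated at scale \<open>e\<close> around
  \<open>y\<close>. The limit \<open>e\<close> to 0 is the inversion formula; the weight makes the
  integral converge although \<open>ft f\<close> need not be integrable.\<close>

lemma gauss_smoothing:
  assumes e: "e > 0" and f: "integrable lborel f"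
  shows "(LBINT \<xi>. of_real (std_normal_density (e * \<xi>)) * iexp (\<xi> * y) * ft f \<xi>)
    = of_real (sqrt (2 * pi)) * (LBINT z. of_real (std_normal_density z) * f (y + e * z))"
proof -
  have [measurable]: "f \<in> borel_measurable borel" using f by (auto dest: borel_measurable_integrable)
  define h where "h = (\<lambda>\<xi> x. of_real (std_normal_density (e * \<xi>)) * iexp (- (\<xi> * (x - y))) * f x)"
  have I: "integrable (lborel \<Otimes>\<^sub>M lborel) (case_prod h)"
    by (rule integrable_pair_dominated[OF integrable_scaled_normal[OF e] f])
       (auto simp: h_def norm_mult)
  have "(LBINT \<xi>. of_real (std_normal_density (e * \<xi>)) * iexp (\<xi> * y) * ft f \<xi>)
     = (LBINT \<xi>. LBINT x. h \<xi> x)"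
  proof (rule Bochner_Integration.integral_cong)
    fix \<xi>
    have "of_real (std_normal_density (e * \<xi>)) * iexp (\<xi> * y) * ft f \<xi>
      = (LBINT x. (of_real (std_normal_density (e * \<xi>)) * iexp (\<xi> * y)) * (iexp (- (\<xi> * x)) * f x))"
      unfolding ft_def by simp
    also have "\<dots> = (LBINT x. h \<xi> x)"
      by (rule Bochner_Integration.integral_cong)
         (auto simp: h_def algebra_simps exp_add[symmetric] mult_exp_exp simp flip: of_real_mult)
    finally show "of_real (std_normal_density (e * \<xi>)) * iexp (\<xi> * y) * ft f \<xi> = (LBINT x. h \<xi> x)" .
  qed simp
  also have "\<dots> = (LBINT x. LBINT \<xi>. h \<xi> x)"
    using lborel_pair.Fubini_integral[OF I] by simp
  also have "\<dots> = (LBINT x. of_real (sqrt (2 * pi) / e * std_normal_density ((x - y) / e)) * f x)"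
    by (simp only: h_def integral_mult_left_zero integral_scaled_normal_iexp[OF e])
  also have "\<dots> = \<bar>e\<bar> *\<^sub>R (LBINT z. of_real (sqrt (2 * pi) / e * std_normal_density ((y + e * z - y) / e)) * f (y + e * z))"
    by (rule lborel_integral_real_affine) (use e in auto)
  also have "\<dots> = of_real (sqrt (2 * pi)) * (LBINT z. of_real (std_normal_density z) * f (y + e * z))"
    using e by (simp add: scaleR_conv_of_real mult.assoc del: of_real_mult add: of_real_mult)
  finally show ?thesis .
qed

lemma borel_measurable_cnj [measurable (raw)]:
  "g \<in> borel_measurable M \<Longrightarrow> (\<lambda>x. cnj (g x)) \<in> borel_measurable M"
  by (rule borel_measurable_continuous_on[of cnj]) (auto intro: continuous_intros)

text \<open>The transform of \<open>g\<close> is written out and the integral over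
  \<open>\<xi>\<close> is done by \<open>gauss_smoothing\<close>. The regularization thus falls on
  \<open>f\<close> alone, so that in the limit continuity is asked of \<open>f\<close> and not of
  \<open>g\<close>.\<close>

lemma gauss_parseval:
  assumes e: "e > 0" and f: "integrable lborel f" and g: "integrable lborel g"
  shows "(LBINT \<xi>. of_real (std_normal_density (e * \<xi>)) * (ft f \<xi> * cnj (ft g \<xi>)))
    = of_real (sqrt (2 * pi)) *
      (LBINT y. cnj (g y) * (LBINT z. of_real (std_normal_density z) * f (y + e * z)))"
proof -
  have [measurable]: "f \<in> borel_measurable borel" "g \<in> borel_measurable borel"
    using f g by (auto dest: borel_measurable_integrable)
  define h where "h = (\<lambda>\<xi> y. of_real (std_normal_density (e * \<xi>)) * ft f \<xi> * cnj (iexp (- (\<xi> * y)) * g y))"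
  have "integrable (lborel \<Otimes>\<^sub>M lborel) (case_prod h)"
  proof (rule integrable_pair_dominated)
    show "integrable lborel (\<lambda>\<xi>. of_real (LBINT x. norm (f x)) * complex_of_real (std_normal_density (e * \<xi>)))"
      using integrable_scaled_normal[OF e] by simp
    show "norm (h \<xi> y) \<le> norm (of_real (LBINT x. norm (f x)) * complex_of_real (std_normal_density (e * \<xi>))) * norm (g y)" for \<xi> y
      using norm_ft_le[of f \<xi>]
      by (auto simp: h_def norm_mult mult_ac intro!: mult_left_mono mult_right_mono)
  qed (use g in \<open>auto simp: h_def\<close>)
  note I = this
  have "(LBINT \<xi>. of_real (std_normal_density (e * \<xi>)) * (ft f \<xi> * cnj (ft g \<xi>)))
     = (LBINT \<xi>. LBINT y. h \<xi> y)"
    by (rule Bochner_Integration.integral_cong)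
       (auto simp: h_def ft_def[of g] mult.assoc simp flip: complex_cnj_mult integral_cnj)
  also have "\<dots> = (LBINT y. LBINT \<xi>. h \<xi> y)"
    using lborel_pair.Fubini_integral[OF I] by simp
  also have "\<dots> = (LBINT y. cnj (g y) * (LBINT \<xi>. of_real (std_normal_density (e * \<xi>)) * iexp (\<xi> * y) * ft f \<xi>))"
  proof (rule Bochner_Integration.integral_cong)
    fix y
    have "(LBINT \<xi>. h \<xi> y) = (LBINT \<xi>. cnj (g y) * (of_real (std_normal_density (e * \<xi>)) * iexp (\<xi> * y) * ft f \<xi>))"
      by (rule Bochner_Integration.integral_cong) (auto simp: h_def exp_cnj)
    then show "(LBINT \<xi>. h \<xi> y) = cnj (g y) * (LBINT \<xi>. of_real (std_normal_density (e * \<xi>)) * iexp (\<xi> * y) * ft f \<xi>)" by simp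
  qed simp
  finally show ?thesis
    by (simp only: gauss_smoothing[OF e f] integral_mult_right_zero
        mult.left_commute[of "cnj (g _)" "of_real (sqrt (2 * pi))"])
qed


section \<open>Limits and products under the integral, Bessel's inequality, Parseval's
  identity\<close>

lemma norm_integral_le_nn:
  fixes f :: "'a \<Rightarrow> 'b::{banach, second_countable_topology}"
  shows "ennreal (norm (integral\<^sup>L M f)) \<le> (\<integral>\<^sup>+x. norm (f x) \<partial>M)"
proof (cases "integrable M f")
  case True
  then show ?thesis by (rule integral_norm_bound_ennreal)
qed (simp add: not_integrable_integral_eq)

text \<open>Fatou's lemma for a sequence with uniformly bounded integrals. Working with extended
  integrals lets the integrability of the limit come out of the bound instead of being
  assumed.\<close>

lemma nn_integral_limit_le:
  fixes u :: "nat \<Rightarrow> 'a \<Rightarrow> ennreal"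
  assumes "\<And>n. u n \<in> borel_measurable M"
    and "AE x in M. (\<lambda>n. u n x) \<longlonglongrightarrow> v x"
    and "\<And>n. (\<integral>\<^sup>+x. u n x \<partial>M) \<le> C"
  shows "(\<integral>\<^sup>+x. v x \<partial>M) \<le> C"
proof -
  have "(\<integral>\<^sup>+x. v x \<partial>M) \<le> (\<integral>\<^sup>+x. liminf (\<lambda>n. u n x) \<partial>M)"
    by (rule nn_integral_mono_AE, use assms(2) in eventually_elim)
       (simp add: lim_imp_Liminf)
  also have "\<dots> \<le> liminf (\<lambda>n. \<integral>\<^sup>+x. u n x \<partial>M)"
    by (rule nn_integral_liminf) (use assms in auto)
  also have "\<dots> \<le> limsup (\<lambda>n. \<integral>\<^sup>+x. u n x \<partial>M)"
    by (simp add: Liminf_le_Limsup)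
  also have "\<dots> \<le> C"
    by (rule Limsup_bounded) (use assms in auto)
  finally show ?thesis .
qed

lemma integrable_mult_L2:
  fixes f g :: "'a \<Rightarrow> complex"
  assumes [measurable]: "f \<in> borel_measurable M" "g \<in> borel_measurable M"
    and "integrable M (\<lambda>x. (norm (f x))\<^sup>2)" "integrable M (\<lambda>x. (norm (g x))\<^sup>2)"
  shows "integrable M (\<lambda>x. f x * g x)"
proof (rule Bochner_Integration.integrable_bound)
  show "integrable M (\<lambda>x. (norm (f x))\<^sup>2 + (norm (g x))\<^sup>2)" using assms by simp
  have "norm (f x * g x) \<le> (norm (f x))\<^sup>2 + (norm (g x))\<^sup>2" for x
  proof -
    have "2 * (norm (f x) * norm (g x)) \<le> (norm (f x))\<^sup>2 + (norm (g x))\<^sup>2"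
      using sum_squares_bound[of "norm (f x)" "norm (g x)"] by (simp only: mult.assoc)
    moreover have "0 \<le> norm (f x) * norm (g x)" by simp
    ultimately show ?thesis unfolding norm_mult by linarith
  qed
  then show "AE x in M. norm (f x * g x) \<le> norm ((norm (f x))\<^sup>2 + (norm (g x))\<^sup>2)" by simp
qed measurable

lemma nn_integral_std_normal: "(\<integral>\<^sup>+z. ennreal (std_normal_density z) \<partial>lborel) = 1"
  by (simp add: nn_integral_eq_integral)

lemma nn_integral_translate:
  fixes f :: "real \<Rightarrow> ennreal"
  assumes [measurable]: "f \<in> borel_measurable borel"
  shows "(\<integral>\<^sup>+y. f (y + a) \<partial>lborel) = (\<integral>\<^sup>+y. f y \<partial>lborel)"
  using nn_integral_real_affine[of f 1 a] by (simp add: add.commute)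

text \<open>
  The autocorrelation of \<open>f\<close> is largest at the origin, so Bessel's inequality follows without the
  continuity of translations in \<open>L\<^sup>2\<close>.
\<close>

lemma gauss_autocorrelation_le:
  assumes [measurable]: "f \<in> borel_measurable borel"
  shows "ennreal (norm (LBINT y. cnj (f y) * (LBINT z. of_real (std_normal_density z) * f (y + e * z))))
    \<le> (nn_energy f)" (is "?L \<le> ?A")
proof -
  let ?N = std_normal_density
  have "?L \<le> (\<integral>\<^sup>+y. norm (cnj (f y) * (LBINT z. of_real (?N z) * f (y + e * z))) \<partial>lborel)"
    by (rule norm_integral_le_nn)
  also have "\<dots> \<le> (\<integral>\<^sup>+y. \<integral>\<^sup>+z. ennreal (?N z * (norm (f y))\<^sup>2 / 2 + ?N z * (norm (f (y + e * z)))\<^sup>2 / 2) \<partial>lborel \<partial>lborel)"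
  proof (rule nn_integral_mono)
    fix y
    have "ennreal (norm (LBINT z. cnj (f y) * (of_real (?N z) * f (y + e * z))))
      \<le> (\<integral>\<^sup>+z. norm (cnj (f y) * (of_real (?N z) * f (y + e * z))) \<partial>lborel)"
      by (rule norm_integral_le_nn)
    also have "\<dots> \<le> (\<integral>\<^sup>+z. ennreal (?N z * (norm (f y))\<^sup>2 / 2 + ?N z * (norm (f (y + e * z)))\<^sup>2 / 2) \<partial>lborel)"
    proof (intro nn_integral_mono ennreal_leI)
      fix z
      have "norm (f y) * norm (f (y + e * z)) \<le> (norm (f y))\<^sup>2 / 2 + (norm (f (y + e * z)))\<^sup>2 / 2"
        using sum_squares_bound[of "norm (f y)" "norm (f (y + e * z))"] by simp
      then have "?N z * (norm (f y) * norm (f (y + e * z))) \<le> ?N z * ((norm (f y))\<^sup>2 / 2 + (norm (f (y + e * z)))\<^sup>2 / 2)"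
        by (rule mult_left_mono) simp
      then show "norm (cnj (f y) * (of_real (?N z) * f (y + e * z)))
        \<le> ?N z * (norm (f y))\<^sup>2 / 2 + ?N z * (norm (f (y + e * z)))\<^sup>2 / 2"
        by (simp add: norm_mult algebra_simps)
    qed
    finally show "ennreal (norm (cnj (f y) * (LBINT z. of_real (?N z) * f (y + e * z)))) \<le> \<dots>"
      by simp
  qed
  \<comment> \<open>The first half does not involve \<open>z\<close> in \<open>f\<close>, and the
    second is invariant under translation in \<open>y\<close> once the integrals are exchanged.
    Since the density has mass 1, each gives half of the energy, whatever \<open>e\<close>
    is.\<close>
  also have "\<dots> = (\<integral>\<^sup>+y. \<integral>\<^sup>+z. ennreal (?N z) * ennreal ((norm (f y))\<^sup>2 / 2) \<partial>lborel \<partial>lborel)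
      + (\<integral>\<^sup>+y. \<integral>\<^sup>+z. ennreal (?N z) * ennreal ((norm (f (y + e * z)))\<^sup>2 / 2) \<partial>lborel \<partial>lborel)"
    by (simp add: nn_integral_add ennreal_mult flip: times_divide_eq_right)
  also have "(\<integral>\<^sup>+y. \<integral>\<^sup>+z. ennreal (?N z) * ennreal ((norm (f y))\<^sup>2 / 2) \<partial>lborel \<partial>lborel)
      = (\<integral>\<^sup>+y. ennreal ((norm (f y))\<^sup>2 / 2) \<partial>lborel)"
    by (simp add: nn_integral_multc nn_integral_std_normal)
  also have "(\<integral>\<^sup>+y. \<integral>\<^sup>+z. ennreal (?N z) * ennreal ((norm (f (y + e * z)))\<^sup>2 / 2) \<partial>lborel \<partial>lborel)
      = (\<integral>\<^sup>+z. \<integral>\<^sup>+y. ennreal (?N z) * ennreal ((norm (f (y + e * z)))\<^sup>2 / 2) \<partial>lborel \<partial>lborel)"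
    by (rule lborel_pair.Fubini') measurable
  also have "\<dots> = (\<integral>\<^sup>+z. ennreal (?N z) * (\<integral>\<^sup>+y. ennreal ((norm (f y))\<^sup>2 / 2) \<partial>lborel) \<partial>lborel)"
    by (simp add: nn_integral_cmult nn_integral_translate[of "\<lambda>y. ennreal ((norm (f y))\<^sup>2 / 2)"])
  also have "\<dots> = (\<integral>\<^sup>+y. ennreal ((norm (f y))\<^sup>2 / 2) \<partial>lborel)"
    by (simp add: nn_integral_multc nn_integral_std_normal)
  also have "(\<integral>\<^sup>+y. ennreal ((norm (f y))\<^sup>2 / 2) \<partial>lborel) + (\<integral>\<^sup>+y. ennreal ((norm (f y))\<^sup>2 / 2) \<partial>lborel) = ?A"
    by (subst nn_integral_add[symmetric]) (auto simp flip: ennreal_plus)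
  finally show ?thesis .
qed

text \<open>The factor \<open>sqrt (2 * pi)\<close> normalizes the weight to 1 at the origin, so
  that it stays below 1 and tends to 1 everywhere as its width \<open>Suc n\<close> grows.\<close>

abbreviation gauss_weight :: "nat \<Rightarrow> real \<Rightarrow> real" where
  "gauss_weight n x \<equiv> sqrt (2 * pi) * std_normal_density (inverse (real (Suc n)) * x)"

lemma gauss_weight_tendsto: "(\<lambda>n. gauss_weight n x) \<longlonglongrightarrow> 1"
proof -
  have "(\<lambda>n. exp (- (inverse (real (Suc n)) * x)\<^sup>2 / 2)) \<longlonglongrightarrow> exp (- (0 * x)\<^sup>2 / 2)"
    by (intro tendsto_intros LIMSEQ_inverse_real_of_nat) auto
  then show ?thesis by (simp add: std_normal_density_def)
qed

lemma normal_density_le: "sqrt (2 * pi) * std_normal_density x \<le> 1"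
  by (simp add: std_normal_density_def)

text \<open>By \<open>gauss_parseval\<close> with both functions equal to \<open>f\<close>, the
  weighted energy of the transform is a multiple of a Gaussian mean of the autocorrelation of
  \<open>f\<close>, hence bounded independently of the weight; Fatou's lemma removes the weight. One
  factor \<open>sqrt (2 * pi)\<close> comes from the normalization of the weight, the other from the
  pairing formula.\<close>

lemma bessel:
  assumes f: "integrable lborel f"
  shows "(nn_energy (ft f)) \<le> ennreal (2 * pi) * (nn_energy f)"
proof (rule nn_integral_limit_le[where u = "\<lambda>n \<xi>. ennreal (gauss_weight n \<xi> * (norm (ft f \<xi>))\<^sup>2)"])
  have [measurable]: "f \<in> borel_measurable borel" using f by (auto dest: borel_measurable_integrable)
  show "(\<lambda>\<xi>. ennreal (gauss_weight n \<xi> * (norm (ft f \<xi>))\<^sup>2)) \<in> borel_measurable lborel" for n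
    by measurable
  show "AE \<xi> in lborel. (\<lambda>n. ennreal (gauss_weight n \<xi> * (norm (ft f \<xi>))\<^sup>2))
     \<longlonglongrightarrow> ennreal ((norm (ft f \<xi>))\<^sup>2)"
  proof (rule AE_I2)
    fix \<xi>
    have "(\<lambda>n. ennreal (gauss_weight n \<xi> * (norm (ft f \<xi>))\<^sup>2))
     \<longlonglongrightarrow> ennreal (1 * (norm (ft f \<xi>))\<^sup>2)"
      by (intro tendsto_ennrealI tendsto_mult gauss_weight_tendsto tendsto_const)
    then show "(\<lambda>n. ennreal (gauss_weight n \<xi> * (norm (ft f \<xi>))\<^sup>2))
     \<longlonglongrightarrow> ennreal ((norm (ft f \<xi>))\<^sup>2)" by simp
  qed
  fix n
  define e where "e = inverse (real (Suc n))"
  have e: "e > 0" by (simp add: e_def)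
  let ?h = "\<lambda>\<xi>. std_normal_density (e * \<xi>) * (norm (ft f \<xi>))\<^sup>2"
  define R where "R = (LBINT y. cnj (f y) * (LBINT z. of_real (std_normal_density z) * f (y + e * z)))"
  have int: "integrable lborel ?h"
  proof (rule Bochner_Integration.integrable_bound)
    show "integrable lborel (\<lambda>\<xi>. (LBINT x. norm (f x))\<^sup>2 * norm (complex_of_real (std_normal_density (e * \<xi>))))"
      using integrable_scaled_normal[OF e] by (intro integrable_mult_right integrable_norm)
    show "AE x in lborel. norm (?h x) \<le> norm ((LBINT x. norm (f x))\<^sup>2 * norm (complex_of_real (std_normal_density (e * x))))"
      using norm_ft_le[of f] by (intro AE_I2) (auto intro!: mult_left_mono power_mono simp: mult.commute abs_mult)
  qed measurable
  have "of_real (LBINT \<xi>. ?h \<xi>) = (LBINT \<xi>. complex_of_real (?h \<xi>))"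
    by (simp only: integral_complex_of_real)
  also have "\<dots> = of_real (sqrt (2 * pi)) * R"
    unfolding R_def gauss_parseval[OF e f f, symmetric]
    by (rule Bochner_Integration.integral_cong) (auto simp: complex_norm_square simp flip: of_real_power)
  \<comment> \<open>The weighted energy is real and nonnegative, so it equals the modulus of the
    right-hand side, and \<open>R\<close> need not be shown to be real.\<close>
  finally have "norm (of_real (LBINT \<xi>. ?h \<xi>) :: complex) = sqrt (2 * pi) * norm R"
    by (simp add: norm_mult)
  then have eq: "(LBINT \<xi>. ?h \<xi>) = sqrt (2 * pi) * norm R"
    by (simp add: abs_of_nonneg integral_nonneg)
  have "(\<integral>\<^sup>+\<xi>. ennreal (sqrt (2 * pi) * std_normal_density (e * \<xi>) * (norm (ft f \<xi>))\<^sup>2) \<partial>lborel)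
     = ennreal (sqrt (2 * pi)) * (\<integral>\<^sup>+\<xi>. ennreal (?h \<xi>) \<partial>lborel)"
    by (subst nn_integral_cmult[symmetric]) (auto simp: ennreal_mult mult.assoc)
  also have "(\<integral>\<^sup>+\<xi>. ennreal (?h \<xi>) \<partial>lborel) = ennreal (sqrt (2 * pi) * norm R)"
    using int by (simp add: nn_integral_eq_integral eq)
  also have "ennreal (sqrt (2 * pi)) * \<dots> = ennreal (2 * pi) * ennreal (norm R)"
    by (simp add: ennreal_mult'[symmetric] mult.assoc[symmetric])
  also have "\<dots> \<le> ennreal (2 * pi) * (nn_energy f)"
    unfolding R_def by (rule mult_left_mono[OF gauss_autocorrelation_le]) auto
  finally show "(\<integral>\<^sup>+\<xi>. ennreal (gauss_weight n \<xi> * (norm (ft f \<xi>))\<^sup>2) \<partial>lborel)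
     \<le> ennreal (2 * pi) * (nn_energy f)" by (simp only: e_def)
qed

lemma nn_integral_square:
  assumes "integrable M (\<lambda>x. (norm (f x))\<^sup>2)"
  shows "(\<integral>\<^sup>+x. ennreal ((norm (f x))\<^sup>2) \<partial>M) = ennreal (LINT x|M. (norm (f x))\<^sup>2)"
  by (rule nn_integral_eq_integral) (use assms in auto)

lemma square_integrable_ft:
  assumes f: "integrable lborel f" and f2: "square_integrable f"
  shows "square_integrable (ft f)"
    and "energy (ft f) \<le> 2 * pi * energy f"
proof -
  have [measurable]: "f \<in> borel_measurable borel" using f by (auto dest: borel_measurable_integrable)
  have *: "(nn_energy (ft f)) \<le> ennreal (2 * pi * energy f)"
    using bessel[OF f] by (simp add: nn_integral_square[OF f2] ennreal_mult')
  show 1: "square_integrable (ft f)"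
    by (rule integrableI_bounded) (use * in \<open>auto simp: less_top[symmetric] top_unique\<close>)
  show "energy (ft f) \<le> 2 * pi * energy f"
    using * unfolding nn_integral_square[OF 1] by (subst (asm) ennreal_le_iff) auto
qed

lemma gauss_mean_tendsto:
  assumes cont: "continuous_on UNIV f" and bound: "\<And>x. norm (f x :: complex) \<le> B"
  shows "(\<lambda>n. LBINT z. of_real (std_normal_density z) * f (y + inverse (real (Suc n)) * z)) \<longlonglongrightarrow> f y"
proof -
  have [measurable]: "f \<in> borel_measurable borel" using cont by (rule borel_measurable_continuous_onI)
  have "(\<lambda>n. LBINT z. of_real (std_normal_density z) * f (y + inverse (real (Suc n)) * z))
     \<longlonglongrightarrow> (LBINT z. of_real (std_normal_density z) * f y)"
  proof (rule integral_dominated_convergence[where w = "\<lambda>z. std_normal_density z * B"])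
    show "AE z in lborel. (\<lambda>n. of_real (std_normal_density z) * f (y + inverse (real (Suc n)) * z))
        \<longlonglongrightarrow> of_real (std_normal_density z) * f y"
    proof (rule AE_I2)
      fix z
      have "(\<lambda>n. f (y + inverse (real (Suc n)) * z)) \<longlonglongrightarrow> f (y + 0 * z)"
        by (rule continuous_on_tendsto_compose[OF cont])
           (intro tendsto_intros LIMSEQ_inverse_real_of_nat, auto)
      then show "(\<lambda>n. of_real (std_normal_density z) * f (y + inverse (real (Suc n)) * z))
        \<longlonglongrightarrow> of_real (std_normal_density z) * f y" by (intro tendsto_intros) simp
    qed
  qed (use bound in \<open>auto simp: norm_mult intro!: mult_left_mono\<close>)
  also have "(LBINT z. of_real (std_normal_density z) * f y) = f y"
    by (simp add: integral_complex_of_real)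
  finally show ?thesis .
qed

text \<open>Both sides are limits of the two sides of \<open>gauss_parseval\<close>. On the left the
  product of the transforms dominates, being integrable by Bessel's inequality; on the right the
  Gaussian means of the continuous bounded \<open>f\<close> converge pointwise. In the application
  \<open>f\<close> is a test function and \<open>g\<close> a truncation, which may jump.\<close>

lemma parseval:
  assumes f: "integrable lborel f" and f2: "square_integrable f"
    and cont: "continuous_on UNIV f" and bound: "\<And>x. norm (f x) \<le> B"
    and g: "integrable lborel g" and g2: "square_integrable g"
  shows "(LBINT \<xi>. ft f \<xi> * cnj (ft g \<xi>)) = of_real (2 * pi) * (LBINT x. f x * cnj (g x))"
proof -
  have [measurable]: "f \<in> borel_measurable borel" "g \<in> borel_measurable borel"
    using f g by (auto dest: borel_measurable_integrable)
  let ?N = std_normal_density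
  let ?e = "\<lambda>n. inverse (real (Suc n))"
  have B: "B \<ge> 0" using bound[of 0] by (meson norm_ge_zero order_trans)
  have prod: "integrable lborel (\<lambda>\<xi>. ft f \<xi> * cnj (ft g \<xi>))"
    by (rule integrable_mult_L2) (use square_integrable_ft[OF f f2] square_integrable_ft[OF g g2] in auto)
  have "(\<lambda>n. LBINT \<xi>. of_real (gauss_weight n \<xi>) * (ft f \<xi> * cnj (ft g \<xi>)))
      \<longlonglongrightarrow> (LBINT \<xi>. ft f \<xi> * cnj (ft g \<xi>))"
  proof (rule integral_dominated_convergence[where w = "\<lambda>\<xi>. norm (ft f \<xi> * cnj (ft g \<xi>))"])
    show "AE \<xi> in lborel. (\<lambda>n. of_real (gauss_weight n \<xi>) * (ft f \<xi> * cnj (ft g \<xi>)))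
        \<longlonglongrightarrow> ft f \<xi> * cnj (ft g \<xi>)"
    proof (rule AE_I2)
      fix \<xi>
      have "(\<lambda>n. of_real (gauss_weight n \<xi>) * (ft f \<xi> * cnj (ft g \<xi>)))
        \<longlonglongrightarrow> of_real 1 * (ft f \<xi> * cnj (ft g \<xi>))"
        by (intro tendsto_mult tendsto_of_real gauss_weight_tendsto tendsto_const)
      then show "(\<lambda>n. of_real (gauss_weight n \<xi>) * (ft f \<xi> * cnj (ft g \<xi>)))
        \<longlonglongrightarrow> ft f \<xi> * cnj (ft g \<xi>)" by simp
    qed
    show "AE \<xi> in lborel. norm (of_real (gauss_weight n \<xi>) * (ft f \<xi> * cnj (ft g \<xi>)))
       \<le> norm (ft f \<xi> * cnj (ft g \<xi>))" for n
    proof (rule AE_I2)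
      fix \<xi>
      have "\<bar>gauss_weight n \<xi>\<bar> * norm (ft f \<xi> * cnj (ft g \<xi>)) \<le> 1 * norm (ft f \<xi> * cnj (ft g \<xi>))"
        by (rule mult_right_mono) (use normal_density_le[of "?e n * \<xi>"] in \<open>auto simp: abs_of_nonneg\<close>)
      then show "norm (of_real (gauss_weight n \<xi>) * (ft f \<xi> * cnj (ft g \<xi>))) \<le> norm (ft f \<xi> * cnj (ft g \<xi>))"
        by (simp only: norm_mult norm_of_real)
    qed
  qed (use prod in \<open>auto\<close>)
  moreover have "(LBINT \<xi>. of_real (gauss_weight n \<xi>) * (ft f \<xi> * cnj (ft g \<xi>)))
     = of_real (2 * pi) * (LBINT y. cnj (g y) * (LBINT z. of_real (?N z) * f (y + ?e n * z)))" for n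
  proof -
    have "(LBINT \<xi>. of_real (gauss_weight n \<xi>) * (ft f \<xi> * cnj (ft g \<xi>)))
      = of_real (sqrt (2 * pi)) * (LBINT \<xi>. of_real (?N (?e n * \<xi>)) * (ft f \<xi> * cnj (ft g \<xi>)))"
      by (simp only: of_real_mult mult.assoc integral_mult_right_zero)
    also have "\<dots> = of_real (sqrt (2 * pi) * sqrt (2 * pi)) * (LBINT y. cnj (g y) * (LBINT z. of_real (?N z) * f (y + ?e n * z)))"
      by (subst gauss_parseval[OF _ f g]) (simp_all only: of_real_mult mult.assoc inverse_positive_iff_positive of_nat_0_less_iff zero_less_Suc)
    finally show ?thesis by simp
  qed
  moreover have "(\<lambda>n. of_real (2 * pi) * (LBINT y. cnj (g y) * (LBINT z. of_real (?N z) * f (y + ?e n * z))))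
     \<longlonglongrightarrow> of_real (2 * pi) * (LBINT y. cnj (g y) * f y)"
  proof (intro tendsto_mult tendsto_const integral_dominated_convergence[where w = "\<lambda>y. norm (g y) * B"])
    show "AE y in lborel. (\<lambda>n. cnj (g y) * (LBINT z. of_real (?N z) * f (y + ?e n * z))) \<longlonglongrightarrow> cnj (g y) * f y"
      by (intro AE_I2 tendsto_mult tendsto_const gauss_mean_tendsto[OF cont bound])
    have "norm (LBINT z. of_real (?N z) * f (y + ?e n * z)) \<le> B" for n y
    proof -
      have "norm (LBINT z. of_real (?N z) * f (y + ?e n * z)) \<le> (LBINT z. norm (of_real (?N z) * f (y + ?e n * z)))"
        by (rule integral_norm_bound)
      also have "\<dots> \<le> (LBINT z. ?N z * B)"
        by (rule integral_mono') (auto simp: norm_mult intro!: mult_left_mono mult_nonneg_nonneg bound B)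
      also have "\<dots> = B" by simp
      finally show ?thesis .
    qed
    then show "AE y in lborel. norm (cnj (g y) * (LBINT z. of_real (?N z) * f (y + ?e n * z))) \<le> norm (g y) * B" for n
      by (auto simp: norm_mult intro!: mult_left_mono)
  qed (use g in auto)
  ultimately have "(LBINT \<xi>. ft f \<xi> * cnj (ft g \<xi>)) = of_real (2 * pi) * (LBINT y. cnj (g y) * f y)"
    by (simp only: LIMSEQ_unique)
  then show ?thesis by (simp only: mult.commute[of "cnj (g _)"])
qed

section \<open>Square-integrable functions\<close>


lemma square_integrable_bound:
  fixes f :: "'a \<Rightarrow> complex"
  assumes [measurable]: "f \<in> borel_measurable M" and "(\<integral>\<^sup>+x. ennreal ((norm (f x))\<^sup>2) \<partial>M) \<le> ennreal C" "C \<ge> 0"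
  shows "integrable M (\<lambda>x. (norm (f x))\<^sup>2)" "(LINT x|M. (norm (f x))\<^sup>2) \<le> C"
proof -
  show *: "integrable M (\<lambda>x. (norm (f x))\<^sup>2)"
    by (rule integrableI_bounded) (use assms in \<open>auto simp: less_top[symmetric] top_unique\<close>)
  show "(LINT x|M. (norm (f x))\<^sup>2) \<le> C"
    using assms(2,3) unfolding nn_integral_square[OF *] by (simp add: ennreal_le_iff)
qed

lemma norm_add_square_le: "(norm (a + b))\<^sup>2 \<le> 2 * (norm a)\<^sup>2 + 2 * (norm (b::'a::real_normed_vector))\<^sup>2"
proof -
  have "(norm (a + b))\<^sup>2 \<le> (norm a + norm b)\<^sup>2"
    by (rule power_mono[OF norm_triangle_ineq]) simp
  also have "\<dots> \<le> 2 * (norm a)\<^sup>2 + 2 * (norm b)\<^sup>2"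
    using sum_squares_bound[of "norm a" "norm b"] by (simp add: power2_sum)
  finally show ?thesis .
qed

lemma norm_diff_square_le: "(norm (a - b))\<^sup>2 \<le> 2 * (norm a)\<^sup>2 + 2 * (norm (b::'a::real_normed_vector))\<^sup>2"
  using norm_add_square_le[of a "-b"] by simp

lemma square_integrable_diff:
  fixes f g :: "'a \<Rightarrow> complex"
  assumes [measurable]: "f \<in> borel_measurable M" "g \<in> borel_measurable M"
    and "integrable M (\<lambda>x. (norm (f x))\<^sup>2)" "integrable M (\<lambda>x. (norm (g x))\<^sup>2)"
  shows "integrable M (\<lambda>x. (norm (f x - g x))\<^sup>2)"
  by (rule Bochner_Integration.integrable_bound[where f = "\<lambda>x. 2 * (norm (f x))\<^sup>2 + 2 * (norm (g x))\<^sup>2"])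
     (use assms norm_diff_square_le in auto)

lemma ennreal_tendsto_0_le:
  fixes f g :: "nat \<Rightarrow> ennreal"
  assumes "g \<longlonglongrightarrow> 0" "\<And>n. f n \<le> g n"
  shows "f \<longlonglongrightarrow> 0"
  by (rule tendsto_sandwich[where f = "\<lambda>_. 0" and h = g]) (use assms in auto)

text \<open>The Gaussian density is square integrable and has no zero. Multiplication by it turns a
  Cauchy sequence in \<open>L2\<close> into one in \<open>L1\<close>, which has a subsequence
  converging almost everywhere, and dividing it out again gives \<open>G\<close>. Fatou's lemma then
  yields convergence of the whole sequence. The Cauchy condition has the form
  \<open>b m + b n\<close> because in the application \<open>b n\<close> is the squared distance to
  a common limit.\<close>

lemma L2_complete:
  fixes g :: "nat \<Rightarrow> real \<Rightarrow> complex"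
  assumes meas [measurable]: "\<And>n. g n \<in> borel_measurable borel"
    and sq: "\<And>n. square_integrable (g n)"
    and cauchy: "\<And>m n. (energy (\<lambda>x. g m x - g n x)) \<le> b m + b n"
    and b: "b \<longlonglongrightarrow> 0"
  obtains G r where "G \<in> borel_measurable borel" "square_integrable G"
    "(\<lambda>n. nn_energy (\<lambda>x. g n x - G x)) \<longlonglongrightarrow> 0"
    "AE x in lborel. (\<lambda>k. g (r k) x) \<longlonglongrightarrow> G x"
proof -
  let ?N = std_normal_density
  have bnn: "b n \<ge> 0" for n using cauchy[of n n] by simp
  define s where "s n x = of_real (?N x) * g n x" for n x
  have N2: "square_integrable (\<lambda>x. complex_of_real (?N x))"
  proof (rule Bochner_Integration.integrable_bound[where f = ?N])
    have "sqrt (2 * pi) \<ge> 1" using pi_gt3 by (simp add: real_le_rsqrt)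
    then have "?N x \<le> 1" for x
      using mult_right_mono[of 1 "sqrt (2 * pi)" "?N x"] normal_density_le[of x] by simp
    then have "?N x * ?N x \<le> ?N x" for x by (simp add: mult_left_le)
    then show "AE x in lborel. norm ((norm (complex_of_real (?N x)))\<^sup>2) \<le> norm (?N x)"
      by (auto simp: power2_eq_square abs_mult)
  qed auto
  define A where "A = energy (\<lambda>x. complex_of_real (?N x))"
  have A: "A \<ge> 0" unfolding A_def by simp
  have d2: "square_integrable (\<lambda>x. g i x - g j x)" for i j
    by (rule square_integrable_diff) (use sq in auto)
  have ints: "integrable lborel (s n)" for n
    unfolding s_def by (rule integrable_mult_L2) (use sq N2 in auto)
  have "\<exists>M. \<forall>i\<ge>M. \<forall>j\<ge>M. (LBINT x. norm (s i x - s j x)) < e" if e: "e > 0" for e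
  proof -
    \<comment> \<open>Young's inequality with parameter \<open>\<delta>\<close> splits the product
      of the density and the difference: the part of the density is at most \<open>e / 2\<close>,
      the other less than \<open>e / 4\<close>.\<close>
    define \<delta> where "\<delta> = e / (A + 1)"
    have \<delta>: "\<delta> > 0" using e A by (simp add: \<delta>_def)
    have "\<forall>\<^sub>F n in sequentially. b n < \<delta> * e / 4"
      by (rule order_tendstoD(2)[OF b]) (use e \<delta> in simp)
    then obtain M where M: "\<And>n. n \<ge> M \<Longrightarrow> b n < \<delta> * e / 4" by (auto simp: eventually_sequentially)
    have "(LBINT x. norm (s i x - s j x)) < e" if "i \<ge> M" "j \<ge> M" for i j
    proof -
      have "(LBINT x. norm (s i x - s j x))
        \<le> (LBINT x. (\<delta> / 2) * (norm (complex_of_real (?N x)))\<^sup>2 + (1 / (2 * \<delta>)) * (norm (g i x - g j x))\<^sup>2)"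
      proof (rule integral_mono)
        show "integrable lborel (\<lambda>x. norm (s i x - s j x))" using ints by (intro integrable_norm) simp
        show "integrable lborel (\<lambda>x. (\<delta> / 2) * (norm (complex_of_real (?N x)))\<^sup>2 + (1 / (2 * \<delta>)) * (norm (g i x - g j x))\<^sup>2)"
          using N2 d2 by simp
        fix x
        have "norm (s i x - s j x) = ?N x * norm (g i x - g j x)"
          by (simp add: s_def norm_mult flip: right_diff_distrib)
        also have "\<dots> \<le> (\<delta> / 2) * (?N x)\<^sup>2 + (1 / (2 * \<delta>)) * (norm (g i x - g j x))\<^sup>2"
          using zero_le_power2[of "\<delta> * ?N x - norm (g i x - g j x)"] \<delta>
          by (simp add: field_simps power2_eq_square)
        finally show "norm (s i x - s j x) \<le> (\<delta> / 2) * (norm (complex_of_real (?N x)))\<^sup>2 + (1 / (2 * \<delta>)) * (norm (g i x - g j x))\<^sup>2"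
          by simp
      qed
      also have "\<dots> = (\<delta> / 2) * A + (1 / (2 * \<delta>)) * energy (\<lambda>x. g i x - g j x)"
        unfolding A_def using N2 d2 by simp
      also have "\<dots> \<le> (\<delta> / 2) * A + (1 / (2 * \<delta>)) * (b i + b j)"
        using \<delta> cauchy by (intro add_left_mono mult_left_mono) auto
      also have "\<dots> < (\<delta> / 2) * A + (1 / (2 * \<delta>)) * (\<delta> * e / 2)"
        using \<delta> M[OF that(1)] M[OF that(2)] by (intro add_strict_left_mono mult_strict_left_mono) auto
      also have "\<dots> = (\<delta> / 2) * A + e / 4" using \<delta> by simp
      also have "(\<delta> / 2) * A \<le> e / 2" using A e by (simp add: \<delta>_def field_simps)
      finally show ?thesis using e by simp
    qed
    then show ?thesis by blast
  qed
  then obtain r where r: "strict_mono r" "AE x in lborel. Cauchy (\<lambda>i. s (r i) x)"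
    by (rule cauchy_L1_AE_cauchy_subseq[OF ints]) blast
  define G where "G x = lim (\<lambda>k. g (r k) x)" for x
  have G [measurable]: "G \<in> borel_measurable borel" unfolding G_def by measurable
  have lim: "AE x in lborel. (\<lambda>k. g (r k) x) \<longlonglongrightarrow> G x"
    using r(2)
  proof eventually_elim
    fix x assume "Cauchy (\<lambda>i. s (r i) x)"
    then obtain l where "(\<lambda>i. s (r i) x) \<longlonglongrightarrow> l" using Cauchy_convergent convergent_def by blast
    then have "(\<lambda>i. inverse (of_real (?N x)) * s (r i) x) \<longlonglongrightarrow> inverse (of_real (?N x)) * l"
      by (intro tendsto_intros)
    moreover have "?N x \<noteq> 0" by (simp add: std_normal_density_def)
    then have "inverse (of_real (?N x)) * s (r i) x = g (r i) x" for i by (simp add: s_def)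
    ultimately have "(\<lambda>i. g (r i) x) \<longlonglongrightarrow> inverse (of_real (?N x)) * l" by simp
    then show "(\<lambda>k. g (r k) x) \<longlonglongrightarrow> G x" unfolding G_def by (simp add: limI)
  qed
  \<comment> \<open>Fatou's lemma in the second index, along the almost everywhere convergent
    subsequence. The shift by \<open>M\<close> makes the second summand of the Cauchy bound smaller
    than \<open>e\<close>.\<close>
  have le: "(nn_energy (\<lambda>x. g n x - G x)) \<le> ennreal (b n + e)" if e: "e > 0" for n e
  proof -
    have "\<forall>\<^sub>F n in sequentially. b n < e" by (rule order_tendstoD(2)[OF b e])
    then obtain M where M: "\<And>n. n \<ge> M \<Longrightarrow> b n < e" by (auto simp: eventually_sequentially)
    show ?thesis
    proof (rule nn_integral_limit_le[where u = "\<lambda>k x. ennreal ((norm (g n x - g (r (k + M)) x))\<^sup>2)"])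
      show "AE x in lborel. (\<lambda>k. ennreal ((norm (g n x - g (r (k + M)) x))\<^sup>2)) \<longlonglongrightarrow> ennreal ((norm (g n x - G x))\<^sup>2)"
        using lim by eventually_elim (intro tendsto_ennrealI tendsto_intros LIMSEQ_ignore_initial_segment)
      fix k
      have "r (k + M) \<ge> M" using seq_suble[OF r(1), of "k + M"] by simp
      then show "(nn_energy (\<lambda>x. g n x - g (r (k + M)) x)) \<le> ennreal (b n + e)"
        unfolding nn_integral_square[OF d2] using cauchy[of n "r (k + M)"] M[of "r (k + M)"]
        by (intro ennreal_leI) auto
    qed measurable
  qed
  show ?thesis
  proof
    show "G \<in> borel_measurable borel" by fact
    have i: "square_integrable (\<lambda>x. g 0 x - G x)"
      by (rule square_integrable_bound(1)[OF _ le[of 1 0]]) (use bnn[of 0] in auto)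
    have "square_integrable (\<lambda>x. g 0 x - (g 0 x - G x))"
      by (rule square_integrable_diff) (use i sq in auto)
    then show "square_integrable G" by simp
    have le': "(nn_energy (\<lambda>x. g n x - G x)) \<le> ennreal (b n + inverse (real (Suc n)))" for n
      by (rule le) simp
    have "(\<lambda>n. ennreal (b n + inverse (real (Suc n)))) \<longlonglongrightarrow> ennreal (0 + 0)"
      by (intro tendsto_ennrealI tendsto_intros b LIMSEQ_inverse_real_of_nat)
    then have "(\<lambda>n. ennreal (b n + inverse (real (Suc n)))) \<longlonglongrightarrow> 0" by simp
    then show "(\<lambda>n. nn_energy (\<lambda>x. g n x - G x)) \<longlonglongrightarrow> 0"
      by (rule ennreal_tendsto_0_le) (rule le')
    show "AE x in lborel. (\<lambda>k. g (r k) x) \<longlonglongrightarrow> G x" by fact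
  qed
qed

lemma tendsto_pairing_0:
  fixes h :: "real \<Rightarrow> complex" and d :: "nat \<Rightarrow> real \<Rightarrow> complex"
  assumes [measurable]: "h \<in> borel_measurable borel" "\<And>n. d n \<in> borel_measurable borel"
    and h: "square_integrable h"
    and d: "(\<lambda>n. nn_energy (d n)) \<longlonglongrightarrow> 0"
  shows "(\<lambda>n. LBINT x. h x * d n x) \<longlonglongrightarrow> 0"
proof -
  let ?A = "nn_energy h"
  have A: "?A < top" by (simp add: nn_integral_square[OF h])
  have bound: "ennreal ((norm (LBINT x. h x * d n x))\<^sup>2) \<le> ?A * (nn_energy (d n))" for n
  proof -
    have "ennreal ((norm (LBINT x. h x * d n x))\<^sup>2) = (ennreal (norm (LBINT x. h x * d n x)))\<^sup>2"
      by (simp add: ennreal_power)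
    also have "\<dots> \<le> (\<integral>\<^sup>+x. norm (h x * d n x) \<partial>lborel)\<^sup>2"
      by (rule power_mono[OF norm_integral_le_nn]) simp
    also have "(\<integral>\<^sup>+x. norm (h x * d n x) \<partial>lborel) = (\<integral>\<^sup>+x. ennreal (norm (h x)) * ennreal (norm (d n x)) \<partial>lborel)"
      by (simp add: norm_mult ennreal_mult)
    also have "\<dots>\<^sup>2 \<le> (\<integral>\<^sup>+x. ennreal (norm (h x)) ^ 2 \<partial>lborel) * (\<integral>\<^sup>+x. ennreal (norm (d n x)) ^ 2 \<partial>lborel)"
      by (rule Cauchy_Schwarz_nn_integral) auto
    finally show ?thesis by (simp add: ennreal_power)
  qed
  have "(\<lambda>n. ?A * (nn_energy (d n))) \<longlonglongrightarrow> ?A * 0"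
    by (rule ennreal_tendsto_cmult[OF A d])
  then have "(\<lambda>n. ennreal ((norm (LBINT x. h x * d n x))\<^sup>2)) \<longlonglongrightarrow> 0"
    unfolding mult_zero_right by (rule ennreal_tendsto_0_le) (rule bound)
  then have "(\<lambda>n. (norm (LBINT x. h x * d n x))\<^sup>2) \<longlonglongrightarrow> 0"
    by (subst (asm) ennreal_tendsto_0_iff) auto
  then have "(\<lambda>n. sqrt ((norm (LBINT x. h x * d n x))\<^sup>2)) \<longlonglongrightarrow> sqrt 0" by (rule tendsto_real_sqrt)
  then show ?thesis by (simp add: tendsto_norm_zero_iff)
qed

lemma tendsto_pairing:
  fixes h :: "real \<Rightarrow> complex" and g :: "nat \<Rightarrow> real \<Rightarrow> complex"
  assumes [measurable]: "h \<in> borel_measurable borel" "\<And>n. g n \<in> borel_measurable borel" "G \<in> borel_measurable borel"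
    and h: "square_integrable h"
    and g: "\<And>n. square_integrable (g n)" and G: "square_integrable G"
    and d: "(\<lambda>n. nn_energy (\<lambda>x. g n x - G x)) \<longlonglongrightarrow> 0"
  shows "(\<lambda>n. LBINT x. h x * g n x) \<longlonglongrightarrow> (LBINT x. h x * G x)"
proof -
  have "(\<lambda>n. (LBINT x. h x * (g n x - G x)) + (LBINT x. h x * G x)) \<longlonglongrightarrow> 0 + (LBINT x. h x * G x)"
    by (intro tendsto_add tendsto_const tendsto_pairing_0 h d) auto
  moreover have "(LBINT x. h x * (g n x - G x)) = (LBINT x. h x * g n x) - (LBINT x. h x * G x)" for n
    unfolding right_diff_distrib
    by (rule Bochner_Integration.integral_diff) (auto intro!: integrable_mult_L2 h g G)
  ultimately show ?thesis by simp
qed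

lemma integrable_truncation:
  fixes f :: "real \<Rightarrow> complex"
  assumes [measurable]: "f \<in> borel_measurable borel" and f: "square_integrable f"
  shows "integrable lborel (\<lambda>x. indicator {-R..R} x *\<^sub>R f x)"
    and "square_integrable (\<lambda>x. indicator {-R..R} x *\<^sub>R f x)"
proof -
  have "integrable lborel (\<lambda>x. complex_of_real (indicator {-R..R} x) * f x)"
  proof (rule integrable_mult_L2)
    have "(\<lambda>x. (norm (complex_of_real (indicator {- R..R} x)))\<^sup>2) = indicator {-R..R}"
      by (auto simp: indicator_def)
    then show "square_integrable (\<lambda>x. complex_of_real (indicator {- R..R} x))"
      by (simp only:) (rule integrable_real_indicator, auto simp: emeasure_lborel_Icc_eq)
  qed (use f in auto)
  then show "integrable lborel (\<lambda>x. indicator {-R..R} x *\<^sub>R f x)" by (simp add: scaleR_conv_of_real)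
  show "square_integrable (\<lambda>x. indicator {-R..R} x *\<^sub>R f x)"
    by (rule Bochner_Integration.integrable_bound[OF f]) (auto simp: indicator_def)
qed

lemma eventually_in_interval: "\<forall>\<^sub>F n in sequentially. (x::real) \<in> {- real n..real n}"
proof -
  have "\<bar>x\<bar> \<le> real n" if "n \<ge> nat \<lceil>\<bar>x\<bar>\<rceil>" for n using that by linarith
  then have "\<forall>\<^sub>F n in sequentially. \<bar>x\<bar> \<le> real n" unfolding eventually_sequentially by blast
  then show ?thesis by eventually_elim auto
qed

lemma truncation_tendsto:
  fixes f :: "real \<Rightarrow> complex"
  assumes [measurable]: "f \<in> borel_measurable borel" and f: "square_integrable f"
  shows "(\<lambda>n. LBINT x. (norm (indicator {- real n..real n} x *\<^sub>R f x - f x))\<^sup>2) \<longlonglongrightarrow> 0"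
proof -
  have "(\<lambda>n. LBINT x. (norm (indicator {- real n..real n} x *\<^sub>R f x - f x))\<^sup>2) \<longlonglongrightarrow> integral\<^sup>L lborel (\<lambda>x::real. 0::real)"
  proof (rule integral_dominated_convergence[where w = "\<lambda>x. (norm (f x))\<^sup>2"])
    show "square_integrable f" by (rule f)
    show "AE x in lborel. (\<lambda>n. (norm (indicator {- real n..real n} x *\<^sub>R f x - f x))\<^sup>2) \<longlonglongrightarrow> 0"
    proof (rule AE_I2, rule tendsto_eventually)
      fix x
      show "\<forall>\<^sub>F n in sequentially. (norm (indicator {- real n..real n} x *\<^sub>R f x - f x))\<^sup>2 = 0"
        using eventually_in_interval[of x] by eventually_elim simp
    qed
  qed (auto simp: indicator_def)
  then show ?thesis by simp
qed

section \<open>Test functions and the inverse transform\<close>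


text \<open>One half of \<open>test_function\<close>, split off because cosines and the factors of a
  cutoff are smooth without having compact support.\<close>

definition smooth :: "(real \<Rightarrow> real) \<Rightarrow> bool" where
  "smooth \<phi> \<longleftrightarrow> (\<forall>n x. (deriv ^^ n) \<phi> field_differentiable at x)"

lemma test_function_iff: "test_function \<phi> \<longleftrightarrow> smooth \<phi> \<and> compact (closure {x. \<phi> x \<noteq> 0})"
  by (simp add: test_function_def smooth_def)

lemma smoothD: "smooth \<phi> \<Longrightarrow> ((deriv ^^ n) \<phi> has_real_derivative (deriv ^^ Suc n) \<phi> x) (at x)"
  unfolding smooth_def by (simp add: field_differentiable_derivI)

lemma smooth_deriv: "smooth \<phi> \<Longrightarrow> smooth (deriv \<phi>)"
  unfolding smooth_def by (metis comp_apply funpow_Suc_right)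

lemma smooth_continuous: "smooth \<phi> \<Longrightarrow> continuous_on A \<phi>"
  using smoothD[of \<phi> 0] by (intro continuous_at_imp_continuous_on) (auto intro: DERIV_isCont)

lemma test_function_support:
  assumes "test_function \<phi>"
  obtains R where "R > 0" "\<And>x. \<bar>x\<bar> \<ge> R \<Longrightarrow> \<phi> x = 0"
proof -
  have "bounded {x. \<phi> x \<noteq> 0}"
    using assms unfolding test_function_def by (meson bounded_subset closure_subset compact_imp_bounded)
  then obtain B where B: "\<And>x. \<phi> x \<noteq> 0 \<Longrightarrow> \<bar>x\<bar> \<le> B" unfolding bounded_iff by auto
  show ?thesis
    by (rule that[of "\<bar>B\<bar> + 1"]) (use B in force)+
qed

lemma test_functionI:
  assumes "smooth \<phi>" "\<And>x. \<bar>x\<bar> \<ge> R \<Longrightarrow> \<phi> x = 0"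
  shows "test_function \<phi>"
proof -
  have "{x. \<phi> x \<noteq> 0} \<subseteq> {-R..R}"
  proof
    fix x assume "x \<in> {x. \<phi> x \<noteq> 0}"
    then have "\<not> \<bar>x\<bar> \<ge> R" using assms(2) by auto
    then show "x \<in> {-R..R}" by auto
  qed
  then have "bounded {x. \<phi> x \<noteq> 0}" using bounded_closed_interval bounded_subset by blast
  then show ?thesis using assms(1) by (simp add: test_function_iff compact_closure)
qed

lemma test_function_deriv:
  assumes "test_function \<phi>" shows "test_function (deriv \<phi>)"
proof -
  obtain R where R: "R > 0" "\<And>x. \<bar>x\<bar> \<ge> R \<Longrightarrow> \<phi> x = 0" by (rule test_function_support[OF assms]) blast
  show ?thesis
  proof (rule test_functionI)
    show "smooth (deriv \<phi>)" using assms by (auto simp: test_function_iff intro: smooth_deriv)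
    \<comment> \<open>At distance exactly \<open>R\<close> the function need not vanish in a whole
      neighbourhood; at distance \<open>R + 1\<close> it does.\<close>
    fix x assume x: "\<bar>x\<bar> \<ge> R + 1"
    have "open {x::real. \<bar>x\<bar> > R}" by (intro open_Collect_less continuous_intros)
    then have "\<forall>\<^sub>F y in nhds x. y \<in> {x. \<bar>x\<bar> > R}" using x by (intro eventually_nhds_in_open) auto
    then have "\<forall>\<^sub>F y in nhds x. \<phi> y = 0" by eventually_elim (simp add: R)
    then have "deriv \<phi> x = deriv (\<lambda>_. 0) x" by (intro deriv_cong_ev) auto
    then show "deriv \<phi> x = 0" by simp
  qed
qed

lemma test_function_deriv_iter: "test_function \<phi> \<Longrightarrow> test_function ((deriv ^^ n) \<phi>)"
  by (induction n) (auto intro: test_function_deriv)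

lemma test_function_continuous: "test_function \<phi> \<Longrightarrow> continuous_on A \<phi>"
  by (simp add: test_function_iff smooth_continuous)

lemma test_function_measurable [measurable_dest]: "test_function \<phi> \<Longrightarrow> \<phi> \<in> borel_measurable borel"
  by (intro borel_measurable_continuous_onI test_function_continuous)

lemma test_function_bounded:
  assumes "test_function \<phi>"
  obtains B where "B \<ge> 0" "\<And>x. \<bar>\<phi> x\<bar> \<le> B"
proof -
  obtain R where R: "R > 0" "\<And>x. \<bar>x\<bar> \<ge> R \<Longrightarrow> \<phi> x = 0" by (rule test_function_support[OF assms]) blast
  have "compact (\<phi> ` {-R..R})"
    by (intro compact_continuous_image test_function_continuous assms) auto
  then obtain B where B: "\<And>x. x \<in> {-R..R} \<Longrightarrow> \<bar>\<phi> x\<bar> \<le> B"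
    using compact_imp_bounded[of "\<phi> ` {-R..R}"] unfolding bounded_iff by fastforce
  show ?thesis
  proof (rule that[of "\<bar>B\<bar>"])
    fix x show "\<bar>\<phi> x\<bar> \<le> \<bar>B\<bar>"
      using B[of x] R(2)[of x] by (cases "\<bar>x\<bar> \<ge> R") (auto simp: abs_le_iff, linarith+)
  qed simp
qed

lemma test_function_integrable:
  assumes "test_function \<phi>"
  shows "integrable lborel \<phi>" "integrable lborel (\<lambda>x. (\<phi> x)\<^sup>2)"
proof -
  obtain R where R: "R > 0" "\<And>x. \<bar>x\<bar> \<ge> R \<Longrightarrow> \<phi> x = 0" by (rule test_function_support[OF assms]) blast
  have 0: "x \<notin> {-R..R} \<Longrightarrow> \<phi> x = 0" for x by (rule R(2)) auto
  have "integrable lborel (\<lambda>x. indicator {-R..R} x *\<^sub>R \<phi> x)"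
    by (intro borel_integrable_compact test_function_continuous assms) auto
  moreover have "integrable lborel (\<lambda>x. indicator {-R..R} x *\<^sub>R (\<phi> x)\<^sup>2)"
    by (intro borel_integrable_compact continuous_intros test_function_continuous assms) auto
  moreover have "(\<lambda>x. indicator {-R..R} x *\<^sub>R \<phi> x) = \<phi>" "(\<lambda>x. indicator {-R..R} x *\<^sub>R (\<phi> x)\<^sup>2) = (\<lambda>x. (\<phi> x)\<^sup>2)"
    using 0 by (auto simp: indicator_def fun_eq_iff)
  ultimately show "integrable lborel \<phi>" "integrable lborel (\<lambda>x. (\<phi> x)\<^sup>2)" by simp_all
qed

section \<open>Derivatives under the transform, inverse transform, weak derivatives from
  frequencies\<close>

lemma ft_deriv:
  assumes \<phi>: "test_function \<phi>"
  shows "ft (\<lambda>x. of_real (deriv \<phi> x)) \<xi> = \<i> * of_real \<xi> * ft (\<lambda>x. of_real (\<phi> x)) \<xi>"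
proof -
  obtain R where R: "R > 0" "\<And>x. \<bar>x\<bar> \<ge> R \<Longrightarrow> \<phi> x = 0" by (rule test_function_support[OF \<phi>]) blast
  obtain R' where R': "R' > 0" "\<And>x. \<bar>x\<bar> \<ge> R' \<Longrightarrow> deriv \<phi> x = 0"
    by (rule test_function_support[OF test_function_deriv[OF \<phi>]]) blast
  define S where "S = max R R'"
  have S: "S > 0" "\<And>x. x \<notin> {-S..S} \<Longrightarrow> \<phi> x = 0" "\<And>x. x \<notin> {-S..S} \<Longrightarrow> deriv \<phi> x = 0" "\<phi> S = 0" "\<phi> (-S) = 0"
    using R R' by (auto simp: S_def)
  have sm: "smooth \<phi>" using \<phi> by (simp add: test_function_iff)
  let ?e = "\<lambda>x. iexp (- (\<xi> * x))"
  let ?g = "\<lambda>x. ?e x * of_real (deriv \<phi> x) - \<i> * of_real \<xi> * (?e x * of_real (\<phi> x))"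
  have der: "((\<lambda>x. ?e x * of_real (\<phi> x)) has_vector_derivative ?g x) (at x within A)" for x A
  proof -
    have "((\<lambda>x. complex_of_real (\<phi> x)) has_vector_derivative of_real (deriv \<phi> x)) (at x within A)"
      using smoothD[OF sm, of 0 x] by (intro has_vector_derivative_of_real) (auto intro: has_field_derivative_at_within simp: has_real_derivative_iff_has_vector_derivative[symmetric])
    moreover have "((\<lambda>z. exp (- (\<i> * (of_real \<xi> * z)))) has_field_derivative - (\<i> * of_real \<xi>) * exp (- (\<i> * (of_real \<xi> * of_real x)))) (at (of_real x) within UNIV)"
      by (auto intro!: derivative_eq_intros)
    then have "(?e has_vector_derivative - (\<i> * of_real \<xi>) * ?e x) (at x within A)"
      by (auto dest!: has_vector_derivative_real_field simp: has_vector_derivative_at_within)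
    ultimately have "((\<lambda>x. ?e x * of_real (\<phi> x)) has_vector_derivative ?e x * of_real (deriv \<phi> x) + (- (\<i> * of_real \<xi>) * ?e x) * of_real (\<phi> x)) (at x within A)"
      by (intro has_vector_derivative_mult)
    then show ?thesis by (simp add: algebra_simps)
  qed
  \<comment> \<open>Integration by parts: \<open>?g\<close> is the derivative of the product of
    \<open>\<phi>\<close> with the character, whose boundary values at \<open>S\<close> and
    \<open>- S\<close> vanish. That the integral of \<open>?g\<close> is 0 is the asserted
    formula.\<close>
  have "(LBINT x. indicator {-S..S} x *\<^sub>R ?g x) = ?e S * of_real (\<phi> S) - ?e (-S) * of_real (\<phi> (-S))"
  proof (rule integral_FTC_Icc)
    have "continuous_on {-S..S} \<phi>" "continuous_on {-S..S} (deriv \<phi>)"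
      using \<phi> by (auto intro: test_function_continuous test_function_deriv)
    then show "continuous_on {-S..S} ?g" by (intro continuous_intros)
  qed (use S der in auto)
  also have "(\<lambda>x. indicator {-S..S} x *\<^sub>R ?g x) = ?g" using S by (auto simp: indicator_def)
  finally have "(LBINT x. ?g x) = 0" using S by simp
  moreover have "integrable lborel (\<lambda>x. ?e x * of_real (deriv \<phi> x))" "integrable lborel (\<lambda>x. ?e x * of_real (\<phi> x))"
    by (intro integrable_iexp_mult integrable_of_real test_function_integrable \<phi> test_function_deriv)+
  ultimately show ?thesis by (simp add: ft_def)
qed

lemma ft_deriv_iter:
  assumes "test_function \<phi>"
  shows "ft (\<lambda>x. of_real ((deriv ^^ n) \<phi> x)) \<xi> = (\<i> * of_real \<xi>) ^ n * ft (\<lambda>x. of_real (\<phi> x)) \<xi>"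
  by (induction n) (auto simp: ft_deriv[OF test_function_deriv_iter[OF assms]])

lemma test_function_complex:
  assumes "test_function \<phi>"
  shows "integrable lborel (\<lambda>x. complex_of_real (\<phi> x))"
    "square_integrable (\<lambda>x. complex_of_real (\<phi> x))"
    "continuous_on UNIV (\<lambda>x. complex_of_real (\<phi> x))"
    "square_integrable (\<lambda>\<xi>. ft (\<lambda>x. complex_of_real (\<phi> x)) \<xi>)"
proof -
  show 1: "integrable lborel (\<lambda>x. complex_of_real (\<phi> x))"
    by (intro integrable_of_real test_function_integrable assms)
  show 2: "square_integrable (\<lambda>x. complex_of_real (\<phi> x))"
    using test_function_integrable(2)[OF assms] by simp
  show "continuous_on UNIV (\<lambda>x. complex_of_real (\<phi> x))"
    by (intro continuous_intros test_function_continuous assms)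
  show "square_integrable (\<lambda>\<xi>. ft (\<lambda>x. complex_of_real (\<phi> x)) \<xi>)"
    by (rule square_integrable_ft[OF 1 2])
qed

text \<open>The inverse transform is the limit in \<open>L2\<close> of those of the truncations of
  \<open>G\<close>, which are integrable. Bessel's inequality for differences of truncations gives
  the Cauchy property, and Fatou's lemma carries the energy bound to the limit. The result is
  identified only by its pairings with test functions, as the definition of a weak derivative
  asks.\<close>

lemma inverse_ft_L2:
  fixes G :: "real \<Rightarrow> complex"
  assumes [measurable]: "G \<in> borel_measurable borel" and G: "square_integrable G"
  obtains g where "g \<in> borel_measurable borel" "square_integrable g"
    "2 * pi * energy g \<le> energy G"
    "\<And>\<phi>. test_function \<phi> \<Longrightarrow> of_real (2 * pi) * (LBINT x. of_real (\<phi> x) * g x)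
       = (LBINT \<xi>. cnj (ft (\<lambda>x. of_real (\<phi> x)) \<xi>) * G \<xi>)"
proof -
  define T where "T n = (\<lambda>x. indicator {- real n..real n} x *\<^sub>R G x)" for n
  have [measurable]: "T n \<in> borel_measurable borel" for n unfolding T_def by measurable
  have T: "integrable lborel (T n)" "square_integrable (T n)" for n
    unfolding T_def by (rule integrable_truncation; use G in simp)+
  \<comment> \<open>The inverse transform as the reflected transform over \<open>2 * pi\<close>. The
    division costs \<open>(2 * pi)^2\<close> in the energy and Bessel's inequality returns one
    factor, whence \<open>2 * pi\<close> on the left of the bound.\<close>
  define g where "g n = (\<lambda>x. ft (T n) (- x) / of_real (2 * pi))" for n
  have g_meas [measurable]: "g n \<in> borel_measurable borel" for n unfolding g_def by measurable
  have reflect: "square_integrable (\<lambda>x. ft f (- x) / of_real (2 * pi))"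
    "2 * pi * energy (\<lambda>x. ft f (- x) / of_real (2 * pi)) \<le> energy f"
    if f: "integrable lborel f" "square_integrable f" for f
  proof -
    have i: "square_integrable (\<lambda>x. ft f (0 + (- 1) * x))"
      by (rule lborel_integrable_real_affine[of "\<lambda>x. (norm (ft f x))\<^sup>2"]) (use square_integrable_ft(1)[OF f] in auto)
    then show "square_integrable (\<lambda>x. ft f (- x) / of_real (2 * pi))"
      by (simp add: norm_divide power_divide)
    have "energy (ft f) = energy (\<lambda>x. ft f (- x))"
      using lborel_integral_real_affine[of "-1" "\<lambda>x. (norm (ft f x))\<^sup>2" 0] by simp
    then have "energy (\<lambda>x. ft f (- x)) \<le> 2 * pi * energy f"
      using square_integrable_ft(2)[OF f] by simp
    then show "2 * pi * energy (\<lambda>x. ft f (- x) / of_real (2 * pi)) \<le> energy f"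
      by (simp add: norm_divide power_divide field_simps power2_eq_square)
  qed
  have g2: "square_integrable (g n)" for n
    unfolding g_def by (rule reflect[OF T])
  define b where "b n = energy (\<lambda>x. T n x - G x)" for n
  have b: "b \<longlonglongrightarrow> 0" unfolding b_def T_def by (rule truncation_tendsto) (use G in auto)
  have diffs: "square_integrable (\<lambda>x. T n x - G x)" for n
    by (rule square_integrable_diff) (use T G in auto)
  have cauchy: "energy (\<lambda>x. g m x - g n x) \<le> b m + b n" for m n
  proof -
    let ?f = "\<lambda>x. T m x - T n x"
    have f: "integrable lborel ?f" "square_integrable ?f"
      using T by (auto intro!: square_integrable_diff)
    have "ft ?f \<xi> = ft (T m) \<xi> - ft (T n) \<xi>" for \<xi>
      unfolding ft_def right_diff_distrib by (intro Bochner_Integration.integral_diff integrable_iexp_mult T)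
    then have "(\<lambda>x. (norm (g m x - g n x))\<^sup>2) = (\<lambda>x. (norm (ft ?f (- x) / of_real (2 * pi)))\<^sup>2)"
      by (simp add: g_def diff_divide_distrib)
    then have "2 * pi * energy (\<lambda>x. g m x - g n x) \<le> (energy ?f)"
      using reflect(2)[OF f] by simp
    also have "\<dots> \<le> (LBINT x. 2 * (norm (T m x - G x))\<^sup>2 + 2 * (norm (T n x - G x))\<^sup>2)"
    proof (rule integral_mono[OF f(2)])
      show "integrable lborel (\<lambda>x. 2 * (norm (T m x - G x))\<^sup>2 + 2 * (norm (T n x - G x))\<^sup>2)" using diffs by simp
      show "(norm (?f x))\<^sup>2 \<le> 2 * (norm (T m x - G x))\<^sup>2 + 2 * (norm (T n x - G x))\<^sup>2" for x
        using norm_diff_square_le[of "T m x - G x" "T n x - G x"] by simp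
    qed
    also have "\<dots> = 2 * (b m + b n)" using diffs by (simp add: b_def)
    finally have *: "2 * pi * energy (\<lambda>x. g m x - g n x) \<le> 2 * (b m + b n)" .
    have "1 * energy (\<lambda>x. g m x - g n x) \<le> pi * energy (\<lambda>x. g m x - g n x)"
      using pi_gt3 by (intro mult_right_mono) auto
    with * show ?thesis by simp
  qed
  obtain h r where h [measurable]: "h \<in> borel_measurable borel" and h2: "square_integrable h"
    and lim: "(\<lambda>n. nn_energy (\<lambda>x. g n x - h x)) \<longlonglongrightarrow> 0"
    and ae: "AE x in lborel. (\<lambda>k. g (r k) x) \<longlonglongrightarrow> h x"
    by (rule L2_complete[OF g_meas g2 cauchy b]) blast
  show ?thesis
  proof
    show "h \<in> borel_measurable borel" "square_integrable h" by fact+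
    let ?C = "energy G / (2 * pi)"
    have "(nn_energy h) \<le> ennreal ?C"
    proof (rule nn_integral_limit_le[where u = "\<lambda>k x. ennreal ((norm (g (r k) x))\<^sup>2)"])
      show "AE x in lborel. (\<lambda>k. ennreal ((norm (g (r k) x))\<^sup>2)) \<longlonglongrightarrow> ennreal ((norm (h x))\<^sup>2)"
        using ae by eventually_elim (intro tendsto_ennrealI tendsto_intros)
      fix k
      have "2 * pi * energy (\<lambda>x. g (r k) x) \<le> energy (\<lambda>x. T (r k) x)"
        unfolding g_def by (rule reflect[OF T])
      also have "\<dots> \<le> energy G"
        by (rule integral_mono[OF T(2) G]) (auto simp: T_def indicator_def)
      finally show "(nn_energy (\<lambda>x. g (r k) x)) \<le> ennreal ?C"
        unfolding nn_integral_square[OF g2] by (intro ennreal_leI) (simp add: field_simps)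
    qed measurable
    then have "energy h \<le> ?C"
      unfolding nn_integral_square[OF h2] by (subst (asm) ennreal_le_iff) auto
    then show "2 * pi * energy h \<le> energy G"
      by (simp add: field_simps)
    fix \<phi> assume \<phi>: "test_function \<phi>"
    note tf = test_function_complex[OF \<phi>]
    have [measurable]: "\<phi> \<in> borel_measurable borel" using \<phi> by measurable
    let ?\<phi> = "\<lambda>x. complex_of_real (\<phi> x)"
    have eq: "of_real (2 * pi) * (LBINT x. ?\<phi> x * g n x) = (LBINT \<xi>. cnj (ft ?\<phi> \<xi>) * T n \<xi>)" for n
    proof -
      define k where "k = (\<lambda>x \<xi>. ?\<phi> x * (iexp (- (- x * \<xi>)) * T n \<xi>))"
      have I: "integrable (lborel \<Otimes>\<^sub>M lborel) (case_prod k)"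
        by (rule integrable_pair_dominated[OF tf(1) T(1)]) (auto simp: k_def norm_mult)
      have "of_real (2 * pi) * (LBINT x. ?\<phi> x * g n x) = (LBINT x. of_real (2 * pi) * (?\<phi> x * g n x))"
        by simp
      also have "\<dots> = (LBINT x. LBINT \<xi>. k x \<xi>)"
        by (rule Bochner_Integration.integral_cong) (auto simp: g_def ft_def k_def)
      also have "\<dots> = (LBINT \<xi>. LBINT x. k x \<xi>)"
        using lborel_pair.Fubini_integral[OF I] by simp
      also have "\<dots> = (LBINT \<xi>. cnj (ft ?\<phi> \<xi>) * T n \<xi>)"
      proof (rule Bochner_Integration.integral_cong)
        fix \<xi>
        have "cnj (ft ?\<phi> \<xi>) = (LBINT x. cnj (iexp (- (\<xi> * x)) * ?\<phi> x))"
          unfolding ft_def by (rule Bochner_Integration.integral_cnj[symmetric])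
        then have "cnj (ft ?\<phi> \<xi>) * T n \<xi> = (LBINT x. cnj (iexp (- (\<xi> * x)) * ?\<phi> x) * T n \<xi>)" by simp
        also have "\<dots> = (LBINT x. k x \<xi>)"
          by (rule Bochner_Integration.integral_cong) (auto simp: k_def exp_cnj mult_ac)
        finally show "(LBINT x. k x \<xi>) = cnj (ft ?\<phi> \<xi>) * T n \<xi>" by simp
      qed simp
      finally show ?thesis .
    qed
    have "(\<lambda>n. of_real (2 * pi) * (LBINT x. ?\<phi> x * g n x)) \<longlonglongrightarrow> of_real (2 * pi) * (LBINT x. ?\<phi> x * h x)"
      by (intro tendsto_mult tendsto_const tendsto_pairing) (use tf g2 h2 lim in auto)
    moreover have "(\<lambda>n. LBINT \<xi>. cnj (ft ?\<phi> \<xi>) * T n \<xi>) \<longlonglongrightarrow> (LBINT \<xi>. cnj (ft ?\<phi> \<xi>) * G \<xi>)"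
    proof (rule tendsto_pairing)
      show "(\<lambda>n. nn_energy (\<lambda>x. T n x - G x)) \<longlonglongrightarrow> 0"
        unfolding nn_integral_square[OF diffs] using b unfolding b_def[abs_def] by (simp add: ennreal_tendsto_0_iff)
    qed (use tf T G in auto)
    ultimately show "of_real (2 * pi) * (LBINT x. ?\<phi> x * h x) = (LBINT \<xi>. cnj (ft ?\<phi> \<xi>) * G \<xi>)"
      unfolding eq by (rule LIMSEQ_unique)
  qed
qed

text \<open>Differentiation is multiplication by \<open>\<i> \<xi>\<close>, so \<open>g\<close> is
  the inverse transform of \<open>(\<i> \<xi>)^n W\<close>. A pairing of \<open>u\<close> with an
  \<open>n\<close>-th derivative goes to frequencies by Parseval's identity, the derivative becomes
  a multiplier there, and \<open>inverse_ft_L2\<close> brings the pairing back. Conjugation of the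
  multiplier is the source of the sign \<open>(-1)^n\<close>.\<close>

lemma weak_deriv_of_ft:
  fixes u W :: "real \<Rightarrow> complex"
  assumes [measurable]: "u \<in> borel_measurable borel" "W \<in> borel_measurable borel"
    and u: "square_integrable u" and W: "square_integrable W"
    and lim: "(\<lambda>k. nn_energy (\<lambda>\<xi>. ft (\<lambda>x. indicator {- real k..real k} x *\<^sub>R u x) \<xi> - W \<xi>)) \<longlonglongrightarrow> 0"
    and Wn: "integrable lborel (\<lambda>\<xi>. (\<bar>\<xi>\<bar> ^ n * norm (W \<xi>))\<^sup>2)"
  obtains g where "g \<in> borel_measurable borel" "square_integrable g"
    "2 * pi * energy g \<le> (LBINT \<xi>. (\<bar>\<xi>\<bar> ^ n * norm (W \<xi>))\<^sup>2)"
    "\<And>\<phi>. test_function \<phi> \<Longrightarrow>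
       (LBINT x. (deriv ^^ n) \<phi> x *\<^sub>R u x) = (-1) ^ n *\<^sub>R (LBINT x. \<phi> x *\<^sub>R g x)"
proof -
  define T where "T k = (\<lambda>x. indicator {- real k..real k} x *\<^sub>R u x)" for k
  have [measurable]: "T n \<in> borel_measurable borel" for n unfolding T_def by measurable
  have T: "integrable lborel (T n)" "square_integrable (T n)" for n
    unfolding T_def by (rule integrable_truncation; use u in simp)+
  \<comment> \<open>Parseval's identity is applied to truncations of \<open>u\<close>. Their pairing
    with \<open>\<phi>\<close> no longer changes once the truncation covers the support of
    \<open>\<phi>\<close>, while on the other side their transforms converge to \<open>W\<close> in
    \<open>L2\<close>.\<close>
  have P: "(LBINT \<xi>. ft (\<lambda>x. of_real (\<phi> x)) \<xi> * cnj (W \<xi>)) = of_real (2 * pi) * (LBINT x. of_real (\<phi> x) * cnj (u x))"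
    if \<phi>: "test_function \<phi>" for \<phi>
  proof -
    note tf = test_function_complex[OF \<phi>]
    have [measurable]: "\<phi> \<in> borel_measurable borel" using \<phi> by measurable
    let ?\<phi> = "\<lambda>x. complex_of_real (\<phi> x)"
    obtain R where R: "R > 0" "\<And>x. \<bar>x\<bar> \<ge> R \<Longrightarrow> \<phi> x = 0" by (rule test_function_support[OF \<phi>]) blast
    obtain B where B: "\<And>x. \<bar>\<phi> x\<bar> \<le> B" by (rule test_function_bounded[OF \<phi>]) blast
    have "(LBINT \<xi>. ft ?\<phi> \<xi> * cnj (ft (T k) \<xi>)) = of_real (2 * pi) * (LBINT x. ?\<phi> x * cnj (T k x))" for k
      by (rule parseval[OF tf(1-3) _ T]) (use B in simp)
    moreover have "(LBINT x. ?\<phi> x * cnj (T k x)) = (LBINT x. ?\<phi> x * cnj (u x))" if "k \<ge> nat \<lceil>R\<rceil>" for k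
    proof (rule Bochner_Integration.integral_cong)
      fix x
      show "?\<phi> x * cnj (T k x) = ?\<phi> x * cnj (u x)"
      proof (cases "\<bar>x\<bar> \<ge> R")
        case False
        then have "x \<in> {- real k..real k}" using that by (auto simp: nat_le_iff ceiling_le_iff)
        then show ?thesis by (simp add: T_def)
      qed (simp add: R)
    qed simp
    ultimately have "(LBINT \<xi>. ft ?\<phi> \<xi> * cnj (ft (T k) \<xi>)) = of_real (2 * pi) * (LBINT x. ?\<phi> x * cnj (u x))"
      if "k \<ge> nat \<lceil>R\<rceil>" for k using that by simp
    then have "\<forall>\<^sub>F k in sequentially. (LBINT \<xi>. ft ?\<phi> \<xi> * cnj (ft (T k) \<xi>)) = of_real (2 * pi) * (LBINT x. ?\<phi> x * cnj (u x))"
      unfolding eventually_sequentially by blast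
    then have "(\<lambda>k. LBINT \<xi>. ft ?\<phi> \<xi> * cnj (ft (T k) \<xi>)) \<longlonglongrightarrow> of_real (2 * pi) * (LBINT x. ?\<phi> x * cnj (u x))"
      by (rule tendsto_eventually)
    moreover have "(\<lambda>k. LBINT \<xi>. ft ?\<phi> \<xi> * cnj (ft (T k) \<xi>)) \<longlonglongrightarrow> (LBINT \<xi>. ft ?\<phi> \<xi> * cnj (W \<xi>))"
    proof (rule tendsto_pairing)
      show "square_integrable (\<lambda>\<xi>. cnj (ft (T k) \<xi>))" for k
        using square_integrable_ft(1)[OF T] by simp
      show "(\<lambda>k. nn_energy (\<lambda>\<xi>. cnj (ft (T k) \<xi>) - cnj (W \<xi>))) \<longlonglongrightarrow> 0"
        using lim unfolding T_def by (simp flip: complex_cnj_diff)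
    qed (use tf W in auto)
    ultimately show ?thesis by (rule LIMSEQ_unique[rotated])
  qed
  define G where "G \<xi> = (\<i> * of_real \<xi>) ^ n * W \<xi>" for \<xi>
  have normG: "norm (G \<xi>) = \<bar>\<xi>\<bar> ^ n * norm (W \<xi>)" for \<xi>
    by (simp add: G_def norm_mult norm_power)
  have [measurable]: "G \<in> borel_measurable borel" unfolding G_def by measurable
  have G2: "square_integrable G" using Wn by (simp add: normG)
  obtain g where g: "g \<in> borel_measurable borel" "square_integrable g"
    "2 * pi * energy g \<le> energy G"
    and dual: "\<And>\<phi>. test_function \<phi> \<Longrightarrow> of_real (2 * pi) * (LBINT x. of_real (\<phi> x) * g x)
       = (LBINT \<xi>. cnj (ft (\<lambda>x. of_real (\<phi> x)) \<xi>) * G \<xi>)"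
    by (rule inverse_ft_L2[OF _ G2]) auto
  show ?thesis
  proof
    show "2 * pi * energy g \<le> (LBINT \<xi>. (\<bar>\<xi>\<bar> ^ n * norm (W \<xi>))\<^sup>2)"
      using g(3) by (simp add: normG)
    fix \<phi> assume \<phi>: "test_function \<phi>"
    let ?\<phi> = "\<lambda>x. complex_of_real (\<phi> x)" and ?\<psi> = "\<lambda>x. complex_of_real ((deriv ^^ n) \<phi> x)"
    have "of_real (2 * pi) * (LBINT x. ?\<psi> x * u x) = cnj (of_real (2 * pi) * (LBINT x. ?\<psi> x * cnj (u x)))"
      by (simp flip: Bochner_Integration.integral_cnj)
    also have "\<dots> = cnj (LBINT \<xi>. ft ?\<psi> \<xi> * cnj (W \<xi>))"
      by (simp add: P[OF test_function_deriv_iter[OF \<phi>]])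
    also have "\<dots> = (LBINT \<xi>. cnj (ft ?\<psi> \<xi> * cnj (W \<xi>)))" by (rule Bochner_Integration.integral_cnj[symmetric])
    also have "\<dots> = (LBINT \<xi>. (-1) ^ n * (cnj (ft ?\<phi> \<xi>) * G \<xi>))"
      by (rule Bochner_Integration.integral_cong)
         (auto simp: ft_deriv_iter[OF \<phi>] G_def power_mult_distrib[symmetric] simp flip: power_mult_distrib mult.assoc)
    also have "\<dots> = (-1) ^ n * (of_real (2 * pi) * (LBINT x. of_real (\<phi> x) * g x))"
      by (simp only: dual[OF \<phi>] integral_mult_right_zero)
    finally have "(LBINT x. ?\<psi> x * u x) = (-1) ^ n * (LBINT x. ?\<phi> x * g x)"
      by (simp add: mult.left_commute)
    then show "(LBINT x. (deriv ^^ n) \<phi> x *\<^sub>R u x) = (-1) ^ n *\<^sub>R (LBINT x. \<phi> x *\<^sub>R g x)"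
      by (simp add: scaleR_conv_of_real)
  qed (use g in auto)
qed

section \<open>Cutoff functions\<close>


text \<open>Pascal's rule after a shift of the index: the bookkeeping of the induction step in
  Leibniz's formula.\<close>

lemma leibniz_sum:
  fixes F G :: "nat \<Rightarrow> real"
  shows "(\<Sum>i\<le>n. real (n choose i) * (F (Suc i) * G (n - i) + F i * G (Suc n - i)))
    = (\<Sum>i\<le>Suc n. real (Suc n choose i) * (F i * G (Suc n - i)))"
proof -
  have "(\<Sum>i\<le>Suc n. real (Suc n choose i) * (F i * G (Suc n - i)))
    = F 0 * G (Suc n) + (\<Sum>i\<le>n. real (n choose Suc i) * (F (Suc i) * G (n - i)))
      + (\<Sum>i\<le>n. real (n choose i) * (F (Suc i) * G (n - i)))"
    by (subst sum.atMost_Suc_shift) (simp add: sum.distrib[symmetric] algebra_simps)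
  also have "F 0 * G (Suc n) + (\<Sum>i\<le>n. real (n choose Suc i) * (F (Suc i) * G (n - i)))
    = (\<Sum>i\<le>Suc n. real (n choose i) * (F i * G (Suc n - i)))"
    by (subst sum.atMost_Suc_shift) simp
  also have "\<dots> = (\<Sum>i\<le>n. real (n choose i) * (F i * G (Suc n - i)))"
    by simp
  finally show ?thesis by (simp add: sum.distrib algebra_simps)
qed

lemma deriv_iter_mult:
  assumes f: "smooth f" and g: "smooth g"
  shows "(deriv ^^ n) (\<lambda>x. f x * g x)
    = (\<lambda>x. \<Sum>i\<le>n. real (n choose i) * ((deriv ^^ i) f x * (deriv ^^ (n - i)) g x))"
proof (induction n)
  case (Suc n)
  show ?case
  proof
    fix x
    have "((\<lambda>x. \<Sum>i\<le>n. real (n choose i) * ((deriv ^^ i) f x * (deriv ^^ (n - i)) g x)) has_real_derivative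
       (\<Sum>i\<le>n. real (n choose i) * ((deriv ^^ Suc i) f x * (deriv ^^ (n - i)) g x + (deriv ^^ i) f x * (deriv ^^ (Suc n - i)) g x))) (at x)"
    proof (rule DERIV_sum)
      fix i assume "i \<in> {..n}"
      then have "Suc n - i = Suc (n - i)" by auto
      then show "((\<lambda>x. real (n choose i) * ((deriv ^^ i) f x * (deriv ^^ (n - i)) g x)) has_real_derivative
        real (n choose i) * ((deriv ^^ Suc i) f x * (deriv ^^ (n - i)) g x + (deriv ^^ i) f x * (deriv ^^ (Suc n - i)) g x)) (at x)"
        using DERIV_cmult[OF DERIV_mult[OF smoothD[OF f, of i x] smoothD[OF g, of "n - i" x]], of "real (n choose i)"]
        by (simp add: mult.commute)
    qed
    then have "deriv ((deriv ^^ n) (\<lambda>x. f x * g x)) x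
      = (\<Sum>i\<le>n. real (n choose i) * ((deriv ^^ Suc i) f x * (deriv ^^ (n - i)) g x + (deriv ^^ i) f x * (deriv ^^ (Suc n - i)) g x))"
      unfolding Suc.IH by (rule DERIV_imp_deriv)
    then show "(deriv ^^ Suc n) (\<lambda>x. f x * g x) x = (\<Sum>i\<le>Suc n. real (Suc n choose i) * ((deriv ^^ i) f x * (deriv ^^ (Suc n - i)) g x))"
      unfolding leibniz_sum[of n "\<lambda>i. (deriv ^^ i) f x" "\<lambda>i. (deriv ^^ i) g x", symmetric] by simp
  qed
qed simp

lemma smooth_mult: "smooth f \<Longrightarrow> smooth g \<Longrightarrow> smooth (\<lambda>x. f x * g x)"
  unfolding smooth_def[of "\<lambda>x. f x * g x"]
  by (auto simp: deriv_iter_mult smooth_def intro!: derivative_intros)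

lemma deriv_iter_affine:
  assumes f: "smooth f"
  shows "(deriv ^^ n) (\<lambda>x. f (a * x + b)) = (\<lambda>x. a ^ n * (deriv ^^ n) f (a * x + b))"
proof (induction n)
  case (Suc n)
  show ?case
  proof
    fix x
    have "((\<lambda>x. a ^ n * (deriv ^^ n) f (a * x + b)) has_real_derivative a ^ n * ((deriv ^^ Suc n) f (a * x + b) * a)) (at x)"
      by (intro DERIV_cmult DERIV_chain2[OF smoothD[OF f]]) (auto intro!: derivative_eq_intros)
    then show "(deriv ^^ Suc n) (\<lambda>x. f (a * x + b)) x = a ^ Suc n * (deriv ^^ Suc n) f (a * x + b)"
      unfolding funpow.simps(2)[of n deriv] comp_def Suc.IH by (simp add: DERIV_imp_deriv mult_ac)
  qed
qed simp

lemma smooth_affine: "smooth f \<Longrightarrow> smooth (\<lambda>x. f (a * x + b))"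
  unfolding smooth_def[of "\<lambda>x. f (a * x + b)"]
proof (intro allI)
  fix n x assume f: "smooth f"
  have "((\<lambda>x. a ^ n * (deriv ^^ n) f (a * x + b)) has_real_derivative a ^ n * ((deriv ^^ Suc n) f (a * x + b) * a)) (at x)"
    by (intro DERIV_cmult DERIV_chain2[OF smoothD[OF f]]) (auto intro!: derivative_eq_intros)
  then show "(deriv ^^ n) (\<lambda>x. f (a * x + b)) field_differentiable at x"
    unfolding deriv_iter_affine[OF f] field_differentiable_def by blast
qed

text \<open>A derivative advances the phase by a quarter turn. Keeping the cosine with a phase gives
  one formula for all orders, and with \<open>\<alpha>\<close> equal to 0 or \<open>pi / 2\<close>
  both parts of a character.\<close>

lemma deriv_iter_cos:
  "(deriv ^^ n) (\<lambda>x. cos (c * x + \<alpha>)) = (\<lambda>x. c ^ n * cos (c * x + \<alpha> + real n * (pi / 2)))"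
proof (induction n)
  case (Suc n)
  show ?case
  proof
    fix x
    have "((\<lambda>x. c ^ n * cos (c * x + \<alpha> + real n * (pi / 2))) has_real_derivative
      c ^ n * (- sin (c * x + \<alpha> + real n * (pi / 2)) * c)) (at x)"
      by (auto intro!: derivative_eq_intros)
    moreover have "c * x + \<alpha> + real (Suc n) * (pi / 2) = (c * x + \<alpha> + real n * (pi / 2)) + pi / 2"
      by (simp add: field_simps)
    then have "cos (c * x + \<alpha> + real (Suc n) * (pi / 2)) = - sin (c * x + \<alpha> + real n * (pi / 2))"
      by (simp only: cos_add) simp
    ultimately have "((\<lambda>x. c ^ n * cos (c * x + \<alpha> + real n * (pi / 2))) has_real_derivative
      c ^ n * (cos (c * x + \<alpha> + real (Suc n) * (pi / 2)) * c)) (at x)"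
      by (simp only:)
    then show "(deriv ^^ Suc n) (\<lambda>x. cos (c * x + \<alpha>)) x = c ^ Suc n * cos (c * x + \<alpha> + real (Suc n) * (pi / 2))"
      unfolding funpow.simps(2)[of n deriv] comp_def Suc.IH by (simp only: DERIV_imp_deriv power_Suc mult_ac)
  qed
qed simp

lemma smooth_cos: "smooth (\<lambda>x. cos (c * x + \<alpha>))"
  unfolding smooth_def deriv_iter_cos field_differentiable_def
  by (auto intro!: exI derivative_eq_intros)

text \<open>The classical function \<open>exp (- 1 / x)\<close>, flat at the origin, with a
  polynomial in \<open>1 / x\<close> in front so that the family is closed under differentiation. At
  \<open>1 / y\<close> its value is \<open>P(y) exp (- y)\<close>, and its boundedness is used once
  more in that form for the high frequencies.\<close>

definition flat_fn :: "real poly \<Rightarrow> real \<Rightarrow> real" where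
  "flat_fn P x = (if x \<le> 0 then 0 else poly P (1 / x) * exp (- (1 / x)))"

lemma poly_exp_tendsto_0: "((\<lambda>y. poly P y * exp (- y)) \<longlongrightarrow> (0::real)) at_top"
proof -
  have "((\<lambda>y. \<Sum>i\<le>degree P. coeff P i * (y ^ i / exp y)) \<longlongrightarrow> (\<Sum>i\<le>degree P. coeff P i * 0)) at_top"
    by (intro tendsto_sum tendsto_mult tendsto_const tendsto_power_div_exp_0)
  then show ?thesis
    by (simp add: poly_altdef sum_distrib_right exp_minus divide_inverse mult.assoc)
qed

text \<open>For positive \<open>x\<close> put \<open>y = 1 / x\<close>, whose derivative is
  \<open>- y^2\<close>; differentiating \<open>P(y) exp (- y)\<close> gives
  \<open>y^2 (P - P')(y) exp (- y)\<close>. At 0 the difference quotient from the right is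
  \<open>y P(y) exp (- y)\<close>, which tends to 0 as \<open>y\<close> grows.\<close>

lemma flat_deriv: "(flat_fn P has_real_derivative flat_fn ([:0, 0, 1:] * (P - pderiv P)) x) (at x)"
proof -
  consider "x < 0" | "x = 0" | "x > 0" by linarith
  then show ?thesis
  proof cases
    case 1
    have "((\<lambda>_. 0) has_real_derivative 0) (at x)" by simp
    then have "(flat_fn P has_real_derivative 0) (at x)"
      by (rule has_field_derivative_transform_within_open[of _ _ _ "{..<0}"]) (use 1 in \<open>auto simp: flat_fn_def\<close>)
    then show ?thesis using 1 by (simp add: flat_fn_def)
  next
    case 3
    have "((\<lambda>x. poly P (1 / x) * exp (- (1 / x))) has_real_derivative
       (poly (pderiv P) (1 / x) * (- 1 / x\<^sup>2)) * exp (- (1 / x)) + (exp (- (1 / x)) * (1 / x\<^sup>2)) * poly P (1 / x)) (at x)"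
      using 3 by (intro DERIV_mult DERIV_chain2[OF poly_DERIV] DERIV_chain2[OF DERIV_exp])
        (auto intro!: derivative_eq_intros simp: power2_eq_square)
    moreover have "(poly (pderiv P) (1 / x) * (- 1 / x\<^sup>2)) * exp (- (1 / x)) + (exp (- (1 / x)) * (1 / x\<^sup>2)) * poly P (1 / x)
      = flat_fn ([:0, 0, 1:] * (P - pderiv P)) x"
      using 3 by (simp add: flat_fn_def field_simps power2_eq_square)
    ultimately have "((\<lambda>x. poly P (1 / x) * exp (- (1 / x))) has_real_derivative flat_fn ([:0, 0, 1:] * (P - pderiv P)) x) (at x)"
      by simp
    then show ?thesis
      by (rule has_field_derivative_transform_within_open[of _ _ _ "{0<..}"]) (use 3 in \<open>auto simp: flat_fn_def\<close>)
  next
    case 2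
    have "((\<lambda>y. poly ([:0, 1:] * P) y * exp (- y)) \<longlongrightarrow> 0) at_top" by (rule poly_exp_tendsto_0)
    then have "((\<lambda>h. poly ([:0, 1:] * P) (inverse h) * exp (- inverse h)) \<longlongrightarrow> 0) (at_right 0)"
      by (rule filterlim_compose[OF _ filterlim_inverse_at_top_right])
    then have "((\<lambda>h. flat_fn P h / h) \<longlongrightarrow> 0) (at_right 0)"
      by (rule Lim_transform_eventually)
         (auto intro!: eventually_at_rightI[of 0 1] simp: flat_fn_def field_simps)
    moreover have "((\<lambda>h. flat_fn P h / h) \<longlongrightarrow> 0) (at_left 0)"
      by (rule tendsto_eventually) (auto intro!: eventually_at_leftI[of "-1"] simp: flat_fn_def)
    ultimately have "((\<lambda>h. flat_fn P h / h) \<longlongrightarrow> 0) (at 0)" by (simp add: filterlim_at_split)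
    then have "(flat_fn P has_real_derivative 0) (at 0)"
      unfolding DERIV_def by (simp add: flat_fn_def[of _ 0])
    then show ?thesis using 2 by (simp add: flat_fn_def)
  qed
qed

lemma deriv_flat: "deriv (flat_fn P) = flat_fn ([:0, 0, 1:] * (P - pderiv P))"
  by (rule ext, rule DERIV_imp_deriv, rule flat_deriv)

text \<open>Each differentiation puts a factor \<open>X^2\<close> into the polynomial. Its vanishing
  at 0 is recorded because the value there is the limit at infinity, so that derivatives of positive
  order die out far from the origin.\<close>

lemma deriv_iter_flat: "\<exists>Q. (deriv ^^ n) (flat_fn P) = flat_fn Q \<and> (n > 0 \<longrightarrow> poly Q 0 = 0) \<and> (n = 0 \<longrightarrow> Q = P)"
proof (induction n)
  case (Suc n)
  then obtain Q where "(deriv ^^ n) (flat_fn P) = flat_fn Q" by blast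
  then have "(deriv ^^ Suc n) (flat_fn P) = flat_fn ([:0, 0, 1:] * (Q - pderiv Q))" by (simp only: funpow.simps comp_def deriv_flat)
  then show ?case by (intro exI[of _ "[:0, 0, 1:] * (Q - pderiv Q)"]) (auto)
qed simp

lemma smooth_flat: "smooth (flat_fn P)"
  unfolding smooth_def using deriv_iter_flat flat_deriv field_differentiable_def by metis

lemma flat_bounded: obtains B where "\<And>x. \<bar>flat_fn P x\<bar> \<le> B"
proof -
  have "\<forall>\<^sub>F y in at_top. dist (poly P y * exp (- y)) 0 < 1"
    using poly_exp_tendsto_0[of P] by (rule tendstoD) simp
  then obtain Y where Y: "\<And>y. y \<ge> Y \<Longrightarrow> \<bar>poly P y * exp (- y)\<bar> < 1"
    by (auto simp: eventually_at_top_linorder)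
  have "compact ((\<lambda>y. poly P y * exp (- y)) ` {0..\<bar>Y\<bar>})"
    by (intro compact_continuous_image continuous_intros) auto
  then obtain B where B: "\<And>y. y \<in> {0..\<bar>Y\<bar>} \<Longrightarrow> \<bar>poly P y * exp (- y)\<bar> \<le> B"
    using compact_imp_bounded[of "(\<lambda>y. poly P y * exp (- y)) ` {0..\<bar>Y\<bar>}"] unfolding bounded_iff by fastforce
  have *: "\<bar>poly P y * exp (- y)\<bar> \<le> max B 1" if "y \<ge> 0" for y
    using Y[of y] B[of y] that by (cases "y \<ge> Y") (auto simp: le_max_iff_disj intro: less_imp_le)
  have "0 \<le> max B 1" by simp
  then show ?thesis using *[of "1 / _"] by (intro that[of "max B 1"]) (auto simp: flat_fn_def)
qed

lemma flat_tendsto: "(flat_fn P \<longlongrightarrow> poly P 0) at_top"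
proof -
  have "((\<lambda>x. poly P (inverse x) * exp (- inverse x)) \<longlongrightarrow> poly P 0 * exp (- 0)) at_top"
    by (intro tendsto_intros tendsto_inverse_0_at_top filterlim_ident)
  then have "((\<lambda>x. poly P (inverse x) * exp (- inverse x)) \<longlongrightarrow> poly P 0) at_top" by simp
  then show ?thesis
    by (rule Lim_transform_eventually)
       (auto intro!: eventually_mono[OF eventually_gt_at_top[of 0]] simp: flat_fn_def field_simps)
qed

text \<open>Bounds uniform in \<open>k\<close> and \<open>x\<close> at every order and pointwise
  limits at every order: what dominated convergence needs when an \<open>n\<close>-th derivative is
  integrated against an integrable function. \<open>L n\<close> is the limit of the
  \<open>n\<close>-th derivatives.\<close>

definition tame :: "(nat \<Rightarrow> real \<Rightarrow> real) \<Rightarrow> (nat \<Rightarrow> real \<Rightarrow> real) \<Rightarrow> bool" where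
  "tame \<Phi> L \<longleftrightarrow> (\<forall>k. smooth (\<Phi> k)) \<and>
     (\<forall>n. (\<exists>B. \<forall>k x. \<bar>(deriv ^^ n) (\<Phi> k) x\<bar> \<le> B) \<and> (\<forall>x. (\<lambda>k. (deriv ^^ n) (\<Phi> k) x) \<longlonglongrightarrow> L n x))"

lemma tame_mult:
  assumes f: "tame \<Phi> L" and g: "tame \<Psi> M"
  shows "tame (\<lambda>k x. \<Phi> k x * \<Psi> k x) (\<lambda>n x. \<Sum>i\<le>n. real (n choose i) * (L i x * M (n - i) x))"
proof -
  have sm: "smooth (\<Phi> k)" "smooth (\<Psi> k)" for k using f g by (auto simp: tame_def)
  have "\<exists>B. \<forall>i k x. \<bar>(deriv ^^ i) (\<Phi> k) x\<bar> \<le> B i" using f unfolding tame_def by metis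
  then obtain B where B: "\<And>i k x. \<bar>(deriv ^^ i) (\<Phi> k) x\<bar> \<le> B i" by blast
  have "\<exists>C. \<forall>i k x. \<bar>(deriv ^^ i) (\<Psi> k) x\<bar> \<le> C i" using g unfolding tame_def by metis
  then obtain C where C: "\<And>i k x. \<bar>(deriv ^^ i) (\<Psi> k) x\<bar> \<le> C i" by blast
  have B0: "B i \<ge> 0" for i using B[of i 0 0] by linarith
  show ?thesis
    unfolding tame_def
  proof (intro conjI allI)
    fix k show "smooth (\<lambda>x. \<Phi> k x * \<Psi> k x)" by (intro smooth_mult sm)
  next
    fix n
    have "\<bar>(deriv ^^ n) (\<lambda>x. \<Phi> k x * \<Psi> k x) x\<bar> \<le> (\<Sum>i\<le>n. real (n choose i) * (B i * C (n - i)))" for k x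
      unfolding deriv_iter_mult[OF sm]
      by (intro order_trans[OF sum_abs] sum_mono) (auto simp: abs_mult intro!: mult_mono mult_left_mono B C B0)
    then show "\<exists>B. \<forall>k x. \<bar>(deriv ^^ n) (\<lambda>x. \<Phi> k x * \<Psi> k x) x\<bar> \<le> B" by blast
  next
    fix n x
    show "(\<lambda>k. (deriv ^^ n) (\<lambda>x. \<Phi> k x * \<Psi> k x) x) \<longlonglongrightarrow> (\<Sum>i\<le>n. real (n choose i) * (L i x * M (n - i) x))"
      unfolding deriv_iter_mult[OF sm] using f g unfolding tame_def by (intro tendsto_intros) auto
  qed
qed

lemma tame_mult_one:
  assumes f: "tame \<Phi> (\<lambda>n x. if n = 0 then 1 else 0)" and g: "tame \<Psi> M"
  shows "tame (\<lambda>k x. \<Phi> k x * \<Psi> k x) M"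
proof -
  have "(\<Sum>i\<le>n. real (n choose i) * ((if i = 0 then 1 else 0) * M (n - i) x)) = M n x" for n x
  proof -
    have "(\<Sum>i\<le>n. real (n choose i) * ((if i = 0 then 1 else 0) * M (n - i) x))
      = (\<Sum>i\<le>n. if i = 0 then M n x else 0)" by (rule sum.cong) auto
    then show ?thesis by simp
  qed
  then show ?thesis using tame_mult[OF f g] by simp
qed

text \<open>\<open>flat_fn 1\<close> tends to 1 at infinity and its derivatives tend to 0, so its
  translates by \<open>k\<close> approach the constant 1 together with all derivatives. Since
  \<open>a\<close> is a sign, the chain rule factors have modulus 1.\<close>

lemma tame_flat_shift:
  assumes "a = 1 \<or> a = -1"
  shows "tame (\<lambda>k x. flat_fn 1 (a * x + real k)) (\<lambda>n x. if n = 0 then 1 else 0)"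
  unfolding tame_def
proof (intro conjI allI)
  fix k show "smooth (\<lambda>x. flat_fn 1 (a * x + real k))" by (rule smooth_affine[OF smooth_flat])
next
  fix n
  obtain Q where Q: "(deriv ^^ n) (flat_fn 1) = flat_fn Q" "n > 0 \<longrightarrow> poly Q 0 = 0" "n = 0 \<longrightarrow> Q = 1"
    using deriv_iter_flat by blast
  obtain B where B: "\<And>x. \<bar>flat_fn Q x\<bar> \<le> B" using flat_bounded[of Q] by blast
  have "\<bar>a ^ n\<bar> = 1" using assms by (auto simp: power_abs)
  then have "\<bar>(deriv ^^ n) (\<lambda>x. flat_fn 1 (a * x + real k)) x\<bar> \<le> B" for k x
    using B by (simp add: deriv_iter_affine[OF smooth_flat] Q abs_mult)
  then show "\<exists>B. \<forall>k x. \<bar>(deriv ^^ n) (\<lambda>x. flat_fn 1 (a * x + real k)) x\<bar> \<le> B" by blast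
next
  fix n x
  obtain Q where Q: "(deriv ^^ n) (flat_fn 1) = flat_fn Q" "n > 0 \<longrightarrow> poly Q 0 = 0" "n = 0 \<longrightarrow> Q = 1"
    using deriv_iter_flat by blast
  have "(\<lambda>k. a ^ n * flat_fn Q (a * x + real k)) \<longlonglongrightarrow> a ^ n * poly Q 0"
    by (intro tendsto_mult tendsto_const filterlim_compose[OF flat_tendsto]
        filterlim_tendsto_add_at_top[OF tendsto_const filterlim_real_sequentially])
  then show "(\<lambda>k. (deriv ^^ n) (\<lambda>x. flat_fn 1 (a * x + real k)) x) \<longlonglongrightarrow> (if n = 0 then 1 else 0)"
    using Q by (auto simp: deriv_iter_affine[OF smooth_flat])
qed

text \<open>Supported in \<open>[- k, k]\<close> and approaching 1 in the sense of
  \<open>tame\<close>; there is no plateau. The factors \<open>1 *\<close> and \<open>- 1 *\<close>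
  give the arguments the shape of \<open>tame_flat_shift\<close>.\<close>

definition cutoff :: "nat \<Rightarrow> real \<Rightarrow> real" where
  "cutoff k x = flat_fn 1 (1 * x + real k) * flat_fn 1 (- 1 * x + real k)"

lemma flat_1_bounds: "0 \<le> flat_fn 1 x" "flat_fn 1 x \<le> 1"
  by (auto simp: flat_fn_def)

lemma cutoff_bounds: "0 \<le> cutoff k x" "cutoff k x \<le> 1"
  unfolding cutoff_def by (intro mult_nonneg_nonneg mult_le_one flat_1_bounds)+

lemma tame_cutoff_cos:
  "tame (\<lambda>k x. cutoff k x * cos (c * x + \<alpha>)) (\<lambda>n x. c ^ n * cos (c * x + \<alpha> + real n * (pi / 2)))"
proof -
  have cos: "tame (\<lambda>k x. cos (c * x + \<alpha>)) (\<lambda>n x. c ^ n * cos (c * x + \<alpha> + real n * (pi / 2)))"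
    unfolding tame_def deriv_iter_cos
  proof (intro conjI allI exI)
    show "\<bar>c ^ n * cos (c * x + \<alpha> + real n * (pi / 2))\<bar> \<le> \<bar>c ^ n\<bar>" for n x
      by (simp add: abs_mult mult_left_le)
  qed (auto intro: smooth_cos)
  have "tame cutoff (\<lambda>n x. if n = 0 then 1 else 0)"
    unfolding cutoff_def by (intro tame_mult_one tame_flat_shift) auto
  then show ?thesis by (rule tame_mult_one[OF _ cos])
qed

lemma test_function_cutoff_cos: "test_function (\<lambda>x. cutoff k x * cos (c * x + \<alpha>))"
proof (rule test_functionI)
  show "smooth (\<lambda>x. cutoff k x * cos (c * x + \<alpha>))" using tame_cutoff_cos by (simp add: tame_def)
  show "\<bar>x\<bar> \<ge> real k \<Longrightarrow> cutoff k x * cos (c * x + \<alpha>) = 0" for x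
    by (auto simp: cutoff_def flat_fn_def)
qed

section \<open>Weak derivatives and the Fourier transform\<close>


text \<open>
  Test functions are real; a cosine and its shift by \<open>\<pi> / 2\<close> make up the complex exponential.
\<close>

lemma phase_eq:
  "of_real (\<xi> ^ n * cos (\<xi> * x + 0 + real n * (pi / 2))) + \<i> * of_real (\<xi> ^ n * cos (\<xi> * x + pi / 2 + real n * (pi / 2)))
    = (- \<i> * of_real \<xi>) ^ n * iexp (- (\<xi> * x))"
proof -
  define t where "t = \<xi> * x + real n * (pi / 2)"
  have "cos (\<xi> * x + pi / 2 + real n * (pi / 2)) = cos (t + pi / 2)"
    by (simp add: t_def algebra_simps)
  also have "\<dots> = - sin t" by (simp add: cos_add)
  finally have "of_real (\<xi> ^ n * cos (\<xi> * x + 0 + real n * (pi / 2))) + \<i> * of_real (\<xi> ^ n * cos (\<xi> * x + pi / 2 + real n * (pi / 2)))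
    = of_real (\<xi> ^ n) * (of_real (cos t) - \<i> * of_real (sin t))"
    by (simp add: t_def algebra_simps)
  also have "of_real (cos t) - \<i> * of_real (sin t) = cis (- t)"
    by (simp add: complex_eq_iff)
  also have "- t = real n * (- (pi / 2)) + - (\<xi> * x)" by (simp add: t_def)
  also have "cis \<dots> = cis (- (pi / 2)) ^ n * cis (- (\<xi> * x))"
    by (simp only: cis_mult Complex.DeMoivre)
  also have "cis (- (pi / 2)) = - \<i>" by (simp add: complex_eq_iff)
  also have "cis (- (\<xi> * x)) = iexp (- (\<xi> * x))" by (simp add: cis_conv_exp)
  finally show ?thesis by (simp only: power_mult_distrib of_real_power mult_ac)
qed

lemma test_function_cutoff: "test_function (cutoff k)"
  using test_function_cutoff_cos[of k 0 0] by simp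

lemma integrable_test_mult_L2:
  fixes g :: "real \<Rightarrow> complex"
  assumes "test_function \<phi>" "g \<in> borel_measurable borel" "square_integrable g"
  shows "integrable lborel (\<lambda>x. of_real (\<phi> x) * g x)"
  by (rule integrable_mult_L2) (use assms test_function_complex[OF assms(1)] in auto)

text \<open>Testing with a truncated character shows that \<open>(\<i> \<xi>)^n ft u \<xi>\<close>
  is the pointwise limit of \<open>ft (G k) \<xi>\<close>. The function \<open>g\<close> is only
  square integrable, but \<open>G k\<close> is integrable with energy at most that of
  \<open>g\<close>; so Bessel's inequality applies to \<open>G k\<close>, and Fatou's lemma takes it
  to the limit.\<close>

lemma ft_weak_deriv_le:
  fixes u g :: "real \<Rightarrow> complex"
  assumes u: "integrable lborel u" and [measurable]: "g \<in> borel_measurable borel"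
    and g: "square_integrable g"
    and weak: "\<And>\<phi>. test_function \<phi> \<Longrightarrow>
       (LBINT x. (deriv ^^ n) \<phi> x *\<^sub>R u x) = (-1) ^ n *\<^sub>R (LBINT x. \<phi> x *\<^sub>R g x)"
  shows "(nn_moment n (ft u)) \<le> ennreal (2 * pi * energy g)"
proof -
  have [measurable]: "u \<in> borel_measurable borel" using u by (auto dest: borel_measurable_integrable)
  have [measurable]: "cutoff k \<in> borel_measurable borel" for k using test_function_cutoff by measurable
  define G where "G k = (\<lambda>x. of_real (cutoff k x) * g x)" for k
  have [measurable]: "G k \<in> borel_measurable borel" for k unfolding G_def by measurable
  have Gi: "integrable lborel (G k)" for k
    unfolding G_def by (rule integrable_test_mult_L2[OF test_function_cutoff]) (use g in auto)
  have Gle: "norm (G k x) \<le> norm (g x)" for k x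
    using cutoff_bounds[of k x] by (simp add: G_def norm_mult mult_left_le_one_le)
  have lim: "(\<lambda>k. norm (ft (G k) \<xi>)) \<longlonglongrightarrow> \<bar>\<xi>\<bar> ^ n * norm (ft u \<xi>)" for \<xi>
  proof -
    define \<Phi> where "\<Phi> \<alpha> k = (\<lambda>x. cutoff k x * cos (\<xi> * x + \<alpha>))" for \<alpha> k
    define D where "D \<alpha> k = (\<lambda>x. complex_of_real ((deriv ^^ n) (\<Phi> \<alpha> k) x))" for \<alpha> k
    have test: "test_function (\<Phi> \<alpha> k)" for \<alpha> k unfolding \<Phi>_def by (rule test_function_cutoff_cos)
    have [measurable]: "D \<alpha> k \<in> borel_measurable borel" for \<alpha> k
      unfolding D_def using test_function_deriv_iter[OF test] by measurable
    have tame: "tame (\<Phi> \<alpha>) (\<lambda>n x. \<xi> ^ n * cos (\<xi> * x + \<alpha> + real n * (pi / 2)))" for \<alpha>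
      unfolding \<Phi>_def by (rule tame_cutoff_cos)
    have "\<exists>B. \<forall>k x. norm (D \<alpha> k x) \<le> B" for \<alpha>
      using tame[of \<alpha>] unfolding tame_def D_def norm_of_real by blast
    then have "\<forall>\<alpha>. \<exists>B. \<forall>k x. norm (D \<alpha> k x) \<le> B" by blast
    from choice[OF this] obtain B where B: "\<And>\<alpha> k x. norm (D \<alpha> k x) \<le> B \<alpha>" by blast
    have Dlim: "(\<lambda>k. D \<alpha> k x) \<longlonglongrightarrow> of_real (\<xi> ^ n * cos (\<xi> * x + \<alpha> + real n * (pi / 2)))" for \<alpha> x
      unfolding D_def using tame by (intro tendsto_of_real) (auto simp: tame_def)
    have Di: "integrable lborel (\<lambda>x. D \<alpha> k x * u x)" for \<alpha> k
      by (rule Bochner_Integration.integrable_bound[of _ "\<lambda>x. of_real (B \<alpha>) * u x"])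
         (use u B[of \<alpha> k] in \<open>auto simp: norm_mult intro!: mult_right_mono order_trans[OF B abs_ge_self]\<close>)
    have wk: "(LBINT x. D \<alpha> k x * u x) = (-1) ^ n * (LBINT x. of_real (\<Phi> \<alpha> k x) * g x)" for \<alpha> k
      using weak[OF test] by (simp add: D_def scaleR_conv_of_real)
    have "(LBINT x. (D 0 k x + \<i> * D (pi / 2) k x) * u x) = (-1) ^ n * ft (G k) \<xi>" for k
    proof -
      have "(LBINT x. (D 0 k x + \<i> * D (pi / 2) k x) * u x)
        = (LBINT x. D 0 k x * u x + \<i> * (D (pi / 2) k x * u x))"
        by (simp add: algebra_simps)
      also have "\<dots> = (LBINT x. D 0 k x * u x) + \<i> * (LBINT x. D (pi / 2) k x * u x)"
        using Di by simp
      also have "\<dots> = (-1) ^ n * ((LBINT x. of_real (\<Phi> 0 k x) * g x) + \<i> * (LBINT x. of_real (\<Phi> (pi / 2) k x) * g x))"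
        unfolding wk by (simp add: algebra_simps)
      also have "(LBINT x. of_real (\<Phi> 0 k x) * g x) + \<i> * (LBINT x. of_real (\<Phi> (pi / 2) k x) * g x)
        = (LBINT x. of_real (\<Phi> 0 k x) * g x + \<i> * (of_real (\<Phi> (pi / 2) k x) * g x))"
        using integrable_test_mult_L2[OF test _ g] by simp
      also have "\<dots> = ft (G k) \<xi>"
        unfolding ft_def
      proof (rule Bochner_Integration.integral_cong)
        fix x
        show "of_real (\<Phi> 0 k x) * g x + \<i> * (of_real (\<Phi> (pi / 2) k x) * g x) = iexp (- (\<xi> * x)) * G k x"
          using phase_eq[of \<xi> 0 x, symmetric] by (simp add: G_def \<Phi>_def algebra_simps)
      qed simp
      finally show ?thesis .
    qed
    \<comment> \<open>The \<open>n\<close>-th derivatives of the truncated characters are bounded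
      uniformly in \<open>k\<close> and converge to those of the full character; integrability of
      \<open>u\<close> supplies the majorant.\<close>
    moreover have "(\<lambda>k. LBINT x. (D 0 k x + \<i> * D (pi / 2) k x) * u x)
       \<longlonglongrightarrow> (LBINT x. ((- \<i> * of_real \<xi>) ^ n * iexp (- (\<xi> * x))) * u x)"
    proof (rule integral_dominated_convergence[where w = "\<lambda>x. (B 0 + B (pi / 2)) * norm (u x)"])
      show "AE x in lborel. (\<lambda>k. (D 0 k x + \<i> * D (pi / 2) k x) * u x) \<longlonglongrightarrow> ((- \<i> * of_real \<xi>) ^ n * iexp (- (\<xi> * x))) * u x"
        unfolding phase_eq[symmetric] by (intro AE_I2 tendsto_intros Dlim)
      have "norm (D 0 k x + \<i> * D (pi / 2) k x) \<le> B 0 + B (pi / 2)" for k x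
        using norm_triangle_ineq[of "D 0 k x" "\<i> * D (pi / 2) k x"] B[of 0 k x] B[of "pi/2" k x] by (simp add: norm_mult)
      then show "AE x in lborel. norm ((D 0 k x + \<i> * D (pi / 2) k x) * u x) \<le> (B 0 + B (pi / 2)) * norm (u x)" for k
        by (auto simp: norm_mult intro!: mult_right_mono)
    qed (use u in auto)
    moreover have "(LBINT x. ((- \<i> * of_real \<xi>) ^ n * iexp (- (\<xi> * x))) * u x) = (- \<i> * of_real \<xi>) ^ n * ft u \<xi>"
      unfolding ft_def mult.assoc by (rule integral_mult_right_zero)
    ultimately have "(\<lambda>k. (-1) ^ n * ft (G k) \<xi>) \<longlonglongrightarrow> (- \<i> * of_real \<xi>) ^ n * ft u \<xi>" by simp
    then have "(\<lambda>k. norm ((-1) ^ n * ft (G k) \<xi>)) \<longlonglongrightarrow> norm ((- \<i> * of_real \<xi>) ^ n * ft u \<xi>)"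
      by (rule tendsto_norm)
    then show ?thesis by (simp add: norm_mult norm_power)
  qed
  show ?thesis
  proof (rule nn_integral_limit_le[where u = "\<lambda>k \<xi>. ennreal ((norm (ft (G k) \<xi>))\<^sup>2)"])
    show "AE \<xi> in lborel. (\<lambda>k. ennreal ((norm (ft (G k) \<xi>))\<^sup>2)) \<longlonglongrightarrow> ennreal ((\<bar>\<xi>\<bar> ^ n * norm (ft u \<xi>))\<^sup>2)"
      by (intro AE_I2 tendsto_ennrealI tendsto_power lim)
    fix k
    have "(nn_energy (\<lambda>\<xi>. ft (G k) \<xi>)) \<le> ennreal (2 * pi) * (nn_energy (G k))"
      by (rule bessel[OF Gi])
    also have "\<dots> \<le> ennreal (2 * pi) * (nn_energy g)"
      by (intro mult_left_mono nn_integral_mono ennreal_leI power_mono Gle) auto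
    finally show "(nn_energy (\<lambda>\<xi>. ft (G k) \<xi>)) \<le> ennreal (2 * pi * energy g)"
      by (simp add: nn_integral_square[OF g] ennreal_mult')
  qed measurable
qed

section \<open>Uniqueness of weak derivatives\<close>

lemma locally_integrable_measurable:
  assumes "locally_integrable f"
  shows "f \<in> borel_measurable borel"
proof (rule borel_measurable_LIMSEQ_metric)
  show "(\<lambda>x. indicator {- real n..real n} x *\<^sub>R f x) \<in> borel_measurable borel" for n
    using assms borel_measurable_integrable unfolding locally_integrable_def set_integrable_def by force
  fix x
  show "(\<lambda>n. indicator {- real n..real n} x *\<^sub>R f x) \<longlonglongrightarrow> f x"
    by (rule tendsto_eventually, use eventually_in_interval[of x] in eventually_elim) simp
qed

text \<open>The fundamental lemma of the calculus of variations. Bumps converge to the indicators of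
  open intervals; these are stable under intersection and generate the Borel sets, so the integrals
  over all Borel sets vanish by a Dynkin argument.\<close>

lemma test_functions_separate:
  fixes f :: "real \<Rightarrow> 'a::euclidean_space"
  assumes f: "locally_integrable f"
    and zero: "\<And>\<phi>. test_function \<phi> \<Longrightarrow> (LBINT x. \<phi> x *\<^sub>R f x) = 0"
  shows "AE x in lborel. f x = 0"
proof -
  have [measurable]: "f \<in> borel_measurable borel" by (rule locally_integrable_measurable[OF f])
  have Ioo: "(LBINT x. indicator {a<..<b} x *\<^sub>R f x) = 0" for a b :: real
  proof -
    \<comment> \<open>Dilation by \<open>k\<close> keeps the support in \<open>[a, b]\<close>:
      outside one of the two arguments is never positive, and strictly inside both grow without
      bound, where \<open>flat_fn 1\<close> tends to 1.\<close>
    define \<beta> where "\<beta> k = (\<lambda>x. flat_fn 1 (real k * x + - real k * a) * flat_fn 1 (- real k * x + real k * b))" for k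
    have supp: "\<beta> k x = 0" if "x \<le> a \<or> b \<le> x" for k x
      using that
    proof
      assume "x \<le> a"
      then have "real k * x \<le> real k * a" by (rule mult_left_mono) simp
      then show ?thesis by (simp add: \<beta>_def flat_fn_def)
    next
      assume "b \<le> x"
      then have "real k * b \<le> real k * x" by (rule mult_left_mono) simp
      then show ?thesis by (simp add: \<beta>_def flat_fn_def)
    qed
    have test: "test_function (\<beta> k)" for k
    proof (rule test_functionI)
      show "smooth (\<beta> k)" unfolding \<beta>_def by (intro smooth_mult smooth_affine smooth_flat)
      show "\<beta> k x = 0" if "\<bar>x\<bar> \<ge> \<bar>a\<bar> + \<bar>b\<bar>" for x
        by (rule supp) (use that in linarith)
    qed
    have [measurable]: "\<beta> k \<in> borel_measurable borel" for k using test by measurable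
    have bound: "\<bar>\<beta> k x\<bar> \<le> indicator {a..b} x" for k x
    proof (cases "a < x \<and> x < b")
      case True
      have "0 \<le> \<beta> k x" "\<beta> k x \<le> 1"
        unfolding \<beta>_def by (intro mult_nonneg_nonneg mult_le_one flat_1_bounds)+
      then show ?thesis using True by simp
    qed (use supp in \<open>auto simp: not_less\<close>)
    have lim: "(\<lambda>k. \<beta> k x) \<longlonglongrightarrow> indicator {a<..<b} x" for x
    proof (cases "a < x \<and> x < b")
      case True
      have "(\<lambda>k. flat_fn 1 (real k * (x - a)) * flat_fn 1 (real k * (b - x))) \<longlonglongrightarrow> poly 1 0 * poly 1 0"
        using True by (intro tendsto_mult filterlim_compose[OF flat_tendsto]
            filterlim_at_top_mult_tendsto_pos[OF tendsto_const _ filterlim_real_sequentially]) auto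
      then show ?thesis using True by (simp add: \<beta>_def algebra_simps)
    qed (use supp in auto)
    have "(\<lambda>k. LBINT x. \<beta> k x *\<^sub>R f x) \<longlonglongrightarrow> (LBINT x. indicator {a<..<b} x *\<^sub>R f x)"
    proof (rule integral_dominated_convergence[where w = "\<lambda>x. norm (indicator {a..b} x *\<^sub>R f x)"])
      show "integrable lborel (\<lambda>x. norm (indicator {a..b} x *\<^sub>R f x))"
        using f unfolding locally_integrable_def set_integrable_def by (intro integrable_norm) blast
      show "AE x in lborel. (\<lambda>k. \<beta> k x *\<^sub>R f x) \<longlonglongrightarrow> indicator {a<..<b} x *\<^sub>R f x"
        by (intro AE_I2 tendsto_scaleR lim tendsto_const)
      show "AE x in lborel. norm (\<beta> k x *\<^sub>R f x) \<le> norm (indicator {a..b} x *\<^sub>R f x)" for k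
        using bound by (auto intro!: mult_right_mono)
    qed auto
    then show ?thesis by (simp add: zero[OF test] LIMSEQ_const_iff)
  qed
  have "AE x in lborel. indicator {- real m<..<real m} x *\<^sub>R f x = 0" for m :: nat
  proof -
    \<comment> \<open>The restriction to a bounded interval is integrable on the whole line, and its
      integral over an open interval is that of \<open>f\<close> over a smaller open
      interval.\<close>
    define d where "d = (\<lambda>x. indicator {- real m<..<real m} x *\<^sub>R f x)"
    have d: "integrable lborel d"
    proof (rule Bochner_Integration.integrable_bound)
      show "integrable lborel (\<lambda>x. indicator {- real m..real m} x *\<^sub>R f x)"
        using f unfolding locally_integrable_def set_integrable_def by blast
    qed (auto simp: d_def indicator_def)
    have di: "set_integrable lborel A d" if "A \<in> sets borel" for A
      using d that unfolding set_integrable_def by (simp add: integrable_mult_indicator)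
    have univ: "(LBINT x. d x) = 0" unfolding d_def by (rule Ioo)
    show ?thesis
      unfolding d_def[symmetric, THEN fun_cong]
    proof (rule sigma_finite_measure.density_zero[OF lborel.sigma_finite_measure_axioms d])
      have "(\<lambda>(a, b). box a b :: real set) = (\<lambda>(a, b). {a<..<b})"
        by (rule ext) (simp add: case_prod_beta box_real)
      then have sets_borel: "sets (borel :: real measure) = sigma_sets UNIV (range (\<lambda>(a, b). {a<..<b}))"
        by (simp add: borel_eq_box)
      fix A :: "real set" assume "A \<in> sets lborel"
      then have A: "A \<in> sigma_sets UNIV (range (\<lambda>(a, b). {a<..<b}))"
        by (simp add: sets_borel)
      have sets: "B \<in> sets borel" if "B \<in> sigma_sets UNIV (range (\<lambda>(a, b). {a<..<b::real}))" for B
        using that by (simp add: sets_borel)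
      show "(LINT x:A|lborel. d x) = 0"
      proof (rule sigma_sets_induct_disjoint[where P = "\<lambda>A. (LINT x:A|lborel. d x) = 0", OF _ _ A])
        show "Int_stable (range (\<lambda>(a, b). {a<..<b::real}))"
        proof (rule Int_stableI)
          fix I J assume "I \<in> range (\<lambda>(a, b). {a<..<b::real})" "J \<in> range (\<lambda>(a, b). {a<..<b::real})"
          then obtain a b c e where "I = {a<..<b}" "J = {c<..<e}" by auto
          then have "I \<inter> J = (\<lambda>(a, b). {a<..<b}) (max a c, min b e)" by auto
          then show "I \<inter> J \<in> range (\<lambda>(a, b). {a<..<b::real})" by blast
        qed
        fix B assume "B \<in> range (\<lambda>(a, b). {a<..<b::real})"
        then obtain a b where B: "B = {a<..<b}" by auto
        have "(LINT x:B|lborel. d x) = (LBINT x. indicator {max a (- real m)<..<min b (real m)} x *\<^sub>R f x)"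
          unfolding set_lebesgue_integral_def d_def B
          by (rule Bochner_Integration.integral_cong) (auto simp: indicator_def)
        then show "(LINT x:B|lborel. d x) = 0" by (simp add: Ioo)
      next
        fix B assume B: "B \<in> sigma_sets UNIV (range (\<lambda>(a, b). {a<..<b::real}))" "(LINT x:B|lborel. d x) = 0"
        have "(LINT x:UNIV - B|lborel. d x) = (LBINT x. d x - indicator B x *\<^sub>R d x)"
          unfolding set_lebesgue_integral_def by (rule Bochner_Integration.integral_cong) (auto simp: indicator_def)
        also have "\<dots> = (LBINT x. d x) - (LINT x:B|lborel. d x)"
          unfolding set_lebesgue_integral_def
          using di[OF sets[OF B(1)]] d by (intro Bochner_Integration.integral_diff) (auto simp: set_integrable_def)
        finally show "(LINT x:UNIV - B|lborel. d x) = 0" using univ B by simp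
      next
        fix F :: "nat \<Rightarrow> real set"
        assume F: "disjoint_family F" "range F \<subseteq> sigma_sets UNIV (range (\<lambda>(a, b). {a<..<b}))"
          and zero: "\<And>i. (LINT x:F i|lborel. d x) = 0"
        have Fs: "F i \<in> sets borel" for i using F(2) by (intro sets) auto
        have "(LINT x:(\<Union>i. F i)|lborel. d x) = (\<Sum>i. (LINT x:F i|lborel. d x))"
          by (rule lebesgue_integral_countable_add)
             (use Fs F(1) in \<open>auto simp: disjoint_family_on_def intro!: di\<close>)
        then show "(LINT x:(\<Union>i. F i)|lborel. d x) = 0" by (simp add: zero)
      qed (auto simp: set_lebesgue_integral_def)
    qed
  qed
  then have "AE x in lborel. \<forall>m. indicator {- real m<..<real m} x *\<^sub>R f x = 0"
    unfolding AE_all_countable by blast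
  then show ?thesis
  proof eventually_elim
    fix x assume x: "\<forall>m. indicator {- real m<..<real m} x *\<^sub>R f x = 0"
    obtain m :: nat where "\<bar>x\<bar> < real m" using reals_Archimedean2 by blast
    then show "f x = 0" using x[rule_format, of m] by (auto simp: indicator_def abs_less_iff)
  qed
qed

lemma integrable_test_mult:
  assumes "test_function \<phi>" "locally_integrable f"
  shows "integrable lborel (\<lambda>x. \<phi> x *\<^sub>R f x)"
proof -
  have [measurable]: "f \<in> borel_measurable borel" "\<phi> \<in> borel_measurable borel"
    using locally_integrable_measurable[OF assms(2)] assms(1) by (auto intro: test_function_measurable)
  obtain R where R: "R > 0" "\<And>x. \<bar>x\<bar> \<ge> R \<Longrightarrow> \<phi> x = 0" by (rule test_function_support[OF assms(1)]) blast
  obtain B where B: "B \<ge> 0" "\<And>x. \<bar>\<phi> x\<bar> \<le> B" by (rule test_function_bounded[OF assms(1)]) blast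
  show ?thesis
  proof (rule Bochner_Integration.integrable_bound)
    show "integrable lborel (\<lambda>x. B *\<^sub>R (indicator {-R..R} x *\<^sub>R f x))"
      using assms(2) unfolding locally_integrable_def set_integrable_def by (intro integrable_scaleR_right) blast
    have "norm (\<phi> x *\<^sub>R f x) \<le> norm (B *\<^sub>R (indicator {-R..R} x *\<^sub>R f x))" for x
      using B R(2)[of x] by (cases "\<bar>x\<bar> \<ge> R") (auto simp: indicator_def intro!: mult_right_mono)
    then show "AE x in lborel. norm (\<phi> x *\<^sub>R f x) \<le> norm (B *\<^sub>R (indicator {-R..R} x *\<^sub>R f x))" by simp
  qed measurable
qed

lemma weak_deriv_unique:
  assumes "has_weak_deriv n f g" "has_weak_deriv n f h"
  shows "AE x in lborel. g x = h x"
proof -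
  have loc: "locally_integrable g" "locally_integrable h" using assms by (auto simp: has_weak_deriv_def)
  have "AE x in lborel. g x - h x = 0"
  proof (rule test_functions_separate)
    show "locally_integrable (\<lambda>x. g x - h x)"
      using loc unfolding locally_integrable_def by (auto intro: set_integral_diff)
    fix \<phi> :: "real \<Rightarrow> real" assume \<phi>: "test_function \<phi>"
    have "(-1) ^ n *\<^sub>R (LBINT x. \<phi> x *\<^sub>R g x) = (-1) ^ n *\<^sub>R (LBINT x. \<phi> x *\<^sub>R h x)"
      using assms \<phi> unfolding has_weak_deriv_def by metis
    then have "(LBINT x. \<phi> x *\<^sub>R g x) = (LBINT x. \<phi> x *\<^sub>R h x)" by simp
    then show "(LBINT x. \<phi> x *\<^sub>R (g x - h x)) = 0"
      unfolding scaleR_diff_right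
      by (subst Bochner_Integration.integral_diff) (auto intro: integrable_test_mult[OF \<phi>] loc)
  qed
  then show ?thesis by eventually_elim simp
qed

text \<open>\<open>weak_deriv\<close> is an arbitrary choice among the representatives; by
  uniqueness its norm can be computed from any derivative constructed by other means.\<close>

lemma L2norm_weak_deriv:
  assumes "has_weak_deriv n f g" "g \<in> L2"
  shows "L2norm (weak_deriv n f) = L2norm g"
proof -
  have w: "has_weak_deriv n f (weak_deriv n f)"
    unfolding weak_deriv_def by (rule someI[of _ g]) (rule assms)
  then have [measurable]: "weak_deriv n f \<in> borel_measurable borel"
    by (auto simp: has_weak_deriv_def intro: locally_integrable_measurable)
  have [measurable]: "g \<in> borel_measurable borel" using assms(2) by (simp add: L2_def)
  have "AE x in lborel. (norm (weak_deriv n f x))\<^sup>2 = (norm (g x))\<^sup>2"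
    using weak_deriv_unique[OF w assms(1)] by eventually_elim simp
  then show ?thesis
    unfolding L2norm_def by (intro arg_cong[where f = sqrt] integral_cong_AE) auto
qed

section \<open>Vector-valued functions\<close>


lemma norm_square_vec: "(norm (x :: complex ^ 'n))\<^sup>2 = (\<Sum>i\<in>UNIV. (cmod (x $ i))\<^sup>2)"
  by (simp add: norm_vec_def L2_set_def sum_nonneg)

lemma norm_vec_smult: "norm (c *s (x :: complex ^ 'n)) = cmod c * norm x"
proof -
  have "(norm (c *s x))\<^sup>2 = (cmod c * norm x)\<^sup>2"
    by (simp add: norm_square_vec norm_mult power_mult_distrib sum_distrib_left)
  then show ?thesis by (simp add: power2_eq_iff_nonneg)
qed

lemma borel_measurable_vec_nth [measurable (raw)]:
  fixes f :: "'a \<Rightarrow> complex ^ 'n"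
  shows "f \<in> borel_measurable M \<Longrightarrow> (\<lambda>x. f x $ i) \<in> borel_measurable M"
  by (erule measurable_compose)
     (intro borel_measurable_continuous_onI bounded_linear.continuous_on[OF bounded_linear_vec_nth] continuous_on_id)

lemma borel_measurable_vecI:
  fixes f :: "'a \<Rightarrow> complex ^ 'n"
  assumes "\<And>i. (\<lambda>x. f x $ i) \<in> borel_measurable M"
  shows "f \<in> borel_measurable M"
proof (rule iffD2[OF borel_measurable_euclidean_space], rule ballI)
  fix b :: "complex ^ 'n" assume "b \<in> Basis"
  then obtain k u where b: "b = axis k u" unfolding Basis_vec_def by blast
  show "(\<lambda>x. f x \<bullet> b) \<in> borel_measurable M"
    unfolding b inner_axis by (rule borel_measurable_inner[OF assms borel_measurable_const])
qed

lemma integral_vec_nth: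
  fixes f :: "'a \<Rightarrow> complex ^ 'n"
  assumes "integrable M f"
  shows "integral\<^sup>L M f $ i = (LINT x|M. f x $ i)"
  by (rule integral_bounded_linear[OF bounded_linear_vec_nth assms, symmetric])

lemma integrable_vec_nth:
  fixes f :: "'a \<Rightarrow> complex ^ 'n"
  assumes "integrable M f"
  shows "integrable M (\<lambda>x. f x $ i)"
  by (rule integrable_bounded_linear[OF bounded_linear_vec_nth assms])

lemma integrable_fourier_kernel:
  fixes f :: "real \<Rightarrow> complex ^ 'n"
  assumes "integrable lborel f"
  shows "integrable lborel (\<lambda>x. exp (- (\<i> * of_real (\<xi> * x))) *s f x)"
proof (rule Bochner_Integration.integrable_bound[OF assms])
  have [measurable]: "f \<in> borel_measurable borel" using assms by (auto dest: borel_measurable_integrable)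
  have "(\<lambda>x. exp (- (\<i> * of_real (\<xi> * x))) *s f x) \<in> borel_measurable borel"
    by (rule borel_measurable_vecI) (simp del: of_real_mult, measurable)
  then show "(\<lambda>x. exp (- (\<i> * of_real (\<xi> * x))) *s f x) \<in> borel_measurable lborel" by simp
qed (simp add: norm_vec_smult)

lemma fourier_nth:
  fixes f :: "real \<Rightarrow> complex ^ 'n"
  assumes "integrable lborel f"
  shows "fourier f \<xi> $ i = ft (\<lambda>x. f x $ i) \<xi>"
  unfolding fourier_def ft_def integral_vec_nth[OF integrable_fourier_kernel[OF assms]] by simp

lemma norm_fourier_le:
  fixes f :: "real \<Rightarrow> complex ^ 'n"
  shows "norm (fourier f \<xi>) \<le> L1norm f"
proof -
  have "norm (fourier f \<xi>) \<le> (LBINT x. norm (exp (- (\<i> * of_real (\<xi> * x))) *s f x))"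
    unfolding fourier_def by (rule integral_norm_bound)
  then show ?thesis by (simp add: norm_vec_smult L1norm_def)
qed

lemma L2_square: "f \<in> L2 \<Longrightarrow> (L2norm f)\<^sup>2 = energy f"
  by (simp add: L2norm_def)

lemma L2_component:
  fixes f :: "real \<Rightarrow> complex ^ 'n"
  assumes "f \<in> L2"
  shows "(\<lambda>x. f x $ i) \<in> borel_measurable borel" "square_integrable (\<lambda>x. f x $ i)"
proof -
  have [measurable]: "f \<in> borel_measurable borel" and f: "square_integrable f"
    using assms by (auto simp: L2_def)
  show "(\<lambda>x. f x $ i) \<in> borel_measurable borel" by measurable
  show "square_integrable (\<lambda>x. f x $ i)"
    by (rule Bochner_Integration.integrable_bound[OF f])
       (auto intro!: power_mono Finite_Cartesian_Product.norm_nth_le)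
qed

lemma L2norm_square_sum:
  fixes f :: "real \<Rightarrow> complex ^ 'n"
  assumes "f \<in> L2"
  shows "(L2norm f)\<^sup>2 = (\<Sum>i\<in>UNIV. LBINT x. (norm (f x $ i))\<^sup>2)"
  unfolding L2_square[OF assms] norm_square_vec
  by (rule Bochner_Integration.integral_sum) (rule L2_component[OF assms])

lemma L2_integrable_on_interval:
  fixes f :: "real \<Rightarrow> 'a::euclidean_space"
  assumes "f \<in> L2"
  shows "integrable lborel (\<lambda>x. indicator {a..b} x *\<^sub>R f x)"
proof (rule Bochner_Integration.integrable_bound)
  have [measurable]: "f \<in> borel_measurable borel" and f: "square_integrable f"
    using assms by (auto simp: L2_def)
  have "integrable lborel (indicator {a..b} :: real \<Rightarrow> real)"
    by (rule integrable_real_indicator) (auto simp: emeasure_lborel_Icc_eq)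
  then show "integrable lborel (\<lambda>x. indicator {a..b} x + (norm (f x))\<^sup>2)" using f by simp
  show "(\<lambda>x. indicator {a..b} x *\<^sub>R f x) \<in> borel_measurable lborel" by measurable
  have "y \<le> 1 + y\<^sup>2" for y :: real
  proof -
    have "2 * y \<le> y\<^sup>2 + 1" using sum_squares_bound[of y 1] by simp
    then show ?thesis using zero_le_power2[of y] by linarith
  qed
  then show "AE x in lborel. norm (indicator {a..b} x *\<^sub>R f x) \<le> norm (indicator {a..b} x + (norm (f x))\<^sup>2)"
    by (auto simp: indicator_def)
qed

lemma L2_locally_integrable:
  fixes f :: "real \<Rightarrow> 'a::euclidean_space"
  shows "f \<in> L2 \<Longrightarrow> locally_integrable f"
  unfolding locally_integrable_def set_integrable_def using L2_integrable_on_interval by blast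

text \<open>The scalar bound for every component; squared norms add up, so the constant does not
  depend on the dimension.\<close>

lemma fourier_weak_deriv_le:
  fixes f g :: "real \<Rightarrow> complex ^ 'n"
  assumes f: "integrable lborel f" and g: "g \<in> L2" and w: "has_weak_deriv n f g"
  shows "(nn_moment n (fourier f)) \<le> ennreal (2 * pi * (L2norm g)\<^sup>2)"
proof -
  have loc: "locally_integrable f" "locally_integrable g" using w by (auto simp: has_weak_deriv_def)
  have [measurable]: "f \<in> borel_measurable borel" using f by (auto dest: borel_measurable_integrable)
  have "(nn_moment n (fourier f))
    = (\<integral>\<^sup>+\<xi>. (\<Sum>i\<in>UNIV. ennreal ((\<bar>\<xi>\<bar> ^ n * norm (ft (\<lambda>x. f x $ i) \<xi>))\<^sup>2)) \<partial>lborel)"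
    by (intro nn_integral_cong)
       (simp add: power_mult_distrib norm_square_vec fourier_nth[OF f] sum_distrib_left sum_ennreal)
  also have "\<dots> = (\<Sum>i\<in>UNIV. \<integral>\<^sup>+\<xi>. ennreal ((\<bar>\<xi>\<bar> ^ n * norm (ft (\<lambda>x. f x $ i) \<xi>))\<^sup>2) \<partial>lborel)"
    by (rule nn_integral_sum) measurable
  also have "\<dots> \<le> (\<Sum>i\<in>UNIV. ennreal (2 * pi * energy (\<lambda>x. g x $ i)))"
  proof (rule sum_mono, rule ft_weak_deriv_le)
    fix i :: 'n and \<phi> :: "real \<Rightarrow> real" assume \<phi>: "test_function \<phi>"
    have "(LBINT x. (deriv ^^ n) \<phi> x *\<^sub>R f x) $ i = ((-1) ^ n *\<^sub>R (LBINT x. \<phi> x *\<^sub>R g x)) $ i"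
      using w \<phi> by (simp add: has_weak_deriv_def)
    then show "(LBINT x. (deriv ^^ n) \<phi> x *\<^sub>R f x $ i) = (-1) ^ n *\<^sub>R (LBINT x. \<phi> x *\<^sub>R g x $ i)"
      using integral_vec_nth[OF integrable_test_mult[OF test_function_deriv_iter[OF \<phi>] loc(1)], of n i]
        integral_vec_nth[OF integrable_test_mult[OF \<phi> loc(2)], of i] by simp
  qed (use L2_component[OF g] integrable_vec_nth[OF f] in auto)
  also have "\<dots> = ennreal (2 * pi * (L2norm g)\<^sup>2)"
    unfolding L2norm_square_sum[OF g] by (subst sum_ennreal) (auto simp: sum_distrib_left)
  finally show ?thesis .
qed

text \<open>The converse passage, for the solution at a fixed time: a finite moment of the transform
  produces the derivative. Its components are chosen separately and assembled, and again the squares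
  add up without loss.\<close>

lemma weak_deriv_of_fourier:
  fixes u W :: "real \<Rightarrow> complex ^ 'n"
  assumes F: "has_fourier_L2 u W"
    and Q: "(nn_moment n W) \<le> ennreal Q" "Q \<ge> 0"
  obtains g where "g \<in> L2" "has_weak_deriv n u g" "2 * pi * (L2norm g)\<^sup>2 \<le> Q"
proof -
  have u: "u \<in> L2" and W: "W \<in> L2"
    and lim: "((\<lambda>R. nn_energy (\<lambda>\<xi>. fourier (\<lambda>x. indicator {-R..R} x *\<^sub>R u x) \<xi> - W \<xi>)) \<longlongrightarrow> 0) at_top"
    using F by (auto simp: has_fourier_L2_def)
  have [measurable]: "W \<in> borel_measurable borel" "u \<in> borel_measurable borel" using W u by (auto simp: L2_def)
  have Wn: "integrable lborel (\<lambda>\<xi>. (\<bar>\<xi>\<bar> ^ n * norm (W \<xi>))\<^sup>2)" "(LBINT \<xi>. (\<bar>\<xi>\<bar> ^ n * norm (W \<xi>))\<^sup>2) \<le> Q"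
  proof -
    define f where "f = (\<lambda>\<xi>. complex_of_real (\<bar>\<xi>\<bar> ^ n * norm (W \<xi>)))"
    have [measurable]: "f \<in> borel_measurable borel" unfolding f_def by measurable
    have f: "(norm (f \<xi>))\<^sup>2 = (\<bar>\<xi>\<bar> ^ n * norm (W \<xi>))\<^sup>2" for \<xi>
      unfolding f_def norm_of_real by (rule power2_abs)
    show "integrable lborel (\<lambda>\<xi>. (\<bar>\<xi>\<bar> ^ n * norm (W \<xi>))\<^sup>2)" "(LBINT \<xi>. (\<bar>\<xi>\<bar> ^ n * norm (W \<xi>))\<^sup>2) \<le> Q"
      using square_integrable_bound[of f lborel Q] Q unfolding f by simp_all
  qed
  have Wi: "integrable lborel (\<lambda>\<xi>. (\<bar>\<xi>\<bar> ^ n * norm (W \<xi> $ i))\<^sup>2)" for i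
    by (rule Bochner_Integration.integrable_bound[OF Wn(1)])
       (auto intro!: power_mono mult_left_mono Finite_Cartesian_Product.norm_nth_le)
  let ?P = "\<lambda>i g. g \<in> borel_measurable borel \<and> square_integrable g
    \<and> 2 * pi * energy g \<le> (LBINT \<xi>. (\<bar>\<xi>\<bar> ^ n * norm (W \<xi> $ i))\<^sup>2)
    \<and> (\<forall>\<phi>. test_function \<phi> \<longrightarrow> (LBINT x. (deriv ^^ n) \<phi> x *\<^sub>R (u x $ i)) = (-1) ^ n *\<^sub>R (LBINT x. \<phi> x *\<^sub>R g x))"
  have "\<exists>g. ?P i g" for i
  proof -
    have "(\<lambda>k. nn_energy (\<lambda>\<xi>. fourier (\<lambda>x. indicator {- real k..real k} x *\<^sub>R u x) \<xi> - W \<xi>)) \<longlonglongrightarrow> 0"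
      by (rule filterlim_compose[OF lim filterlim_real_sequentially])
    then have comp: "(\<lambda>k. nn_energy (\<lambda>\<xi>. ft (\<lambda>x. indicator {- real k..real k} x *\<^sub>R u x $ i) \<xi> - W \<xi> $ i)) \<longlonglongrightarrow> 0"
    proof (rule ennreal_tendsto_0_le, intro nn_integral_mono ennreal_leI power_mono)
      fix k \<xi>
      have "ft (\<lambda>x. indicator {- real k..real k} x *\<^sub>R u x $ i) \<xi> - W \<xi> $ i
        = (fourier (\<lambda>x. indicator {- real k..real k} x *\<^sub>R u x) \<xi> - W \<xi>) $ i"
        using fourier_nth[OF L2_integrable_on_interval[OF u], of "- real k" "real k" \<xi> i] by simp
      then show "norm (ft (\<lambda>x. indicator {- real k..real k} x *\<^sub>R u x $ i) \<xi> - W \<xi> $ i)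
        \<le> norm (fourier (\<lambda>x. indicator {- real k..real k} x *\<^sub>R u x) \<xi> - W \<xi>)"
        by (simp only: Finite_Cartesian_Product.norm_nth_le)
    qed simp
    show ?thesis
      by (rule weak_deriv_of_ft[OF L2_component(1)[OF u, of i] L2_component(1)[OF W, of i] L2_component(2)[OF u] L2_component(2)[OF W] comp Wi])
         blast
  qed
  then have "\<forall>i. \<exists>g. ?P i g" by blast
  from choice[OF this] obtain h where "\<forall>i. ?P i (h i)" ..
  then have h [measurable]: "\<And>i. h i \<in> borel_measurable borel"
    and h2: "\<And>i. square_integrable (h i)"
    and hle: "\<And>i. 2 * pi * energy (h i) \<le> (LBINT \<xi>. (\<bar>\<xi>\<bar> ^ n * norm (W \<xi> $ i))\<^sup>2)"
    and weak: "\<And>i \<phi>. test_function \<phi> \<Longrightarrow> (LBINT x. (deriv ^^ n) \<phi> x *\<^sub>R (u x $ i)) = (-1) ^ n *\<^sub>R (LBINT x. \<phi> x *\<^sub>R h i x)"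
    by simp_all
  define g :: "real \<Rightarrow> complex ^ 'n" where "g x = (\<chi> i. h i x)" for x
  have gm: "g \<in> borel_measurable borel" by (rule borel_measurable_vecI) (simp add: g_def)
  have g2: "square_integrable g"
    unfolding norm_square_vec by (intro Bochner_Integration.integrable_sum) (simp add: g_def h2)
  have g: "g \<in> L2" using gm g2 by (simp add: L2_def)
  show ?thesis
  proof
    show "g \<in> L2" by fact
    have loc: "locally_integrable u" "locally_integrable g" using u g by (auto intro: L2_locally_integrable)
    have "(LBINT x. (deriv ^^ n) \<phi> x *\<^sub>R u x) = (-1) ^ n *\<^sub>R (LBINT x. \<phi> x *\<^sub>R g x)" if \<phi>: "test_function \<phi>" for \<phi>
    proof (subst vec_eq_iff, rule allI)
      fix i
      show "(LBINT x. (deriv ^^ n) \<phi> x *\<^sub>R u x) $ i = ((-1) ^ n *\<^sub>R (LBINT x. \<phi> x *\<^sub>R g x)) $ i"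
        using integral_vec_nth[OF integrable_test_mult[OF test_function_deriv_iter[OF \<phi>] loc(1)], of n i]
          integral_vec_nth[OF integrable_test_mult[OF \<phi> loc(2)], of i] weak[OF \<phi>, of i] by (simp add: g_def)
    qed
    then show "has_weak_deriv n u g" using loc by (simp add: has_weak_deriv_def)
    have "2 * pi * (L2norm g)\<^sup>2 = (\<Sum>i\<in>UNIV. 2 * pi * energy (h i))"
      unfolding L2norm_square_sum[OF g] by (simp add: g_def sum_distrib_left)
    also have "\<dots> \<le> (\<Sum>i\<in>UNIV. LBINT \<xi>. (\<bar>\<xi>\<bar> ^ n * norm (W \<xi> $ i))\<^sup>2)"
      by (rule sum_mono) (rule hle)
    also have "\<dots> = (LBINT \<xi>. (\<Sum>i\<in>UNIV. (\<bar>\<xi>\<bar> ^ n * norm (W \<xi> $ i))\<^sup>2))"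
      by (rule Bochner_Integration.integral_sum[symmetric]) (rule Wi)
    also have "\<dots> = (LBINT \<xi>. (\<bar>\<xi>\<bar> ^ n * norm (W \<xi>))\<^sup>2)"
      by (simp add: power_mult_distrib norm_square_vec sum_distrib_left)
    finally show "2 * pi * (L2norm g)\<^sup>2 \<le> Q" using Wn(2) by simp
  qed
qed

section \<open>The system in Fourier space\<close>


text \<open>The terms of the energy and the corrections to it all have the shape
  \<open>Re (c * (f t * cnj (g t)))\<close>, so this single rule differentiates the whole Lyapunov
  functional.\<close>

lemma has_derivative_Re_cnj:
  assumes "(f has_vector_derivative f') (at t within S)" "(g has_vector_derivative g') (at t within S)"
  shows "((\<lambda>t. Re (c * (f t * cnj (g t)))) has_real_derivative Re (c * (f' * cnj (g t) + f t * cnj g'))) (at t within S)"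
proof -
  have "((\<lambda>t. f t * cnj (g t)) has_vector_derivative (f t * cnj g' + f' * cnj (g t))) (at t within S)"
    by (rule has_vector_derivative_mult[OF assms(1) has_vector_derivative_cnj[OF assms(2)]])
  then have "((\<lambda>t. c * (f t * cnj (g t))) has_vector_derivative c * (f t * cnj g' + f' * cnj (g t))) (at t within S)"
    by (rule has_vector_derivative_mult_right)
  then have "((\<lambda>t. Re (c * (f t * cnj (g t)))) has_vector_derivative Re (c * (f t * cnj g' + f' * cnj (g t)))) (at t within S)"
    by (rule bounded_linear.has_vector_derivative[OF bounded_linear_Re])
  then show ?thesis
    by (simp add: has_real_derivative_iff_has_vector_derivative add.commute)
qed

lemma Re_cnj_bounds:
  "r * Re (a * cnj b) \<le> \<bar>r\<bar> * (cmod a * cmod b)"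
  "r * Re (\<i> * (a * cnj b)) \<le> \<bar>r\<bar> * (cmod a * cmod b)"
proof -
  have "\<bar>r * Re z\<bar> \<le> \<bar>r\<bar> * cmod z" for z
    unfolding abs_mult by (intro mult_left_mono abs_Re_le_cmod) simp
  from this[of "a * cnj b"] this[of "\<i> * (a * cnj b)"]
  show "r * Re (a * cnj b) \<le> \<bar>r\<bar> * (cmod a * cmod b)"
    "r * Re (\<i> * (a * cnj b)) \<le> \<bar>r\<bar> * (cmod a * cmod b)"
    by (simp_all only: norm_mult complex_mod_cnj norm_ii mult_1 abs_le_iff)
qed

lemma small_error:
  fixes c \<theta> \<tau> P S :: real
  assumes "0 \<le> c" "0 \<le> \<theta>" "\<theta> \<le> \<tau>" "0 \<le> P" "P \<le> S"
  shows "c * \<theta> * P \<le> c * \<tau> * S"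
  using assms by (intro mult_mono mult_left_mono) auto

text \<open>
  The powers of \<open>\<tau>\<close> grow strictly concavely along the chain, so that each error term is
  \<open>O(\<tau>)\<close> times a product of two of the quantities \<open>M0, \<dots>, M6\<close>.
\<close>

lemma chain_dissipation:
  fixes k1 k4 \<gamma> \<alpha> \<delta> \<tau> x i h U V W P M N :: real
  assumes pos: "k1 > 0" "k4 > 0" "\<gamma> > 0" "\<alpha> \<ge> 0" "\<delta> \<ge> 0" "0 < \<tau>" "\<tau> \<le> 1" "0 \<le> x" "0 \<le> i" "i \<le> 1" "x * i \<le> 1"
    and nonneg: "0 \<le> h" "0 \<le> U" "0 \<le> V" "0 \<le> W" "0 \<le> P" "0 \<le> M" "0 \<le> N"
  defines "S \<equiv> (x * h)\<^sup>2 + (\<tau> ^ 6 * (x * i)\<^sup>2 * U)\<^sup>2 + (\<tau> ^ 11 * (x * i) ^ 3 * V)\<^sup>2 + (\<tau> ^ 15 * ((x * i) ^ 3 * i) * W)\<^sup>2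
      + (\<tau> ^ 18 * ((x * i) ^ 3 * i) * P)\<^sup>2 + (\<tau> ^ 20 * ((x * i) ^ 3 * i) * M)\<^sup>2 + (\<tau> ^ 21 * ((x * i) ^ 3 * i) * N)\<^sup>2"
    and "K \<equiv> 8 + 4 * \<gamma> + k4 + 3 * k1 + 5 * \<alpha> + \<delta>"
  shows "- 2 * k4 * x\<^sup>2 * h\<^sup>2
    + \<tau> ^ 12 * (x\<^sup>2 * i ^ 4) * (- \<gamma> * x\<^sup>2 * U\<^sup>2 + \<gamma> * x\<^sup>2 * h\<^sup>2 + k4 * x ^ 3 * (h * U) + k1 * x\<^sup>2 * (h * V))
    + \<tau> ^ 22 * (x ^ 4 * i ^ 6) * (- k1 * x\<^sup>2 * V\<^sup>2 + x\<^sup>2 * U\<^sup>2 + \<gamma> * x\<^sup>2 * (h * V) + x * (U * W))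
    + \<tau> ^ 30 * (x ^ 6 * i ^ 8) * (- W\<^sup>2 + 2 * k1 * V\<^sup>2 + x * (U * W) + x * (V * P))
    + \<tau> ^ 36 * (x ^ 4 * i ^ 8) * (- x\<^sup>2 * P\<^sup>2 + 2 * \<gamma> * x * (h * P) + 2 * x * (U * (M + \<alpha> * W)) + x\<^sup>2 * (W * (M + \<alpha> * W)))
    + \<tau> ^ 40 * (x ^ 4 * i ^ 8) * (- x\<^sup>2 * M\<^sup>2 + \<alpha> * x\<^sup>2 * (W * M) + x\<^sup>2 * (P * N))
    + \<tau> ^ 42 * (x ^ 4 * i ^ 8) * (- x\<^sup>2 * N\<^sup>2 + \<alpha> * x\<^sup>2 * M\<^sup>2 + \<delta> * x\<^sup>2 * (M * W))
    \<le> (K * \<tau> - min (min (2 * k4) \<gamma>) (min k1 1)) * S"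
proof -
  \<comment> \<open>In the application \<open>x\<close> is \<open>|\<xi>|\<close> and
    \<open>i\<close> is \<open>1 / sqrt (1 + \<xi>^2)\<close>. Then \<open>r\<close> behaves like
    \<open>|\<xi>|\<close> near 0 and like 1 at infinity, so powers of \<open>r\<close> and
    \<open>i\<close> adjust the two regimes independently.\<close>
  define r where "r = x * i"
  have r: "0 \<le> r" "r \<le> 1" using pos by (auto simp: r_def)
  \<comment> \<open>The exponents 0, 6, 11, 15, 18, 20, 21 of \<open>\<tau>\<close> have second
    differences -1. Twice an inner exponent exceeds the sum of its two neighbours by exactly 1,
    which leaves one factor \<open>\<tau>\<close> in front of a product of neighbours.\<close>
  define M0 where "M0 = x * h"
  define M1 where "M1 = \<tau> ^ 6 * r\<^sup>2 * U"
  define M2 where "M2 = \<tau> ^ 11 * r ^ 3 * V"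
  define M3 where "M3 = \<tau> ^ 15 * (r ^ 3 * i) * W"
  define M4 where "M4 = \<tau> ^ 18 * (r ^ 3 * i) * P"
  define M5 where "M5 = \<tau> ^ 20 * (r ^ 3 * i) * M"
  define M6 where "M6 = \<tau> ^ 21 * (r ^ 3 * i) * N"
  note Mdefs = M0_def M1_def M2_def M3_def M4_def M5_def M6_def
  have S: "S = M0\<^sup>2 + M1\<^sup>2 + M2\<^sup>2 + M3\<^sup>2 + M4\<^sup>2 + M5\<^sup>2 + M6\<^sup>2"
    unfolding S_def Mdefs r_def by (simp only:)
  have Mnn: "0 \<le> M0" "0 \<le> M1" "0 \<le> M2" "0 \<le> M3" "0 \<le> M4" "0 \<le> M5" "0 \<le> M6"
    unfolding Mdefs using pos nonneg r by auto
  have ab: "a * b \<le> (a\<^sup>2 + b\<^sup>2)" for a b :: real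
    using sum_squares_bound[of a b] zero_le_power2[of a] zero_le_power2[of b] by linarith
  have sq: "0 \<le> M0\<^sup>2" "0 \<le> M1\<^sup>2" "0 \<le> M2\<^sup>2" "0 \<le> M3\<^sup>2" "0 \<le> M4\<^sup>2" "0 \<le> M5\<^sup>2" "0 \<le> M6\<^sup>2" by auto
  have t: "\<tau> ^ j * \<theta> \<le> \<tau>" if "0 \<le> \<theta>" "\<theta> \<le> 1" "0 < j" for j \<theta>
  proof -
    have "\<tau> ^ (j - 1) * \<theta> \<le> 1" using pos that by (intro mult_le_one power_le_one) auto
    then have "\<tau> * (\<tau> ^ (j - 1) * \<theta>) \<le> \<tau> * 1" using pos by (intro mult_left_mono) auto
    then show ?thesis using that by (simp add: power_eq_if)
  qed
  have le_S: "M0 * M0 \<le> S" "M1 * M1 \<le> S" "M2 * M2 \<le> S" "M3 * M3 \<le> S" "M4 * M4 \<le> S" "M5 * M5 \<le> S"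
    "M0 * M1 \<le> S" "M0 * M2 \<le> S" "M1 * M3 \<le> S" "M2 * M4 \<le> S" "M0 * M4 \<le> S" "M1 * M5 \<le> S" "M3 * M5 \<le> S"
    "M4 * M6 \<le> S" "M5 * M3 \<le> S"
    unfolding S using sq ab[of M0 M1] ab[of M0 M2] ab[of M1 M3] ab[of M2 M4] ab[of M0 M4] ab[of M1 M5]
      ab[of M3 M5] ab[of M4 M6] ab[of M5 M3]
    by (simp_all only: power2_eq_square[symmetric])
  have err: "c * (\<tau> ^ j * \<theta>) * (A * B) \<le> c * \<tau> * S"
    if "0 \<le> c" "0 < j" "0 \<le> \<theta>" "\<theta> \<le> 1" "0 \<le> A" "0 \<le> B" "A * B \<le> S" for c A B j \<theta>
    using that pos by (intro small_error t) auto
  have \<theta>: "0 \<le> r\<^sup>2 * i\<^sup>2" "r\<^sup>2 * i\<^sup>2 \<le> 1" "0 \<le> r\<^sup>2 * i" "r\<^sup>2 * i \<le> 1" "0 \<le> r * i ^ 3" "r * i ^ 3 \<le> 1"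
    "0 \<le> r\<^sup>2" "r\<^sup>2 \<le> 1" "0 \<le> i\<^sup>2" "i\<^sup>2 \<le> 1" "0 \<le> r" "r \<le> 1" "0 \<le> i" "i \<le> 1" "0 \<le> (1::real)" "1 \<le> (1::real)"
    using r pos by (auto intro!: mult_le_one power_le_one)
  have c: "0 \<le> \<gamma>" "0 \<le> k4" "0 \<le> k1" "0 \<le> 2 * k1" "0 \<le> \<alpha>" "0 \<le> 2 * \<alpha>" "0 \<le> 2 * \<gamma>" "0 \<le> (2 :: real)" "0 \<le> \<delta>"
    using pos by auto
  \<comment> \<open>One bound for each of the eighteen error terms; \<open>K\<close> is the sum of
    their coefficients.\<close>
  have es: "\<gamma> * (\<tau> ^ 12 * (r\<^sup>2 * i\<^sup>2)) * (M0 * M0) \<le> \<gamma> * \<tau> * S"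
    "k4 * (\<tau> ^ 6 * (r\<^sup>2)) * (M0 * M1) \<le> k4 * \<tau> * S"
    "k1 * (\<tau> ^ 1 * (i)) * (M0 * M2) \<le> k1 * \<tau> * S"
    "1 * (\<tau> ^ 10 * (r\<^sup>2)) * (M1 * M1) \<le> 1 * \<tau> * S"
    "\<gamma> * (\<tau> ^ 11 * (r\<^sup>2 * i)) * (M0 * M2) \<le> \<gamma> * \<tau> * S"
    "1 * (\<tau> ^ 1 * (1)) * (M1 * M3) \<le> 1 * \<tau> * S"
    "(2 * k1) * (\<tau> ^ 8 * (i\<^sup>2)) * (M2 * M2) \<le> (2 * k1) * \<tau> * S"
    "1 * (\<tau> ^ 9 * (r\<^sup>2)) * (M1 * M3) \<le> 1 * \<tau> * S"
    "1 * (\<tau> ^ 1 * (r)) * (M2 * M4) \<le> 1 * \<tau> * S"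
    "(2 * \<gamma>) * (\<tau> ^ 18 * (r * i ^ 3)) * (M0 * M4) \<le> (2 * \<gamma>) * \<tau> * S"
    "2 * (\<tau> ^ 10 * (i\<^sup>2)) * (M1 * M5) \<le> 2 * \<tau> * S"
    "(2 * \<alpha>) * (\<tau> ^ 15 * (i\<^sup>2)) * (M1 * M3) \<le> (2 * \<alpha>) * \<tau> * S"
    "1 * (\<tau> ^ 1 * (1)) * (M3 * M5) \<le> 1 * \<tau> * S"
    "\<alpha> * (\<tau> ^ 6 * (1)) * (M3 * M3) \<le> \<alpha> * \<tau> * S"
    "(\<alpha>) * (\<tau> ^ 5 * (1)) * (M3 * M5) \<le> (\<alpha>) * \<tau> * S"
    "1 * (\<tau> ^ 1 * (1)) * (M4 * M6) \<le> 1 * \<tau> * S"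
    "(\<alpha>) * (\<tau> ^ 2 * (1)) * (M5 * M5) \<le> (\<alpha>) * \<tau> * S"
    "\<delta> * (\<tau> ^ 7 * (1)) * (M5 * M3) \<le> \<delta> * \<tau> * S"
    by (intro err \<theta> c Mnn le_S; simp)+
  have id1: "\<tau> ^ 12 * (x\<^sup>2 * i ^ 4) * (- \<gamma> * x\<^sup>2 * U\<^sup>2 + \<gamma> * x\<^sup>2 * h\<^sup>2 + k4 * x ^ 3 * (h * U) + k1 * x\<^sup>2 * (h * V))
    = - \<gamma> * M1\<^sup>2 + (\<gamma> * (\<tau> ^ 12 * (r\<^sup>2 * i\<^sup>2)) * (M0 * M0) + k4 * (\<tau> ^ 6 * (r\<^sup>2)) * (M0 * M1) + k1 * (\<tau> ^ 1 * (i)) * (M0 * M2))"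
    unfolding Mdefs r_def by algebra
  have id2: "\<tau> ^ 22 * (x ^ 4 * i ^ 6) * (- k1 * x\<^sup>2 * V\<^sup>2 + x\<^sup>2 * U\<^sup>2 + \<gamma> * x\<^sup>2 * (h * V) + x * (U * W))
    = - k1 * M2\<^sup>2 + (1 * (\<tau> ^ 10 * (r\<^sup>2)) * (M1 * M1) + \<gamma> * (\<tau> ^ 11 * (r\<^sup>2 * i)) * (M0 * M2) + 1 * (\<tau> ^ 1 * (1)) * (M1 * M3))"
    unfolding Mdefs r_def by algebra
  have id3: "\<tau> ^ 30 * (x ^ 6 * i ^ 8) * (- W\<^sup>2 + 2 * k1 * V\<^sup>2 + x * (U * W) + x * (V * P))
    = - M3\<^sup>2 + ((2 * k1) * (\<tau> ^ 8 * (i\<^sup>2)) * (M2 * M2) + 1 * (\<tau> ^ 9 * (r\<^sup>2)) * (M1 * M3) + 1 * (\<tau> ^ 1 * (r)) * (M2 * M4))"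
    unfolding Mdefs r_def by algebra
  have id4: "\<tau> ^ 36 * (x ^ 4 * i ^ 8) * (- x\<^sup>2 * P\<^sup>2 + 2 * \<gamma> * x * (h * P) + 2 * x * (U * (M + \<alpha> * W)) + x\<^sup>2 * (W * (M + \<alpha> * W)))
    = - M4\<^sup>2 + ((2 * \<gamma>) * (\<tau> ^ 18 * (r * i ^ 3)) * (M0 * M4) + 2 * (\<tau> ^ 10 * (i\<^sup>2)) * (M1 * M5) + (2 * \<alpha>) * (\<tau> ^ 15 * (i\<^sup>2)) * (M1 * M3) + 1 * (\<tau> ^ 1 * (1)) * (M3 * M5) + \<alpha> * (\<tau> ^ 6 * (1)) * (M3 * M3))"
    unfolding Mdefs r_def by algebra
  have id5: "\<tau> ^ 40 * (x ^ 4 * i ^ 8) * (- x\<^sup>2 * M\<^sup>2 + \<alpha> * x\<^sup>2 * (W * M) + x\<^sup>2 * (P * N))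
    = - M5\<^sup>2 + ((\<alpha>) * (\<tau> ^ 5 * (1)) * (M3 * M5) + 1 * (\<tau> ^ 1 * (1)) * (M4 * M6))"
    unfolding Mdefs r_def by algebra
  have id6: "\<tau> ^ 42 * (x ^ 4 * i ^ 8) * (- x\<^sup>2 * N\<^sup>2 + \<alpha> * x\<^sup>2 * M\<^sup>2 + \<delta> * x\<^sup>2 * (M * W))
    = - M6\<^sup>2 + ((\<alpha>) * (\<tau> ^ 2 * (1)) * (M5 * M5) + \<delta> * (\<tau> ^ 7 * (1)) * (M5 * M3))"
    unfolding Mdefs r_def by algebra
  have id0: "- 2 * k4 * x\<^sup>2 * h\<^sup>2 = - (2 * k4) * M0\<^sup>2" unfolding Mdefs by (simp add: power_mult_distrib)
  define c0 where "c0 = min (min (2 * k4) \<gamma>) (min k1 1)"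
  have c0: "c0 \<le> 2 * k4" "c0 \<le> \<gamma>" "c0 \<le> k1" "c0 \<le> 1" by (auto simp: c0_def)
  have "c0 * M0\<^sup>2 \<le> 2 * k4 * M0\<^sup>2" "c0 * M1\<^sup>2 \<le> \<gamma> * M1\<^sup>2" "c0 * M2\<^sup>2 \<le> k1 * M2\<^sup>2" "c0 * M3\<^sup>2 \<le> 1 * M3\<^sup>2"
    "c0 * M4\<^sup>2 \<le> 1 * M4\<^sup>2" "c0 * M5\<^sup>2 \<le> 1 * M5\<^sup>2" "c0 * M6\<^sup>2 \<le> 1 * M6\<^sup>2"
    using c0 by (intro mult_right_mono; simp)+
  moreover have "c0 * S = c0 * M0\<^sup>2 + c0 * M1\<^sup>2 + c0 * M2\<^sup>2 + c0 * M3\<^sup>2 + c0 * M4\<^sup>2 + c0 * M5\<^sup>2 + c0 * M6\<^sup>2"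
    unfolding S by (simp only: distrib_left)
  moreover have "0 \<le> \<alpha> * \<tau> * S" "0 \<le> \<tau> * S" using pos S by auto
  moreover have "(K * \<tau> - c0) * S = 8 * (\<tau> * S) + 4 * (\<gamma> * \<tau> * S) + k4 * \<tau> * S + 3 * (k1 * \<tau> * S) + 5 * (\<alpha> * \<tau> * S) + \<delta> * \<tau> * S - c0 * S"
    unfolding K_def by (simp add: algebra_simps)
  ultimately show ?thesis
    unfolding id0 id1 id2 id3 id4 id5 id6 c0_def[symmetric]
    using es sq by linarith
qed


text \<open>Gronwall's inequality by means of the integrating factor \<open>exp (c * s)\<close>. The
  derivative at 0 is one-sided, so monotonicity is drawn from the open interval together with
  continuity on the closed one.\<close>

lemma exponential_decay:
  fixes L :: "real \<Rightarrow> real"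
  assumes der: "\<And>t. t \<ge> 0 \<Longrightarrow> (L has_real_derivative L' t) (at t within {0..})"
    and le: "\<And>t. t \<ge> 0 \<Longrightarrow> L' t \<le> - c * L t" and t: "t \<ge> 0"
  shows "L t \<le> exp (- c * t) * L 0"
proof -
  define g where "g s = exp (c * s) * L s" for s
  have g: "(g has_real_derivative exp (c * s) * (c * L s + L' s)) (at s within {0..})" if "s \<ge> 0" for s
    unfolding g_def by (rule derivative_eq_intros der that refl)+ (simp add: algebra_simps)
  have "g 0 \<ge> g t"
  proof (rule DERIV_nonpos_imp_decreasing_open[OF t])
    fix s assume s: "0 < s" "s < t"
    then have "(g has_real_derivative exp (c * s) * (c * L s + L' s)) (at s)"
      using g[of s] at_within_interior[of s "{0..}"] by simp
    moreover have "exp (c * s) * (c * L s + L' s) \<le> 0"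
      using le[of s] s by (intro mult_nonneg_nonpos) auto
    ultimately show "\<exists>y. (g has_real_derivative y) (at s) \<and> y \<le> 0" by blast
  next
    show "continuous_on {0..t} g"
      unfolding continuous_on_eq_continuous_within
    proof
      fix s assume "s \<in> {0..t}"
      then have "continuous (at s within {0..}) g" using g[of s] DERIV_continuous by auto
      then show "continuous (at s within {0..t}) g" by (rule continuous_within_subset) auto
    qed
  qed
  then have "exp (- c * t) * (exp (c * t) * L t) \<le> exp (- c * t) * L 0"
    by (intro mult_left_mono) (auto simp: g_def)
  moreover have "exp (- c * t) * (exp (c * t) * L t) = L t"
    by (simp add: mult.assoc[symmetric] exp_add[symmetric])
  ultimately show ?thesis by (simp only:)
qed

section \<open>The chain of coupled equations and its Lyapunov functional\<close>

context
  fixes k1 k4 \<gamma> \<alpha> \<delta> \<xi> :: real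
  assumes pos: "k1 > 0" "k4 > 0" "\<gamma> > 0" "\<alpha> \<ge> 0" "\<delta> \<ge> 0"
begin

abbreviation (input) ix :: complex where "ix \<equiv> \<i> * of_real \<xi>"

text \<open>The left-hand sides of these six bounds are the derivatives of the products in the
  functional, written literally as \<open>has_derivative_Re_cnj\<close> delivers them. One pairing
  in each yields the negative square of the next member, and the remaining ones are estimated by
  their moduli.\<close>

lemma chain_bound_1:
  "Re (- \<i> * of_real \<xi> * ((of_real k4 * (ix\<^sup>2 * \<eta>) - of_real \<gamma> * (ix * u)) * cnj u
       + \<eta> * cnj (of_real k1 * (ix * v) - of_real \<gamma> * (ix * \<eta>))))
   \<le> - \<gamma> * \<bar>\<xi>\<bar>\<^sup>2 * (cmod u)\<^sup>2 + \<gamma> * \<bar>\<xi>\<bar>\<^sup>2 * (cmod \<eta>)\<^sup>2 + k4 * \<bar>\<xi>\<bar> ^ 3 * (cmod \<eta> * cmod u) + k1 * \<bar>\<xi>\<bar>\<^sup>2 * (cmod \<eta> * cmod v)"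
  (is "?L \<le> _")
proof -
  have "?L = - \<gamma> * \<xi>\<^sup>2 * (cmod u)\<^sup>2 + \<gamma> * \<xi>\<^sup>2 * (cmod \<eta>)\<^sup>2 + (k4 * \<xi> ^ 3) * Re (\<i> * (\<eta> * cnj u)) + (- k1 * \<xi>\<^sup>2) * Re (\<eta> * cnj v)"
    unfolding cmod_power2 by (simp add: power2_eq_square power3_eq_cube algebra_simps)
  moreover have "\<bar>k4 * \<xi> ^ 3\<bar> = k4 * \<bar>\<xi>\<bar> ^ 3" "\<bar>- k1 * \<xi>\<^sup>2\<bar> = k1 * \<bar>\<xi>\<bar>\<^sup>2" using pos by (auto simp: abs_mult power_abs)
  ultimately show ?thesis
    using Re_cnj_bounds(2)[of "k4 * \<xi> ^ 3" \<eta> u] Re_cnj_bounds(1)[of "- k1 * \<xi>\<^sup>2" \<eta> v] by simp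
qed

lemma chain_bound_2:
  "Re (ix * ((of_real k1 * (ix * v) - of_real \<gamma> * (ix * \<eta>)) * cnj v
       + u * cnj (ix * u + w)))
   \<le> - k1 * \<bar>\<xi>\<bar>\<^sup>2 * (cmod v)\<^sup>2 + \<bar>\<xi>\<bar>\<^sup>2 * (cmod u)\<^sup>2 + \<gamma> * \<bar>\<xi>\<bar>\<^sup>2 * (cmod \<eta> * cmod v) + \<bar>\<xi>\<bar> * (cmod u * cmod w)"
  (is "?L \<le> _")
proof -
  have "?L = - k1 * \<xi>\<^sup>2 * (cmod v)\<^sup>2 + \<xi>\<^sup>2 * (cmod u)\<^sup>2 + (\<gamma> * \<xi>\<^sup>2) * Re (\<eta> * cnj v) + \<xi> * Re (\<i> * (u * cnj w))"
    unfolding cmod_power2 by (simp add: power2_eq_square power3_eq_cube algebra_simps)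
  moreover have "\<bar>\<gamma> * \<xi>\<^sup>2\<bar> = \<gamma> * \<bar>\<xi>\<bar>\<^sup>2" using pos by (auto simp: abs_mult power_abs)
  ultimately show ?thesis
    using Re_cnj_bounds(1)[of "\<gamma> * \<xi>\<^sup>2" \<eta> v] Re_cnj_bounds(2)[of \<xi> u w] by simp
qed

lemma chain_bound_3:
  "Re (- 1 * ((ix * u + w) * cnj w + v * cnj (ix * p - 2 * of_real k1 * v)))
   \<le> - (cmod w)\<^sup>2 + 2 * k1 * (cmod v)\<^sup>2 + \<bar>\<xi>\<bar> * (cmod u * cmod w) + \<bar>\<xi>\<bar> * (cmod v * cmod p)"
  (is "?L \<le> _")
proof -
  have "?L = - (cmod w)\<^sup>2 + 2 * k1 * (cmod v)\<^sup>2 + (- \<xi>) * Re (\<i> * (u * cnj w)) + \<xi> * Re (\<i> * (v * cnj p))"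
    unfolding cmod_power2 by (simp add: power2_eq_square power3_eq_cube algebra_simps)
  then show ?thesis
    using Re_cnj_bounds(2)[of "- \<xi>" u w] Re_cnj_bounds(2)[of \<xi> v p] by simp
qed

text \<open>The multiple of \<open>w\<close> also creates the dissipation: its derivative
  contributes \<open>- (\<xi>^2 / 2) p\<close>, and the factor 2 normalizes the outcome to
  \<open>- \<xi>^2\<close> times the square of the modulus of \<open>p\<close>. The equation for
  \<open>p\<close> involves \<open>m\<close> and \<open>w\<close> together, whence the sums on the
  right.\<close>

lemma chain_bound_4:
  "Re (2 * ((of_real k1 * (ix * v) - of_real \<gamma> * (ix * \<eta>)
        + \<i> * of_real (\<xi> / 2) * (ix * p - 2 * of_real k1 * v)) * cnj p
       + (u + \<i> * of_real (\<xi> / 2) * w) * cnj (ix * (m + of_real \<alpha> * w))))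
   \<le> - \<bar>\<xi>\<bar>\<^sup>2 * (cmod p)\<^sup>2 + 2 * \<gamma> * \<bar>\<xi>\<bar> * (cmod \<eta> * cmod p) + 2 * \<bar>\<xi>\<bar> * (cmod u * (cmod m + \<alpha> * cmod w))
     + \<bar>\<xi>\<bar>\<^sup>2 * (cmod w * (cmod m + \<alpha> * cmod w))"
  (is "?L \<le> _")
proof -
  let ?q = "m + of_real \<alpha> * w"
  have "cmod ?q \<le> cmod m + \<alpha> * cmod w"
    using norm_triangle_ineq[of m "of_real \<alpha> * w"] pos by (simp add: norm_mult)
  then have "\<bar>\<xi>\<bar> * (cmod u * cmod ?q) \<le> \<bar>\<xi>\<bar> * (cmod u * (cmod m + \<alpha> * cmod w))"
    "\<bar>\<xi>\<bar>\<^sup>2 * (cmod w * cmod ?q) \<le> \<bar>\<xi>\<bar>\<^sup>2 * (cmod w * (cmod m + \<alpha> * cmod w))"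
    by (intro mult_left_mono; simp)+
  moreover have "?L = - \<xi>\<^sup>2 * (cmod p)\<^sup>2 + (- 2 * \<gamma> * \<xi>) * Re (\<i> * (\<eta> * cnj p)) + (- 2 * \<xi>) * Re (\<i> * (u * cnj ?q)) + \<xi>\<^sup>2 * Re (w * cnj ?q)"
    unfolding cmod_power2 by (simp add: power2_eq_square power3_eq_cube algebra_simps)
  moreover have "\<bar>- 2 * \<gamma> * \<xi>\<bar> = 2 * \<gamma> * \<bar>\<xi>\<bar>" "\<bar>- 2 * \<xi>\<bar> = 2 * \<bar>\<xi>\<bar>" using pos by (auto simp: abs_mult power_abs)
  ultimately show ?thesis
    using Re_cnj_bounds(2)[of "- 2 * \<gamma> * \<xi>" \<eta> p] Re_cnj_bounds(2)[of "- 2 * \<xi>" u ?q] Re_cnj_bounds(1)[of "\<xi>\<^sup>2" w ?q]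
    by simp
qed

lemma chain_bound_5:
  "Re (ix * ((ix * (m + of_real \<alpha> * w)) * cnj m + p * cnj (ix * n)))
   \<le> - \<bar>\<xi>\<bar>\<^sup>2 * (cmod m)\<^sup>2 + \<alpha> * \<bar>\<xi>\<bar>\<^sup>2 * (cmod w * cmod m) + \<bar>\<xi>\<bar>\<^sup>2 * (cmod p * cmod n)"
  (is "?L \<le> _")
proof -
  have "?L = - \<xi>\<^sup>2 * (cmod m)\<^sup>2 + (- \<alpha> * \<xi>\<^sup>2) * Re (w * cnj m) + \<xi>\<^sup>2 * Re (p * cnj n)"
    unfolding cmod_power2 by (simp add: power2_eq_square power3_eq_cube algebra_simps)
  moreover have "\<bar>- \<alpha> * \<xi>\<^sup>2\<bar> = \<alpha> * \<bar>\<xi>\<bar>\<^sup>2" using pos by (auto simp: abs_mult power_abs)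
  ultimately show ?thesis
    using Re_cnj_bounds(1)[of "- \<alpha> * \<xi>\<^sup>2" w m] Re_cnj_bounds(1)[of "\<xi>\<^sup>2" p n] by simp
qed

lemma chain_bound_6:
  "Re (ix * ((ix * n) * cnj n + m * cnj (ix * (of_real \<alpha> * m + of_real \<delta> * w))))
   \<le> - \<bar>\<xi>\<bar>\<^sup>2 * (cmod n)\<^sup>2 + \<alpha> * \<bar>\<xi>\<bar>\<^sup>2 * (cmod m)\<^sup>2 + \<delta> * \<bar>\<xi>\<bar>\<^sup>2 * (cmod m * cmod w)"
  (is "?L \<le> _")
proof -
  have "?L = - \<xi>\<^sup>2 * (cmod n)\<^sup>2 + \<alpha> * \<xi>\<^sup>2 * (cmod m)\<^sup>2 + (\<delta> * \<xi>\<^sup>2) * Re (m * cnj w)"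
    unfolding cmod_power2 by (simp add: power2_eq_square power3_eq_cube algebra_simps)
  moreover have "\<bar>\<delta> * \<xi>\<^sup>2\<bar> = \<delta> * \<bar>\<xi>\<bar>\<^sup>2" using pos by (auto simp: abs_mult power_abs)
  ultimately show ?thesis
    using Re_cnj_bounds(1)[of "\<delta> * \<xi>\<^sup>2" m w] by simp
qed

text \<open>The physical energy \<open>H\<close> has the exact dissipation law but is not the sum of
  squares \<open>E\<close> of the chain variables, so it enters abstractly through the equivalence
  constants \<open>a\<close> and \<open>b\<close>. For small \<open>\<tau>\<close> the corrected
  functional is still equivalent to \<open>E\<close>, and its derivative is at most
  \<open>- (c0 / 2)\<close> times a weighted sum of squares. The smallest weight in that sum gives
  the rate.\<close>

lemma chain_decay:
  fixes \<eta> u v w p m n :: "real \<Rightarrow> complex" and H :: "real \<Rightarrow> real" and a b \<tau> :: real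
  defines "E \<equiv> \<lambda>t. (cmod (\<eta> t))\<^sup>2 + (cmod (u t))\<^sup>2 + (cmod (v t))\<^sup>2 + (cmod (w t))\<^sup>2 + (cmod (p t))\<^sup>2 + (cmod (m t))\<^sup>2 + (cmod (n t))\<^sup>2"
    and "K \<equiv> 8 + 4 * \<gamma> + k4 + 3 * k1 + 5 * \<alpha> + \<delta>" and "c0 \<equiv> min (min (2 * k4) \<gamma>) (min k1 1)"
  assumes der: "\<And>t. t \<ge> 0 \<Longrightarrow> (\<eta> has_vector_derivative of_real k4 * (ix\<^sup>2 * \<eta> t) - of_real \<gamma> * (ix * u t)) (at t within {0..})"
      "\<And>t. t \<ge> 0 \<Longrightarrow> (u has_vector_derivative of_real k1 * (ix * v t) - of_real \<gamma> * (ix * \<eta> t)) (at t within {0..})"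
      "\<And>t. t \<ge> 0 \<Longrightarrow> (v has_vector_derivative ix * u t + w t) (at t within {0..})"
      "\<And>t. t \<ge> 0 \<Longrightarrow> (w has_vector_derivative ix * p t - 2 * of_real k1 * v t) (at t within {0..})"
      "\<And>t. t \<ge> 0 \<Longrightarrow> (p has_vector_derivative ix * (m t + of_real \<alpha> * w t)) (at t within {0..})"
      "\<And>t. t \<ge> 0 \<Longrightarrow> (m has_vector_derivative ix * n t) (at t within {0..})"
      "\<And>t. t \<ge> 0 \<Longrightarrow> (n has_vector_derivative ix * (of_real \<alpha> * m t + of_real \<delta> * w t)) (at t within {0..})"
    and H: "\<And>t. t \<ge> 0 \<Longrightarrow> (H has_real_derivative - 2 * k4 * \<bar>\<xi>\<bar>\<^sup>2 * (cmod (\<eta> t))\<^sup>2) (at t within {0..})"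
    and HE: "\<And>t. t \<ge> 0 \<Longrightarrow> a * E t \<le> H t" "\<And>t. t \<ge> 0 \<Longrightarrow> H t \<le> b * E t"
    and ab: "0 < a" "0 < b" and \<tau>: "0 < \<tau>" "\<tau> \<le> 1" "K * \<tau> \<le> c0 / 2" "8 * \<tau> \<le> a / 2"
    and t: "t \<ge> 0"
  shows "E t \<le> (b + a / 2) / (a / 2) * exp (- (c0 / 2 * \<tau> ^ 42 / (b + a / 2)) * decay_rate \<xi> * t) * E 0"
proof -
  define x where "x = \<bar>\<xi>\<bar>"
  \<comment> \<open>A smooth substitute for the minimum of 1 and \<open>1 / |\<xi>|\<close>; its
    eighth power turns into the denominator of the rate.\<close>
  define i where "i = 1 / sqrt (1 + \<xi>\<^sup>2)"
  have x: "0 \<le> x" "x\<^sup>2 = \<xi>\<^sup>2" by (auto simp: x_def)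
  have s1: "1 \<le> sqrt (1 + \<xi>\<^sup>2)" by simp
  have "x \<le> sqrt (1 + \<xi>\<^sup>2)" by (rule real_le_rsqrt) (simp add: x)
  moreover have "0 \<le> 1 / s \<and> 1 / s \<le> 1 \<and> x * (1 / s) \<le> 1" if "1 \<le> s" "x \<le> s" for s
    using that by (auto simp: divide_simps)
  ultimately have i: "0 \<le> i" "i \<le> 1" "x * i \<le> 1" unfolding i_def using s1 by blast+
  have f: "x ^ 6 * i ^ 8 = \<xi> ^ 6 / (1 + \<xi>\<^sup>2) ^ 4"
  proof -
    have "x ^ 6 = \<xi> ^ 6" by (simp add: x_def power_even_abs)
    moreover have "sqrt (1 + \<xi>\<^sup>2) ^ 8 = (1 + \<xi>\<^sup>2) ^ 4"
    proof -
      have "sqrt (1 + \<xi>\<^sup>2) ^ 8 = ((sqrt (1 + \<xi>\<^sup>2))\<^sup>2) ^ 4" by algebra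
      also have "(sqrt (1 + \<xi>\<^sup>2))\<^sup>2 = 1 + \<xi>\<^sup>2" by (rule real_sqrt_pow2) simp
      finally show ?thesis .
    qed
    ultimately show ?thesis by (simp only: i_def power_divide power_one times_divide_eq_right mult_1_right)
  qed
  \<comment> \<open>The constant in each product gives the square of the next member a negative real
    coefficient when the equation of the preceding member is inserted. \<open>F3\<close> has no
    factor \<open>\<xi>\<close>, since \<open>w\<close> enters the derivative of \<open>v\<close>
    with coefficient 1.\<close>
  define F1 where "F1 t = Re (- \<i> * of_real \<xi> * (\<eta> t * cnj (u t)))" for t
  define F2 where "F2 t = Re (ix * (u t * cnj (v t)))" for t
  define F3 where "F3 t = Re (- 1 * (v t * cnj (w t)))" for t
  \<comment> \<open>The summand with \<open>w\<close> removes \<open>v\<close> from the derivative of \<open>u\<close>, since \<open>w' = \<i> \<xi> p - 2 k1 v\<close>; an error term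
    in \<open>v\<close> could not be absorbed at low frequencies.\<close>
  define F4 where "F4 t = Re (2 * ((u t + \<i> * of_real (\<xi> / 2) * w t) * cnj (p t)))" for t
  define F5 where "F5 t = Re (ix * (p t * cnj (m t)))" for t
  define F6 where "F6 t = Re (ix * (m t * cnj (n t)))" for t
  \<comment> \<open>Apart from powers of \<open>\<tau>\<close>, each weight times the
    \<open>\<xi>^2\<close> of its dissipation term is the square of a coefficient
    \<open>r^2\<close>, \<open>r^3\<close> or \<open>r^3 i\<close> with \<open>r = x * i\<close>.
    The dissipation of \<open>F3\<close> lacks \<open>\<xi>^2\<close>, so its weight has two more
    powers of \<open>x\<close> than those of \<open>F4\<close>, \<open>F5\<close> and
    \<open>F6\<close>.\<close>
  define L where "L t = H t + \<tau> ^ 12 * (x\<^sup>2 * i ^ 4) * F1 t + \<tau> ^ 22 * (x ^ 4 * i ^ 6) * F2 t + \<tau> ^ 30 * (x ^ 6 * i ^ 8) * F3 t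
    + \<tau> ^ 36 * (x ^ 4 * i ^ 8) * F4 t + \<tau> ^ 40 * (x ^ 4 * i ^ 8) * F5 t + \<tau> ^ 42 * (x ^ 4 * i ^ 8) * F6 t" for t
  have \<tau>1: "\<tau> ^ j \<le> \<tau>" if "0 < j" for j
    using \<tau> that power_decreasing[of 1 j \<tau>] by simp
  have E0: "0 \<le> E t" for t by (simp add: E_def)
  \<comment> \<open>The 8 is \<open>1 + 1 + 1 + 3 + 1 + 1\<close>. The 3 belongs to
    \<open>F4\<close>, whose two summands are bounded by \<open>2 * E t\<close> and
    \<open>x * E t\<close>.\<close>
  have equiv: "\<bar>L t - H t\<bar> \<le> 8 * \<tau> * E t" for t
  proof -
    have ab2: "A * B \<le> A\<^sup>2 + B\<^sup>2" for A B :: real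
      using sum_squares_bound[of A B] zero_le_power2[of A] zero_le_power2[of B] by linarith
    have small: "\<bar>\<tau> ^ j * y * F\<bar> \<le> \<tau> * (C * E t)"
      if "\<bar>F\<bar> \<le> z * E t" "0 \<le> y" "y * z \<le> C" "0 < j" for j y z F C
    proof -
      have "\<bar>\<tau> ^ j * y * F\<bar> = \<tau> ^ j * (y * \<bar>F\<bar>)" using that \<tau> by (simp add: abs_mult)
      also have "\<dots> \<le> \<tau> * (y * \<bar>F\<bar>)" by (rule mult_right_mono[OF \<tau>1]) (use that in simp_all)
      also have "\<dots> \<le> \<tau> * (C * E t)"
      proof (rule mult_left_mono)
        have "y * \<bar>F\<bar> \<le> y * (z * E t)" by (rule mult_left_mono) (use that in auto)
        also have "\<dots> = (y * z) * E t" by simp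
        also have "\<dots> \<le> C * E t" by (rule mult_right_mono) (use that E0 in auto)
        finally show "y * \<bar>F\<bar> \<le> C * E t" .
      qed (use \<tau> in simp)
      finally show ?thesis .
    qed
    have Fle: "\<bar>Re (c * (A * cnj B))\<bar> \<le> cmod c * E t" if "cmod A * cmod B \<le> E t" for c A B
    proof -
      have "\<bar>Re (c * (A * cnj B))\<bar> \<le> cmod c * (cmod A * cmod B)"
        using abs_Re_le_cmod[of "c * (A * cnj B)"] by (simp add: norm_mult)
      also have "\<dots> \<le> cmod c * E t" by (rule mult_left_mono[OF that]) simp
      finally show ?thesis .
    qed
    have sq: "0 \<le> (cmod (\<eta> t))\<^sup>2" "0 \<le> (cmod (u t))\<^sup>2" "0 \<le> (cmod (v t))\<^sup>2" "0 \<le> (cmod (w t))\<^sup>2"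
      "0 \<le> (cmod (p t))\<^sup>2" "0 \<le> (cmod (m t))\<^sup>2" "0 \<le> (cmod (n t))\<^sup>2" by simp_all
    have pairs: "cmod (\<eta> t) * cmod (u t) \<le> E t" "cmod (u t) * cmod (v t) \<le> E t" "cmod (v t) * cmod (w t) \<le> E t"
      "cmod (u t) * cmod (p t) \<le> E t" "cmod (w t) * cmod (p t) \<le> E t" "cmod (p t) * cmod (m t) \<le> E t" "cmod (m t) * cmod (n t) \<le> E t"
      unfolding E_def by (rule order_trans[OF ab2], use sq in linarith)+
    have b1: "\<bar>F1 t\<bar> \<le> x * E t" "\<bar>F2 t\<bar> \<le> x * E t" "\<bar>F3 t\<bar> \<le> 1 * E t" "\<bar>F5 t\<bar> \<le> x * E t" "\<bar>F6 t\<bar> \<le> x * E t"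
      unfolding F1_def F2_def F3_def F5_def F6_def
      using Fle[OF pairs(1), of "- \<i> * of_real \<xi>"] Fle[OF pairs(2), of "ix"] Fle[OF pairs(3), of "- 1"]
        Fle[OF pairs(6), of "ix"] Fle[OF pairs(7), of "ix"]
      by (simp_all add: norm_mult x_def)
    have "F4 t = Re (2 * (u t * cnj (p t))) + Re (ix * (w t * cnj (p t)))"
      by (simp add: F4_def algebra_simps)
    then have "\<bar>F4 t\<bar> \<le> \<bar>Re (2 * (u t * cnj (p t)))\<bar> + \<bar>Re (ix * (w t * cnj (p t)))\<bar>"
      by (simp only: abs_triangle_ineq)
    also have "\<dots> \<le> 2 * E t + x * E t"
      using Fle[OF pairs(4), of 2] Fle[OF pairs(5), of "ix"] by (simp add: norm_mult x_def)
    finally have b4: "\<bar>F4 t\<bar> \<le> (2 + x) * E t" by (simp add: distrib_right)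
    have r: "0 \<le> x * i" using x i by simp
    have le1: "(x * i) ^ j * i ^ k \<le> 1" for j k
      by (rule mult_le_one[OF power_le_one[OF r i(3)] zero_le_power[OF i(1)] power_le_one[OF i(1,2)]])
    have "(x\<^sup>2 * i ^ 4) * x = (x * i) ^ 3 * i ^ 1" "(x ^ 4 * i ^ 6) * x = (x * i) ^ 5 * i ^ 1"
      "(x ^ 6 * i ^ 8) * 1 = (x * i) ^ 6 * i ^ 2" "(x ^ 4 * i ^ 8) * (2 + x) = 2 * ((x * i) ^ 4 * i ^ 4) + (x * i) ^ 5 * i ^ 3"
      "(x ^ 4 * i ^ 8) * x = (x * i) ^ 5 * i ^ 3"
      by algebra+
    then have wt: "(x\<^sup>2 * i ^ 4) * x \<le> 1" "(x ^ 4 * i ^ 6) * x \<le> 1" "(x ^ 6 * i ^ 8) * 1 \<le> 1"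
      "(x ^ 4 * i ^ 8) * (2 + x) \<le> 3" "(x ^ 4 * i ^ 8) * x \<le> 1"
      using le1[of 3 1] le1[of 5 1] le1[of 6 2] le1[of 4 4] le1[of 5 3] by linarith+
    have nn: "0 \<le> x\<^sup>2 * i ^ 4" "0 \<le> x ^ 4 * i ^ 6" "0 \<le> x ^ 6 * i ^ 8" "0 \<le> x ^ 4 * i ^ 8" using x i by auto
    have "\<bar>\<tau> ^ 12 * (x\<^sup>2 * i ^ 4) * F1 t\<bar> \<le> \<tau> * (1 * E t)" by (rule small[OF b1(1) nn(1) wt(1)]) simp
    moreover have "\<bar>\<tau> ^ 22 * (x ^ 4 * i ^ 6) * F2 t\<bar> \<le> \<tau> * (1 * E t)" by (rule small[OF b1(2) nn(2) wt(2)]) simp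
    moreover have "\<bar>\<tau> ^ 30 * (x ^ 6 * i ^ 8) * F3 t\<bar> \<le> \<tau> * (1 * E t)" by (rule small[OF b1(3) nn(3) wt(3)]) simp
    moreover have "\<bar>\<tau> ^ 36 * (x ^ 4 * i ^ 8) * F4 t\<bar> \<le> \<tau> * (3 * E t)" by (rule small[OF b4 nn(4) wt(4)]) simp
    moreover have "\<bar>\<tau> ^ 40 * (x ^ 4 * i ^ 8) * F5 t\<bar> \<le> \<tau> * (1 * E t)" by (rule small[OF b1(4) nn(4) wt(5)]) simp
    moreover have "\<bar>\<tau> ^ 42 * (x ^ 4 * i ^ 8) * F6 t\<bar> \<le> \<tau> * (1 * E t)" by (rule small[OF b1(5) nn(4) wt(5)]) simp
    ultimately show ?thesis unfolding L_def by (simp only: mult_1 mult.left_commute[of \<tau> 3] mult.assoc[of 8])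
  qed
  have lower: "a / 2 * E t \<le> L t" and upper: "L t \<le> (b + a / 2) * E t" if "t \<ge> 0" for t
  proof -
    have "8 * \<tau> * E t \<le> a / 2 * E t" by (rule mult_right_mono[OF \<tau>(4) E0])
    then have "\<bar>L t - H t\<bar> \<le> a / 2 * E t" using equiv[of t] by linarith
    moreover have "a * E t = a / 2 * E t + a / 2 * E t" by simp
    moreover have "(b + a / 2) * E t = b * E t + a / 2 * E t" by (simp only: distrib_right)
    ultimately have "a / 2 * E t \<le> L t \<and> L t \<le> (b + a / 2) * E t"
      using HE[OF that] by linarith
    then show "a / 2 * E t \<le> L t" "L t \<le> (b + a / 2) * E t" by blast+
  qed
  define D where "D t = - 2 * k4 * \<bar>\<xi>\<bar>\<^sup>2 * (cmod (\<eta> t))\<^sup>2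
    + \<tau> ^ 12 * (x\<^sup>2 * i ^ 4) * Re (- \<i> * of_real \<xi> * ((of_real k4 * (ix\<^sup>2 * \<eta> t) - of_real \<gamma> * (ix * u t)) * cnj (u t)
       + \<eta> t * cnj (of_real k1 * (ix * v t) - of_real \<gamma> * (ix * \<eta> t))))
    + \<tau> ^ 22 * (x ^ 4 * i ^ 6) * Re (ix * ((of_real k1 * (ix * v t) - of_real \<gamma> * (ix * \<eta> t)) * cnj (v t)
       + u t * cnj (ix * u t + w t)))
    + \<tau> ^ 30 * (x ^ 6 * i ^ 8) * Re (- 1 * ((ix * u t + w t) * cnj (w t) + v t * cnj (ix * p t - 2 * of_real k1 * v t)))
    + \<tau> ^ 36 * (x ^ 4 * i ^ 8) * Re (2 * ((of_real k1 * (ix * v t) - of_real \<gamma> * (ix * \<eta> t)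
        + \<i> * of_real (\<xi> / 2) * (ix * p t - 2 * of_real k1 * v t)) * cnj (p t)
       + (u t + \<i> * of_real (\<xi> / 2) * w t) * cnj (ix * (m t + of_real \<alpha> * w t))))
    + \<tau> ^ 40 * (x ^ 4 * i ^ 8) * Re (ix * ((ix * (m t + of_real \<alpha> * w t)) * cnj (m t) + p t * cnj (ix * n t)))
    + \<tau> ^ 42 * (x ^ 4 * i ^ 8) * Re (ix * ((ix * n t) * cnj (n t) + m t * cnj (ix * (of_real \<alpha> * m t + of_real \<delta> * w t))))" for t
  have derL: "(L has_real_derivative D t) (at t within {0..})" if "t \<ge> 0" for t
    unfolding L_def[abs_def] D_def F1_def F2_def F3_def F4_def F5_def F6_def
    by (intro DERIV_add DERIV_cmult has_derivative_Re_cnj has_vector_derivative_add has_vector_derivative_mult_right H der that)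
  have Dle: "D t \<le> - (c0 / 2 * \<tau> ^ 42 / (b + a / 2) * (x ^ 6 * i ^ 8)) * L t" if t: "t \<ge> 0" for t
  proof -
    have regroup: "- (P * Y) * (y / B) = - (P / B * Y) * y" for P Y y B :: real by simp
    define S where "S = (x * cmod (\<eta> t))\<^sup>2 + (\<tau> ^ 6 * (x * i)\<^sup>2 * cmod (u t))\<^sup>2 + (\<tau> ^ 11 * (x * i) ^ 3 * cmod (v t))\<^sup>2
      + (\<tau> ^ 15 * ((x * i) ^ 3 * i) * cmod (w t))\<^sup>2 + (\<tau> ^ 18 * ((x * i) ^ 3 * i) * cmod (p t))\<^sup>2
      + (\<tau> ^ 20 * ((x * i) ^ 3 * i) * cmod (m t))\<^sup>2 + (\<tau> ^ 21 * ((x * i) ^ 3 * i) * cmod (n t))\<^sup>2"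
    have nn: "0 \<le> \<tau> ^ 12 * (x\<^sup>2 * i ^ 4)" "0 \<le> \<tau> ^ 22 * (x ^ 4 * i ^ 6)" "0 \<le> \<tau> ^ 30 * (x ^ 6 * i ^ 8)"
      "0 \<le> \<tau> ^ 36 * (x ^ 4 * i ^ 8)" "0 \<le> \<tau> ^ 40 * (x ^ 4 * i ^ 8)" "0 \<le> \<tau> ^ 42 * (x ^ 4 * i ^ 8)"
      using x i \<tau> by auto
    have "D t \<le> (K * \<tau> - c0) * S"
      unfolding D_def S_def K_def c0_def
      by (rule order_trans[OF _ chain_dissipation[OF pos(1,2,3,4,5) \<tau>(1,2) x(1) i]])
         (unfold x_def, (intro add_mono order_refl norm_ge_zero mult_left_mono[OF chain_bound_1 nn(1)[unfolded x_def]]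
           mult_left_mono[OF chain_bound_2 nn(2)[unfolded x_def]] mult_left_mono[OF chain_bound_3 nn(3)[unfolded x_def]]
           mult_left_mono[OF chain_bound_4 nn(4)[unfolded x_def]] mult_left_mono[OF chain_bound_5 nn(5)[unfolded x_def]]
           mult_left_mono[OF chain_bound_6 nn(6)[unfolded x_def]])+)
    also have "\<dots> \<le> - (c0 / 2) * S"
      using \<tau>(3) by (intro mult_right_mono) (auto simp: S_def)
    also have "\<dots> \<le> - (c0 / 2) * (\<tau> ^ 42 * (x ^ 6 * i ^ 8) * E t)"
    proof (rule mult_left_mono_neg)
      \<comment> \<open>21 is the largest exponent of \<open>\<tau>\<close> in \<open>S\<close>,
        whence the power 42 in the rate; the other weights are only larger because
        \<open>\<tau> \<le> 1\<close>.\<close>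
      have sq: "\<tau> ^ 42 * (x ^ 6 * i ^ 8) * A\<^sup>2 \<le> (\<tau> ^ e * X * A)\<^sup>2" if "x ^ 6 * i ^ 8 \<le> X\<^sup>2" "e \<le> 21" for A X e
      proof -
        have "\<tau> ^ 42 \<le> \<tau> ^ (2 * e)" using \<tau> that by (intro power_decreasing) auto
        then have "\<tau> ^ 42 * (x ^ 6 * i ^ 8) \<le> \<tau> ^ (2 * e) * X\<^sup>2" using that x i \<tau> by (intro mult_mono) auto
        then have "\<tau> ^ 42 * (x ^ 6 * i ^ 8) * A\<^sup>2 \<le> \<tau> ^ (2 * e) * X\<^sup>2 * A\<^sup>2" by (rule mult_right_mono) simp
        also have "\<dots> = (\<tau> ^ e * X * A)\<^sup>2" by (simp add: power_mult_distrib power_mult mult.commute flip: power_mult)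
        finally show ?thesis .
      qed
      have r: "0 \<le> x * i" using x i by simp
      have le1: "(x * i) ^ j * i ^ k \<le> 1" for j k
        by (rule mult_le_one[OF power_le_one[OF r i(3)] zero_le_power[OF i(1)] power_le_one[OF i(1,2)]])
      have "x ^ 6 * i ^ 8 = x\<^sup>2 * ((x * i) ^ 4 * i ^ 4)" by algebra
      also have "\<dots> \<le> x\<^sup>2 * 1" by (rule mult_left_mono[OF le1]) simp
      finally have X0: "x ^ 6 * i ^ 8 \<le> x\<^sup>2" by simp
      have "x ^ 6 * i ^ 8 = ((x * i)\<^sup>2)\<^sup>2 * ((x * i) ^ 2 * i ^ 2)" by algebra
      also have "\<dots> \<le> ((x * i)\<^sup>2)\<^sup>2 * 1" by (rule mult_left_mono[OF le1]) simp
      finally have X1: "x ^ 6 * i ^ 8 \<le> ((x * i)\<^sup>2)\<^sup>2" by simp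
      have "x ^ 6 * i ^ 8 = ((x * i) ^ 3)\<^sup>2 * ((x * i) ^ 0 * i ^ 2)" by algebra
      also have "\<dots> \<le> ((x * i) ^ 3)\<^sup>2 * 1" by (rule mult_left_mono[OF le1]) simp
      finally have X2: "x ^ 6 * i ^ 8 \<le> ((x * i) ^ 3)\<^sup>2" by simp
      have "x ^ 6 * i ^ 8 = ((x * i) ^ 3 * i)\<^sup>2" by algebra
      then have X3: "x ^ 6 * i ^ 8 \<le> ((x * i) ^ 3 * i)\<^sup>2" by simp
      have "\<tau> ^ 42 * (x ^ 6 * i ^ 8) * (cmod (\<eta> t))\<^sup>2 \<le> (x * cmod (\<eta> t))\<^sup>2" using sq[OF X0, of 0] by simp
      then show "\<tau> ^ 42 * (x ^ 6 * i ^ 8) * E t \<le> S"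
        unfolding E_def S_def distrib_left
        by (intro add_mono sq X1 X2 X3) simp_all
      show "- (c0 / 2) \<le> 0" using pos by (simp add: c0_def)
    qed
    also have "\<dots> = - (c0 / 2 * \<tau> ^ 42 * (x ^ 6 * i ^ 8)) * E t" by simp
    also have "\<dots> \<le> - (c0 / 2 * \<tau> ^ 42 * (x ^ 6 * i ^ 8)) * (L t / (b + a / 2))"
    proof (rule mult_left_mono_neg)
      show "L t / (b + a / 2) \<le> E t" using upper[OF t] ab by (simp add: divide_le_eq mult.commute)
      show "- (c0 / 2 * \<tau> ^ 42 * (x ^ 6 * i ^ 8)) \<le> 0" using pos \<tau> x i by (simp add: c0_def)
    qed
    finally show ?thesis
      unfolding regroup .
  qed
  let ?c = "c0 / 2 * \<tau> ^ 42 / (b + a / 2) * (x ^ 6 * i ^ 8)"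
  have "a / 2 * E t \<le> L t" by (rule lower[OF t])
  also have "\<dots> \<le> exp (- ?c * t) * L 0" by (rule exponential_decay[OF derL Dle t])
  also have "\<dots> \<le> exp (- ?c * t) * ((b + a / 2) * E 0)" by (rule mult_left_mono[OF upper]) auto
  finally have "E t \<le> exp (- ?c * t) * ((b + a / 2) * E 0) / (a / 2)"
    using ab by (simp add: pos_le_divide_eq mult.commute)
  moreover have "e * (B * y) / q = B / q * e * y" for e B y q :: real by simp
  moreover have "- ?c * t = - (c0 / 2 * \<tau> ^ 42 / (b + a / 2)) * (x ^ 6 * i ^ 8) * t" by simp
  ultimately show ?thesis unfolding f[symmetric] by (simp only:)
qed

end


section \<open>From the chain back to the seven components of the system\<close>

lemma exhaust_7:
  fixes x :: 7
  shows "x = 1 \<or> x = 2 \<or> x = 3 \<or> x = 4 \<or> x = 5 \<or> x = 6 \<or> x = 7"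
proof (induct x)
  case (of_int z)
  then have "0 \<le> z" "z < 7" by simp_all
  then have "z = 0 \<or> z = 1 \<or> z = 2 \<or> z = 3 \<or> z = 4 \<or> z = 5 \<or> z = 6" by arith
  then show ?case by auto
qed

lemma UNIV_7: "(UNIV :: 7 set) = {1, 2, 3, 4, 5, 6, 7}"
  using exhaust_7 by auto

lemma norm_square_7:
  fixes x :: "complex ^ 7"
  shows "(norm x)\<^sup>2 = (cmod (x $ 1))\<^sup>2 + (cmod (x $ 2))\<^sup>2 + (cmod (x $ 3))\<^sup>2 + (cmod (x $ 4))\<^sup>2
    + (cmod (x $ 5))\<^sup>2 + (cmod (x $ 6))\<^sup>2 + (cmod (x $ 7))\<^sup>2"
proof -
  have "(norm x)\<^sup>2 = (\<Sum>i\<in>UNIV. (cmod (x $ i))\<^sup>2)"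
    by (simp add: norm_vec_def L2_set_def sum_nonneg)
  then show ?thesis unfolding UNIV_7 by (simp add: ac_simps)
qed

lemma parallelogram_law_complex: "(cmod (a + b))\<^sup>2 + (cmod (a - b))\<^sup>2 = 2 * (cmod a)\<^sup>2 + 2 * (cmod b)\<^sup>2"
  unfolding cmod_power2 by (simp add: power2_eq_square algebra_simps)

text \<open>By the parallelogram law the sum and the difference of \<open>y\<close> and
  \<open>\<theta>\<close> carry the same information as the pair, and likewise for
  \<open>k2 z\<close> and \<open>k3 \<phi>\<close>. The differences appear multiplied by
  \<open>d\<close>, so \<open>1 / d^2\<close> enters the second constant and grows without bound as
  \<open>k2\<close> approaches \<open>k3\<close>.\<close>

lemma chain_norm_equiv:
  fixes v u z y \<phi> \<theta> \<eta> :: complex and k2 k3 d :: real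
  assumes pos: "k2 > 0" "k3 > 0" "d \<noteq> 0"
  defines "N \<equiv> (cmod v)\<^sup>2 + (cmod u)\<^sup>2 + (cmod z)\<^sup>2 + (cmod y)\<^sup>2 + (cmod \<phi>)\<^sup>2 + (cmod \<theta>)\<^sup>2 + (cmod \<eta>)\<^sup>2"
    and "E \<equiv> (cmod \<eta>)\<^sup>2 + (cmod u)\<^sup>2 + (cmod v)\<^sup>2 + (cmod (y + \<theta>))\<^sup>2 + (cmod (of_real k2 * z + of_real k3 * \<phi>))\<^sup>2
      + (cmod (of_real d * (y - \<theta>)))\<^sup>2 + (cmod (of_real d * (of_real k2 * z - of_real k3 * \<phi>)))\<^sup>2"
  shows "E \<le> (2 * (1 + d\<^sup>2) * (1 + k2\<^sup>2 + k3\<^sup>2)) * N" "N \<le> ((1 + 1 / d\<^sup>2) * (1 + 1 / k2\<^sup>2 + 1 / k3\<^sup>2)) * E"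
proof -
  define A where "A = (cmod v)\<^sup>2 + (cmod u)\<^sup>2 + (cmod \<eta>)\<^sup>2"
  define Q R where "Q = (cmod y)\<^sup>2 + (cmod \<theta>)\<^sup>2" and "R = k2\<^sup>2 * (cmod z)\<^sup>2 + k3\<^sup>2 * (cmod \<phi>)\<^sup>2"
  define X Y where "X = (cmod (y + \<theta>))\<^sup>2" and "Y = (cmod (y - \<theta>))\<^sup>2"
  define P Z where "P = (cmod (of_real k2 * z + of_real k3 * \<phi>))\<^sup>2" and "Z = (cmod (of_real k2 * z - of_real k3 * \<phi>))\<^sup>2"
  have XY: "X + Y = 2 * Q" unfolding X_def Y_def Q_def using parallelogram_law_complex[of y \<theta>] by simp
  have PZ: "P + Z = 2 * R" unfolding P_def Z_def R_def
    using parallelogram_law_complex[of "of_real k2 * z" "of_real k3 * \<phi>"] by (simp add: norm_mult power_mult_distrib)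
  have E: "E = A + X + P + d\<^sup>2 * Y + d\<^sup>2 * Z"
    unfolding E_def A_def X_def Y_def P_def Z_def by (simp add: norm_mult power_mult_distrib)
  have N: "N = A + Q + (cmod z)\<^sup>2 + (cmod \<phi>)\<^sup>2" unfolding N_def A_def Q_def by simp
  have nn: "0 \<le> A" "0 \<le> Q" "0 \<le> R" "0 \<le> X" "0 \<le> Y" "0 \<le> P" "0 \<le> Z" "0 \<le> (cmod z)\<^sup>2" "0 \<le> (cmod \<phi>)\<^sup>2" "0 \<le> N"
    by (auto simp: A_def Q_def R_def X_def Y_def P_def Z_def N_def)
  have d2: "0 < d\<^sup>2" using pos by simp
  show "E \<le> (2 * (1 + d\<^sup>2) * (1 + k2\<^sup>2 + k3\<^sup>2)) * N"
  proof -
    have "E \<le> 2 * (1 + d\<^sup>2) * (A + Q + R)"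
    proof -
      have "2 * (1 + d\<^sup>2) * (A + Q + R) = (A + (X + Y) + (P + Z)) + (d\<^sup>2 * (X + Y) + d\<^sup>2 * (P + Z)) + A + d\<^sup>2 * (2 * A)"
        unfolding XY PZ by (simp add: algebra_simps)
      moreover have "0 \<le> d\<^sup>2 * (2 * A)" "0 \<le> d\<^sup>2 * X" "0 \<le> d\<^sup>2 * P" using nn by auto
      ultimately show ?thesis unfolding E using nn by (simp only: distrib_left)
    qed
    also have "A + Q + R \<le> (1 + k2\<^sup>2 + k3\<^sup>2) * N"
    proof -
      have "(1 + k2\<^sup>2 + k3\<^sup>2) * N = N + k2\<^sup>2 * N + k3\<^sup>2 * N" by (simp add: algebra_simps)
      moreover have "k2\<^sup>2 * (cmod z)\<^sup>2 \<le> k2\<^sup>2 * N" "k3\<^sup>2 * (cmod \<phi>)\<^sup>2 \<le> k3\<^sup>2 * N"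
        using nn unfolding N by (auto intro!: mult_left_mono)
      ultimately show ?thesis unfolding R_def using nn N by linarith
    qed
    finally show ?thesis by (simp add: mult_left_mono mult.assoc)
  qed
  show "N \<le> ((1 + 1 / d\<^sup>2) * (1 + 1 / k2\<^sup>2 + 1 / k3\<^sup>2)) * E"
  proof -
    have "N \<le> (1 + 1 / k2\<^sup>2 + 1 / k3\<^sup>2) * (A + Q + R)"
    proof -
      have "(cmod z)\<^sup>2 \<le> 1 / k2\<^sup>2 * (A + Q + R)" "(cmod \<phi>)\<^sup>2 \<le> 1 / k3\<^sup>2 * (A + Q + R)"
        using pos nn by (auto simp: R_def field_simps)
      moreover have "(1 + 1 / k2\<^sup>2 + 1 / k3\<^sup>2) * (A + Q + R) = (A + Q + R) + 1 / k2\<^sup>2 * (A + Q + R) + 1 / k3\<^sup>2 * (A + Q + R)"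
        by (simp only: distrib_right mult_1)
      ultimately show ?thesis unfolding N using nn by linarith
    qed
    also have "A + Q + R \<le> (1 + 1 / d\<^sup>2) * E"
    proof -
      have "(1 + 1 / d\<^sup>2) * E = E + (A + X + P) / d\<^sup>2 + Y + Z"
        unfolding E using d2 by (simp add: field_simps)
      moreover have "0 \<le> (A + X + P) / d\<^sup>2" "0 \<le> d\<^sup>2 * Y" "0 \<le> d\<^sup>2 * Z" using nn d2 by auto
      ultimately show ?thesis using XY PZ nn E by linarith
    qed
    finally show ?thesis using pos by (simp add: mult_left_mono mult.assoc mult.left_commute)
  qed
qed

text \<open>\<open>C\<close> and \<open>c\<close> are built from the coefficients alone, before
  \<open>\<xi>\<close> is fixed; all dependence on the frequency sits in \<open>decay_rate\<close>.
  This uniformity permits integration over \<open>\<xi>\<close> afterwards.\<close>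

lemma fourier_system_decay:
  fixes k1 k2 k3 k4 \<gamma> :: real
  assumes pos: "k1 > 0" "k2 > 0" "k3 > 0" "k4 > 0" "\<gamma> > 0" and neq: "k2 \<noteq> k3"
  obtains C c where "C > 0" "c > 0"
    "\<And>\<xi> W t. fourier_system k1 k2 k3 k4 \<gamma> \<xi> W \<Longrightarrow> t \<ge> 0 \<Longrightarrow>
       (norm (W t))\<^sup>2 \<le> C * exp (- c * decay_rate \<xi> * t) * (norm (W 0))\<^sup>2"
proof -
  \<comment> \<open>These constants close the chain: \<open>k2 y + k3 \<theta>\<close> equals
    \<open>\<alpha> w + m\<close>, and \<open>d (k2 y - k3 \<theta>)\<close> equals
    \<open>\<alpha> m + \<delta> w\<close>.\<close>
  define d where "d = (k2 - k3) / 2"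
  define \<alpha> where "\<alpha> = (k2 + k3) / 2"
  define \<delta> where "\<delta> = d\<^sup>2"
  define C2 where "C2 = 2 * (1 + d\<^sup>2) * (1 + k2\<^sup>2 + k3\<^sup>2)"
  define C1 where "C1 = (1 + 1 / d\<^sup>2) * (1 + 1 / k2\<^sup>2 + 1 / k3\<^sup>2)"
  define h1 where "h1 = min (min 1 k1) (min k2 k3)"
  define h2 where "h2 = 1 + k1 + k2 + k3"
  define a where "a = h1 / C2"
  define b where "b = h2 * C1"
  define K where "K = 8 + 4 * \<gamma> + k4 + 3 * k1 + 5 * \<alpha> + \<delta>"
  define c0 where "c0 = min (min (2 * k4) \<gamma>) (min k1 1)"
  \<comment> \<open>Small enough that the error terms take up at most half of the dissipation,
    \<open>K * \<tau> \<le> c0 / 2\<close>, and that the corrections take up at most half of the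
    energy, \<open>8 * \<tau> \<le> a / 2\<close>.\<close>
  define \<tau> where "\<tau> = min (min 1 (c0 / (2 * K))) (a / 16)"
  have \<alpha>\<delta>: "\<alpha> \<ge> 0" "\<delta> \<ge> 0" using pos by (auto simp: \<alpha>_def \<delta>_def)
  have d: "d \<noteq> 0" using neq by (simp add: d_def)
  have C: "C1 > 0" "C2 > 0" using pos by (auto simp: C1_def C2_def intro!: mult_pos_pos add_pos_nonneg)
  have h: "h1 > 0" "h2 > 0" using pos by (auto simp: h1_def h2_def)
  have ab: "a > 0" "b > 0" using C h by (auto simp: a_def b_def)
  have K: "K > 0" using pos by (simp add: K_def \<alpha>_def \<delta>_def add_pos_nonneg)
  have c0: "c0 > 0" using pos by (simp add: c0_def)
  have \<tau>: "0 < \<tau>" "\<tau> \<le> 1" "\<tau> \<le> c0 / (2 * K)" "\<tau> \<le> a / 16" using c0 K ab by (auto simp: \<tau>_def)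
  have \<tau>': "K * \<tau> \<le> c0 / 2" "8 * \<tau> \<le> a / 2" using \<tau> K by (auto simp: field_simps)
  define R where "R = (b + a / 2) / (a / 2)"
  define c where "c = c0 / 2 * \<tau> ^ 42 / (b + a / 2)"
  have R: "R > 0" using ab by (simp add: R_def)
  have c: "c > 0" using ab c0 \<tau> by (simp add: c_def)
  show ?thesis
  proof (rule that[of "C1 * R * C2" c])
    show "C1 * R * C2 > 0" using C R by simp
    show "c > 0" by fact
    fix \<xi> :: real and W :: "real \<Rightarrow> complex ^ 7" and t :: real
    assume sys: "fourier_system k1 k2 k3 k4 \<gamma> \<xi> W" and t: "t \<ge> 0"
    define v u z y \<phi> \<theta> \<eta> where "v = (\<lambda>t. W t $ 1)" and "u = (\<lambda>t. W t $ 2)" and "z = (\<lambda>t. W t $ 3)"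
      and "y = (\<lambda>t. W t $ 4)" and "\<phi> = (\<lambda>t. W t $ 5)" and "\<theta> = (\<lambda>t. W t $ 6)" and "\<eta> = (\<lambda>t. W t $ 7)"
    note comps = v_def u_def z_def y_def \<phi>_def \<theta>_def \<eta>_def
    let ?D = "\<i> * of_real \<xi>"
    have der:
      "(v has_vector_derivative ?D * u t + y t + \<theta> t) (at t within {0..})"
      "(u has_vector_derivative of_real k1 * (?D * v t) - of_real \<gamma> * (?D * \<eta> t)) (at t within {0..})"
      "(z has_vector_derivative ?D * y t) (at t within {0..})"
      "(y has_vector_derivative of_real k2 * (?D * z t) - of_real k1 * v t) (at t within {0..})"
      "(\<phi> has_vector_derivative ?D * \<theta> t) (at t within {0..})"
      "(\<theta> has_vector_derivative of_real k3 * (?D * \<phi> t) - of_real k1 * v t) (at t within {0..})"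
      "(\<eta> has_vector_derivative of_real k4 * (?D\<^sup>2 * \<eta> t) - of_real \<gamma> * (?D * u t)) (at t within {0..})"
      if "t \<ge> 0" for t
      using sys that unfolding fourier_system_def Let_def comps by blast+
    define w where "w t = y t + \<theta> t" for t
    define p where "p t = of_real k2 * z t + of_real k3 * \<phi> t" for t
    define m where "m t = of_real d * (y t - \<theta> t)" for t
    define n where "n t = of_real d * (of_real k2 * z t - of_real k3 * \<phi> t)" for t
    define E where "E t = (cmod (\<eta> t))\<^sup>2 + (cmod (u t))\<^sup>2 + (cmod (v t))\<^sup>2 + (cmod (w t))\<^sup>2 + (cmod (p t))\<^sup>2 + (cmod (m t))\<^sup>2 + (cmod (n t))\<^sup>2" for t
    \<comment> \<open>The physical energy. The weights \<open>k1\<close>, \<open>k2\<close>,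
      \<open>k3\<close> on \<open>v\<close>, \<open>z\<close>, \<open>\<phi>\<close> make all
      couplings skew-symmetric, so that only the heat conduction survives in the derivative.\<close>
    define H where "H t = Re (of_real k1 * (v t * cnj (v t))) + Re (1 * (u t * cnj (u t))) + Re (of_real k2 * (z t * cnj (z t)))
      + Re (1 * (y t * cnj (y t))) + Re (of_real k3 * (\<phi> t * cnj (\<phi> t))) + Re (1 * (\<theta> t * cnj (\<theta> t))) + Re (1 * (\<eta> t * cnj (\<eta> t)))" for t
    have N: "(norm (W t))\<^sup>2 = (cmod (v t))\<^sup>2 + (cmod (u t))\<^sup>2 + (cmod (z t))\<^sup>2 + (cmod (y t))\<^sup>2 + (cmod (\<phi> t))\<^sup>2 + (cmod (\<theta> t))\<^sup>2 + (cmod (\<eta> t))\<^sup>2" for t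
      unfolding norm_square_7 comps by simp
    have EN: "E t \<le> C2 * (norm (W t))\<^sup>2" "(norm (W t))\<^sup>2 \<le> C1 * E t" for t
      unfolding N E_def w_def p_def m_def n_def C1_def C2_def by (rule chain_norm_equiv[OF pos(2,3) d])+
    have H: "H t = k1 * (cmod (v t))\<^sup>2 + (cmod (u t))\<^sup>2 + k2 * (cmod (z t))\<^sup>2 + (cmod (y t))\<^sup>2 + k3 * (cmod (\<phi> t))\<^sup>2 + (cmod (\<theta> t))\<^sup>2 + (cmod (\<eta> t))\<^sup>2" for t
      unfolding H_def complex_mult_cnj cmod_power2 by simp
    have scale: "h1 * X \<le> k * X" "k * X \<le> h2 * X" if "X \<ge> 0" "k \<in> {1, k1, k2, k3}" for k X
      using that pos by (auto intro!: mult_right_mono simp: h1_def h2_def)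
    have HN: "h1 * (norm (W t))\<^sup>2 \<le> H t" "H t \<le> h2 * (norm (W t))\<^sup>2" for t
      unfolding N H distrib_left
      using scale[of "(cmod (v t))\<^sup>2" k1] scale[of "(cmod (u t))\<^sup>2" 1] scale[of "(cmod (z t))\<^sup>2" k2] scale[of "(cmod (y t))\<^sup>2" 1]
        scale[of "(cmod (\<phi> t))\<^sup>2" k3] scale[of "(cmod (\<theta> t))\<^sup>2" 1] scale[of "(cmod (\<eta> t))\<^sup>2" 1]
      by simp_all
    have HE: "a * E t \<le> H t" "H t \<le> b * E t" for t
    proof -
      have "a * E t \<le> a * (C2 * (norm (W t))\<^sup>2)" using EN(1) ab by (intro mult_left_mono) auto
      also have "\<dots> = h1 * (norm (W t))\<^sup>2" using C by (simp add: a_def)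
      finally show "a * E t \<le> H t" using HN(1)[of t] by simp
      have "h2 * (norm (W t))\<^sup>2 \<le> h2 * (C1 * E t)" using EN(2) h by (intro mult_left_mono) auto
      then show "H t \<le> b * E t" using HN(2)[of t] by (simp add: b_def mult.assoc)
    qed
    have Hder: "(H has_real_derivative - 2 * k4 * \<bar>\<xi>\<bar>\<^sup>2 * (cmod (\<eta> t))\<^sup>2) (at t within {0..})" if "t \<ge> 0" for t
    proof -
      have "(H has_real_derivative
          Re (of_real k1 * ((?D * u t + y t + \<theta> t) * cnj (v t) + v t * cnj (?D * u t + y t + \<theta> t)))
        + Re (1 * ((of_real k1 * (?D * v t) - of_real \<gamma> * (?D * \<eta> t)) * cnj (u t) + u t * cnj (of_real k1 * (?D * v t) - of_real \<gamma> * (?D * \<eta> t))))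
        + Re (of_real k2 * ((?D * y t) * cnj (z t) + z t * cnj (?D * y t)))
        + Re (1 * ((of_real k2 * (?D * z t) - of_real k1 * v t) * cnj (y t) + y t * cnj (of_real k2 * (?D * z t) - of_real k1 * v t)))
        + Re (of_real k3 * ((?D * \<theta> t) * cnj (\<phi> t) + \<phi> t * cnj (?D * \<theta> t)))
        + Re (1 * ((of_real k3 * (?D * \<phi> t) - of_real k1 * v t) * cnj (\<theta> t) + \<theta> t * cnj (of_real k3 * (?D * \<phi> t) - of_real k1 * v t)))
        + Re (1 * ((of_real k4 * (?D\<^sup>2 * \<eta> t) - of_real \<gamma> * (?D * u t)) * cnj (\<eta> t) + \<eta> t * cnj (of_real k4 * (?D\<^sup>2 * \<eta> t) - of_real \<gamma> * (?D * u t)))))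
        (at t within {0..})"
        unfolding H_def[abs_def] by (intro DERIV_add has_derivative_Re_cnj der that)
      then show ?thesis
        by (rule DERIV_cong) (unfold cmod_power2, simp add: power2_eq_square algebra_simps)
    qed
    have "E t \<le> R * exp (- c * decay_rate \<xi> * t) * E 0"
      unfolding E_def R_def c_def c0_def
    proof (rule chain_decay[where \<alpha> = \<alpha> and \<delta> = \<delta> and H = H])
      fix t :: real assume t: "t \<ge> 0"
      note der = der[OF t]
      show "(w has_vector_derivative ?D * p t - 2 * of_real k1 * v t) (at t within {0..})"
        unfolding w_def[abs_def] p_def
        by (rule has_vector_derivative_eq_rhs, rule has_vector_derivative_add[OF der(4,6)]) (simp add: algebra_simps)
      show "(p has_vector_derivative ?D * (m t + of_real \<alpha> * w t)) (at t within {0..})"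
        unfolding p_def[abs_def] m_def w_def
        by (rule has_vector_derivative_eq_rhs, rule has_vector_derivative_add[OF has_vector_derivative_mult_right[OF der(3)] has_vector_derivative_mult_right[OF der(5)]])
           (simp add: d_def \<alpha>_def field_simps)
      show "(m has_vector_derivative ?D * n t) (at t within {0..})"
        unfolding m_def[abs_def] n_def
        by (rule has_vector_derivative_eq_rhs, rule has_vector_derivative_mult_right[OF has_vector_derivative_diff[OF der(4,6)]])
           (simp add: algebra_simps)
      show "(n has_vector_derivative ?D * (of_real \<alpha> * m t + of_real \<delta> * w t)) (at t within {0..})"
        unfolding n_def[abs_def] m_def w_def
        by (rule has_vector_derivative_eq_rhs, rule has_vector_derivative_mult_right[OF has_vector_derivative_diff[OF has_vector_derivative_mult_right[OF der(3)] has_vector_derivative_mult_right[OF der(5)]]])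
           (simp add: d_def \<alpha>_def \<delta>_def field_simps power2_eq_square)
      show "(v has_vector_derivative ?D * u t + w t) (at t within {0..})"
        using der(1) by (simp add: w_def add.assoc)
      show "(H has_real_derivative - 2 * k4 * \<bar>\<xi>\<bar>\<^sup>2 * (cmod (\<eta> t))\<^sup>2) (at t within {0..})" by (rule Hder[OF t])
    qed (use pos t ab \<tau> \<tau>' HE der \<alpha>\<delta> in \<open>auto simp: E_def[symmetric] K_def[symmetric] c0_def[symmetric]\<close>)
    then have "C1 * E t \<le> C1 * (R * exp (- c * decay_rate \<xi> * t) * E 0)" using C by (intro mult_left_mono) auto
    also have "\<dots> \<le> C1 * (R * exp (- c * decay_rate \<xi> * t) * (C2 * (norm (W 0))\<^sup>2))"
      using C R EN(1)[of 0] by (intro mult_left_mono) auto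
    finally show "(norm (W t))\<^sup>2 \<le> C1 * R * C2 * exp (- c * decay_rate \<xi> * t) * (norm (W 0))\<^sup>2"
      using EN(2)[of t] by (simp add: mult_ac)
  qed
qed

section \<open>Decay estimates\<close>


text \<open>\<open>1 + \<xi>^2\<close> is at most 2 for small and at most \<open>2 \<xi>^2\<close>
  for large frequencies; 16 is the fourth power of this 2.\<close>

lemma rate_ge:
  fixes \<xi> :: real
  shows "\<bar>\<xi>\<bar> \<le> 1 \<Longrightarrow> \<xi> ^ 6 / 16 \<le> \<xi> ^ 6 / (1 + \<xi>\<^sup>2) ^ 4"
    and "\<bar>\<xi>\<bar> \<ge> 1 \<Longrightarrow> 1 / (16 * \<xi>\<^sup>2) \<le> \<xi> ^ 6 / (1 + \<xi>\<^sup>2) ^ 4"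
proof -
  have pos: "0 < (1 + \<xi>\<^sup>2) ^ 4" by (intro zero_less_power add_pos_nonneg) auto
  show "\<xi> ^ 6 / 16 \<le> \<xi> ^ 6 / (1 + \<xi>\<^sup>2) ^ 4" if "\<bar>\<xi>\<bar> \<le> 1"
  proof (rule divide_left_mono)
    have "\<xi>\<^sup>2 \<le> 1" using that by (simp add: abs_square_le_1)
    then have "(1 + \<xi>\<^sup>2) ^ 4 \<le> 2 ^ 4" by (intro power_mono) auto
    then show "(1 + \<xi>\<^sup>2) ^ 4 \<le> 16" by simp
  qed (use pos in auto)
  show "1 / (16 * \<xi>\<^sup>2) \<le> \<xi> ^ 6 / (1 + \<xi>\<^sup>2) ^ 4" if "\<bar>\<xi>\<bar> \<ge> 1"
  proof -
    have sq: "1 \<le> \<xi>\<^sup>2" using that by (simp add: abs_le_square_iff[of 1, simplified])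
    then have "(1 + \<xi>\<^sup>2) ^ 4 \<le> (2 * \<xi>\<^sup>2) ^ 4" by (intro power_mono) auto
    also have "\<dots> = 16 * \<xi>\<^sup>2 * \<xi> ^ 6" by algebra
    finally have "1 * (1 + \<xi>\<^sup>2) ^ 4 \<le> \<xi> ^ 6 * (16 * \<xi>\<^sup>2)" by (simp add: mult_ac)
    moreover have "0 < 16 * \<xi>\<^sup>2" using sq by linarith
    ultimately show ?thesis using pos by (simp only: frac_le_eq divide_le_eq pos_le_divide_eq times_divide_eq_left mult_1)
        (simp add: divide_le_eq mult_ac)
  qed
qed

text \<open>Comparison with the moments of a Gaussian: the sixth power dominates the square up to an
  additive constant in the exponent.\<close>

lemma integrable_moment_exp_neg_sixth:
  fixes c :: real
  assumes c: "c > 0"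
  shows "integrable lborel (\<lambda>y. y ^ k * exp (- c * y ^ 6))"
proof (rule Bochner_Integration.integrable_bound)
  \<comment> \<open>With \<open>z = y^2\<close>, the difference \<open>z / 2 - c z^3\<close> is at
    most \<open>q / 2\<close> for \<open>z \<le> q\<close> by dropping the cubic term. For
    \<open>z > q\<close> it is not positive, because then
    \<open>z^2 \<ge> q \<ge> 1 / (2 c)\<close>.\<close>
  define q where "q = 1 + 1 / (2 * c)"
  show "integrable lborel (\<lambda>y. (exp (q / 2) * sqrt (2 * pi)) * (std_normal_density y * y ^ k))"
    using integrable_std_normal_moment by simp
  have q: "1 \<le> q" "1 / (2 * c) \<le> q" using c by (auto simp: q_def)
  have le: "z / 2 - c * z ^ 3 \<le> q / 2" if z: "z \<ge> 0" for z :: real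
  proof (cases "z \<le> q")
    case True
    moreover have "0 \<le> c * z ^ 3" using c z by simp
    ultimately show ?thesis by linarith
  next
    case False
    then have "q * 1 \<le> z * z" using q by (intro mult_mono) auto
    then have "1 / (2 * c) \<le> z * z" using q by linarith
    then have "c * (1 / (2 * c)) \<le> c * (z * z)" using c by (intro mult_left_mono) auto
    then have "1 / 2 \<le> c * (z * z)" using c by simp
    then have "1 / 2 * z \<le> c * (z * z) * z" using z by (rule mult_right_mono)
    then have "z / 2 \<le> c * z ^ 3" by (simp add: power3_eq_cube mult.assoc)
    then show ?thesis using q by simp
  qed
  have "exp (- c * y ^ 6) \<le> exp (q / 2) * sqrt (2 * pi) * std_normal_density y" for y
  proof -
    have "y ^ 6 = (y\<^sup>2) ^ 3" by algebra
    then have "- c * y ^ 6 \<le> q / 2 + - y\<^sup>2 / 2" using le[of "y\<^sup>2"] by simp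
    then have "exp (- c * y ^ 6) \<le> exp (q / 2 + - y\<^sup>2 / 2)" by simp
    also have "\<dots> = exp (q / 2) * exp (- y\<^sup>2 / 2)" by (rule exp_add)
    also have "exp (- y\<^sup>2 / 2) = sqrt (2 * pi) * std_normal_density y"
      by (simp add: std_normal_density_def)
    finally show ?thesis by (simp add: mult.assoc)
  qed
  then have "\<bar>y ^ k\<bar> * exp (- c * y ^ 6) \<le> \<bar>y ^ k\<bar> * (exp (q / 2) * sqrt (2 * pi) * std_normal_density y)" for y
    by (intro mult_left_mono) auto
  then show "AE y in lborel. norm (y ^ k * exp (- c * y ^ 6)) \<le> norm ((exp (q / 2) * sqrt (2 * pi)) * (std_normal_density y * y ^ k))"
    by (intro AE_I2) (simp add: abs_mult mult_ac)
qed auto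

text \<open>On \<open>[-1, 1]\<close> the factor \<open>exp c\<close> pays for replacing
  \<open>t\<close> by \<open>1 + t\<close>, which keeps the bound finite at \<open>t = 0\<close>.
  The substitution of \<open>(1 + t)^(1/6) \<xi>\<close> then extracts \<open>2 j\<close> powers
  from the moment and one from the measure, giving the exponent
  \<open>(1 + 2 j) / 6\<close>.\<close>

lemma low_frequency_integral:
  fixes c :: real
  assumes c: "c > 0"
  obtains A where "A > 0"
    "\<And>t. t \<ge> 0 \<Longrightarrow> (\<integral>\<^sup>+\<xi>. ennreal (indicator {-1..1} \<xi> * (\<xi> ^ (2 * j) * exp (- c * \<xi> ^ 6 * t))) \<partial>lborel)
      \<le> ennreal (A * (1 + t) powr (- (1 + 2 * real j) / 6))"
proof -
  define g where "g y = y ^ (2 * j) * exp (- c * y ^ 6)" for y :: real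
  define I where "I = (LBINT y. g y)"
  have g: "integrable lborel g" unfolding g_def by (rule integrable_moment_exp_neg_sixth[OF c])
  have I: "I \<ge> 0" unfolding I_def g_def by (intro Bochner_Integration.integral_nonneg) simp
  show ?thesis
  proof (rule that[of "exp c * I + 1"])
    show "exp c * I + 1 > 0" using I by (simp add: add_nonneg_pos)
    fix t :: real assume t: "t \<ge> 0"
    define s where "s = (1 + t) powr (1 / 6)"
    have s: "s > 0" using t by (simp add: s_def)
    have s6: "s ^ 6 = 1 + t" using t by (simp add: s_def powr_power)
    have spow: "1 / s ^ (2 * j + 1) = (1 + t) powr (- (1 + 2 * real j) / 6)"
    proof -
      have "s ^ (2 * j + 1) = (1 + t) powr ((1 + 2 * real j) / 6)"
        using t unfolding s_def by (subst powr_power) (auto simp: add.commute mult.commute)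
      moreover have "- (1 + 2 * real j) / 6 = - ((1 + 2 * real j) / 6)" by (rule minus_divide_left[symmetric])
      ultimately show ?thesis by (simp only: powr_minus_divide)
    qed
    have eq: "g (0 + s * \<xi>) = s ^ (2 * j) * (\<xi> ^ (2 * j) * exp (- c * (1 + t) * \<xi> ^ 6))" for \<xi>
      by (simp add: g_def power_mult_distrib s6 mult_ac)
    have J: "integrable lborel (\<lambda>\<xi>. \<xi> ^ (2 * j) * exp (- c * (1 + t) * \<xi> ^ 6))"
      using integrable_moment_exp_neg_sixth[of "c * (1 + t)" "2 * j"] c t by simp
    have "I = \<bar>s\<bar> *\<^sub>R (LBINT \<xi>. g (0 + s * \<xi>))"
      unfolding I_def by (rule lborel_integral_real_affine) (use s in auto)
    also have "\<dots> = s ^ (2 * j + 1) * (LBINT \<xi>. \<xi> ^ (2 * j) * exp (- c * (1 + t) * \<xi> ^ 6))"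
      unfolding eq using s by simp
    finally have J_eq: "(LBINT \<xi>. \<xi> ^ (2 * j) * exp (- c * (1 + t) * \<xi> ^ 6)) = I * (1 + t) powr (- (1 + 2 * real j) / 6)"
      unfolding spow[symmetric] using s by simp
    have "(\<integral>\<^sup>+\<xi>. ennreal (indicator {-1..1} \<xi> * (\<xi> ^ (2 * j) * exp (- c * \<xi> ^ 6 * t))) \<partial>lborel)
      \<le> (\<integral>\<^sup>+\<xi>. ennreal (exp c * (\<xi> ^ (2 * j) * exp (- c * (1 + t) * \<xi> ^ 6))) \<partial>lborel)"
    proof (intro nn_integral_mono ennreal_leI)
      fix \<xi> :: real
      have nn: "0 \<le> \<xi> ^ (2 * j)" by simp
      show "indicator {-1..1} \<xi> * (\<xi> ^ (2 * j) * exp (- c * \<xi> ^ 6 * t)) \<le> exp c * (\<xi> ^ (2 * j) * exp (- c * (1 + t) * \<xi> ^ 6))"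
      proof (cases "\<xi> \<in> {-1..1}")
        case True
        then have "\<bar>\<xi>\<bar> ^ 6 \<le> 1" by (intro power_le_one) auto
        then have "c * \<xi> ^ 6 \<le> c * 1" using c by (intro mult_left_mono) (auto simp: power_even_abs)
        then have "- c * \<xi> ^ 6 * t \<le> c + - c * (1 + t) * \<xi> ^ 6" by (simp add: algebra_simps)
        then have "exp (- c * \<xi> ^ 6 * t) \<le> exp c * exp (- c * (1 + t) * \<xi> ^ 6)" by (simp flip: exp_add)
        then have "\<xi> ^ (2 * j) * exp (- c * \<xi> ^ 6 * t) \<le> \<xi> ^ (2 * j) * (exp c * exp (- c * (1 + t) * \<xi> ^ 6))"
          by (rule mult_left_mono[OF _ nn])
        then show ?thesis using True by (simp add: mult_ac)
      qed (use nn in simp)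
    qed
    also have "\<dots> = ennreal (LBINT \<xi>. exp c * (\<xi> ^ (2 * j) * exp (- c * (1 + t) * \<xi> ^ 6)))"
      by (rule nn_integral_eq_integral) (use J in auto)
    also have "(LBINT \<xi>. exp c * (\<xi> ^ (2 * j) * exp (- c * (1 + t) * \<xi> ^ 6))) = exp c * (I * (1 + t) powr (- (1 + 2 * real j) / 6))"
      unfolding J_eq[symmetric] by (rule integral_mult_right_zero)
    also have "ennreal \<dots> \<le> ennreal ((exp c * I + 1) * (1 + t) powr (- (1 + 2 * real j) / 6))"
      by (intro ennreal_leI) (simp add: distrib_right)
    finally show "(\<integral>\<^sup>+\<xi>. ennreal (indicator {-1..1} \<xi> * (\<xi> ^ (2 * j) * exp (- c * \<xi> ^ 6 * t))) \<partial>lborel)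
      \<le> ennreal ((exp c * I + 1) * (1 + t) powr (- (1 + 2 * real j) / 6))" .
  qed
qed

text \<open>\<open>z^l exp (- z)\<close> is bounded, being the value of
  \<open>flat_fn (monom 1 l)\<close> at \<open>1 / z\<close>; here
  \<open>z = c (1 + t) / \<xi>^2\<close>. Every power of \<open>1 / (1 + t)\<close> is thus paid for
  with a factor \<open>\<xi>^2\<close>, that is with one derivative in the squared norm. The factor
  \<open>exp c\<close> again accounts for \<open>1 + t\<close> in place of \<open>t\<close>.\<close>

lemma high_frequency_bound:
  fixes c :: real
  assumes c: "c > 0"
  obtains A where "A > 0"
    "\<And>\<xi> t. \<bar>\<xi>\<bar> \<ge> 1 \<Longrightarrow> t \<ge> 0 \<Longrightarrow> exp (- c * (1 / \<xi>\<^sup>2) * t) \<le> A * (1 + t) powr (- real l) * (\<bar>\<xi>\<bar> ^ l)\<^sup>2"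
proof -
  obtain B where B: "\<And>x. \<bar>flat_fn (monom 1 l) x\<bar> \<le> B" using flat_bounded[of "monom 1 l"] by blast
  have B0: "B \<ge> 0" using B[of 0] by linarith
  show ?thesis
  proof (rule that[of "exp c * (B + 1) / c ^ l"])
    show "exp c * (B + 1) / c ^ l > 0" using c B0 by simp
    fix \<xi> t :: real assume \<xi>: "\<bar>\<xi>\<bar> \<ge> 1" and t: "t \<ge> 0"
    define y where "y = 1 / \<xi>\<^sup>2"
    have sq: "1 \<le> \<xi>\<^sup>2" using \<xi> by (simp add: abs_le_square_iff[of 1, simplified])
    have y: "0 < y" "y \<le> 1" using sq by (auto simp: y_def divide_simps)
    define z where "z = c * y * (1 + t)"
    have z: "0 < z" using c y t by (simp add: z_def)
    have "\<bar>flat_fn (monom 1 l) (1 / z)\<bar> = z ^ l * exp (- z)"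
      using z by (simp add: flat_fn_def poly_monom abs_mult)
    then have "z ^ l * exp (- z) \<le> B + 1" using B[of "1 / z"] by simp
    then have ez: "exp (- z) \<le> (B + 1) / z ^ l" using z by (simp add: pos_le_divide_eq mult.commute)
    have "- c * y * t = c * y + - z" by (simp add: z_def algebra_simps)
    also have "\<dots> \<le> c + - z" using c y by (simp add: mult_left_le)
    finally have "exp (- c * y * t) \<le> exp c * exp (- z)" by (simp flip: exp_add)
    also have "\<dots> \<le> exp c * ((B + 1) / z ^ l)" by (rule mult_left_mono[OF ez]) simp
    also have "\<dots> = exp c * (B + 1) / c ^ l * (1 / (1 + t) ^ l) * (1 / y ^ l)"
      by (simp add: z_def power_mult_distrib)
    also have "1 / (1 + t) ^ l = (1 + t) powr (- real l)"
      using t by (simp add: powr_minus_divide powr_realpow)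
    also have "1 / y ^ l = (\<bar>\<xi>\<bar> ^ l)\<^sup>2"
      by (simp add: y_def power_divide power_mult[symmetric] mult.commute power_even_abs)
    finally show "exp (- c * (1 / \<xi>\<^sup>2) * t) \<le> exp c * (B + 1) / c ^ l * (1 + t) powr (- real l) * (\<bar>\<xi>\<bar> ^ l)\<^sup>2"
      unfolding y_def .
  qed
qed

text \<open>The line is split at \<open>|\<xi>| = 1\<close>. For low frequencies the data are
  bounded by their supremum \<open>M\<close> and the weight is integrated; for high ones the weight
  is bounded pointwise and the moment \<open>G\<close> of order \<open>j + l\<close> absorbs the
  growth. \<open>A\<close> depends on \<open>C\<close>, \<open>c\<close>, \<open>j\<close> and
  \<open>l\<close> only.\<close>

lemma weighted_L2_decay:
  fixes C c :: real and j l :: nat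
  assumes C: "C > 0" and c: "c > 0"
  obtains A where "A > 0"
    "\<And>(W :: real \<Rightarrow> complex ^ 'n) (W0 :: real \<Rightarrow> complex ^ 'n) M G t. W0 \<in> borel_measurable borel \<Longrightarrow> (\<And>\<xi>. norm (W0 \<xi>) \<le> M) \<Longrightarrow> t \<ge> 0 \<Longrightarrow> G \<ge> 0 \<Longrightarrow>
      (\<And>\<xi>. (norm (W \<xi>))\<^sup>2 \<le> C * exp (- c * decay_rate \<xi> * t) * (norm (W0 \<xi>))\<^sup>2) \<Longrightarrow>
      (nn_moment (j + l) W0) \<le> ennreal G \<Longrightarrow>
      (nn_moment j W)
        \<le> ennreal (A * ((1 + t) powr (- (1 + 2 * real j) / 6) * M\<^sup>2 + (1 + t) powr (- real l) * G))"
proof -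
  have c16: "c / 16 > 0" using c by simp
  obtain A1 where A1: "A1 > 0"
    and low: "\<And>t. t \<ge> 0 \<Longrightarrow> (\<integral>\<^sup>+\<xi>. ennreal (indicator {-1..1} \<xi> * (\<xi> ^ (2 * j) * exp (- (c / 16) * \<xi> ^ 6 * t))) \<partial>lborel)
      \<le> ennreal (A1 * (1 + t) powr (- (1 + 2 * real j) / 6))"
    by (rule low_frequency_integral[OF c16]) blast
  obtain A2 where A2: "A2 > 0"
    and high: "\<And>\<xi> t. \<bar>\<xi>\<bar> \<ge> 1 \<Longrightarrow> t \<ge> 0 \<Longrightarrow> exp (- (c / 16) * (1 / \<xi>\<^sup>2) * t) \<le> A2 * (1 + t) powr (- real l) * (\<bar>\<xi>\<bar> ^ l)\<^sup>2"
    by (rule high_frequency_bound[OF c16]) blast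
  show ?thesis
  proof (rule that[of "C * (A1 + A2)"])
    show "C * (A1 + A2) > 0" using C A1 A2 by simp
    fix W W0 :: "real \<Rightarrow> complex ^ 'n" and M G t :: real
    assume [measurable]: "W0 \<in> borel_measurable borel" and M: "\<And>\<xi>. norm (W0 \<xi>) \<le> M" and t: "t \<ge> 0" and G: "G \<ge> 0"
      and W: "\<And>\<xi>. (norm (W \<xi>))\<^sup>2 \<le> C * exp (- c * decay_rate \<xi> * t) * (norm (W0 \<xi>))\<^sup>2"
      and W0: "(nn_moment (j + l) W0) \<le> ennreal G"
    define T where "T = (1 + t) powr (- real l)"
    have T: "T \<ge> 0" by (simp add: T_def)
    define lo where "lo \<xi> = indicator {-1..1} \<xi> * (\<xi> ^ (2 * j) * exp (- (c / 16) * \<xi> ^ 6 * t))" for \<xi> :: real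
    define hi where "hi \<xi> = (\<bar>\<xi>\<bar> ^ (j + l) * norm (W0 \<xi>))\<^sup>2" for \<xi>
    have lo0: "lo \<xi> \<ge> 0" for \<xi> by (simp add: lo_def)
    have hi0: "hi \<xi> \<ge> 0" for \<xi> by (simp add: hi_def)
    have point: "(\<bar>\<xi>\<bar> ^ j * norm (W \<xi>))\<^sup>2 \<le> (C * M\<^sup>2) * lo \<xi> + (C * A2 * T) * hi \<xi>" for \<xi>
    proof -
      have "(\<bar>\<xi>\<bar> ^ j * norm (W \<xi>))\<^sup>2 = (\<bar>\<xi>\<bar> ^ j)\<^sup>2 * (norm (W \<xi>))\<^sup>2" by (rule power_mult_distrib)
      also have "\<dots> \<le> (\<bar>\<xi>\<bar> ^ j)\<^sup>2 * (C * exp (- c * decay_rate \<xi> * t) * (norm (W0 \<xi>))\<^sup>2)"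
        by (rule mult_left_mono[OF W]) simp
      finally have 1: "(\<bar>\<xi>\<bar> ^ j * norm (W \<xi>))\<^sup>2 \<le> \<dots>" .
      show ?thesis
      proof (cases "\<bar>\<xi>\<bar> \<le> 1")
        case True
        have "c * (\<xi> ^ 6 / 16) * t \<le> c * decay_rate \<xi> * t"
          using rate_ge(1)[OF True] c t by (intro mult_right_mono mult_left_mono) auto
        then have e: "exp (- c * decay_rate \<xi> * t) \<le> exp (- (c / 16) * \<xi> ^ 6 * t)" by simp
        have "(norm (W0 \<xi>))\<^sup>2 \<le> M\<^sup>2" by (rule power_mono[OF M]) simp
        then have "(\<bar>\<xi>\<bar> ^ j)\<^sup>2 * (C * exp (- c * decay_rate \<xi> * t) * (norm (W0 \<xi>))\<^sup>2)
          \<le> (\<bar>\<xi>\<bar> ^ j)\<^sup>2 * (C * exp (- (c / 16) * \<xi> ^ 6 * t) * M\<^sup>2)"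
          using e C by (intro mult_left_mono mult_mono) auto
        also have "\<dots> = (C * M\<^sup>2) * lo \<xi>"
        proof -
          have "(\<bar>\<xi>\<bar> ^ j)\<^sup>2 = \<xi> ^ (2 * j)" by (simp add: power_mult[symmetric] mult.commute power_even_abs)
          moreover have "lo \<xi> = \<xi> ^ (2 * j) * exp (- (c / 16) * \<xi> ^ 6 * t)"
            using True by (simp add: lo_def abs_le_iff)
          ultimately show ?thesis by (simp only: mult_ac)
        qed
        finally have "(\<bar>\<xi>\<bar> ^ j * norm (W \<xi>))\<^sup>2 \<le> (C * M\<^sup>2) * lo \<xi>" using 1 by linarith
        moreover have "0 \<le> (C * A2 * T) * hi \<xi>" using C A2 T hi0 by simp
        ultimately show ?thesis by linarith
      next
        case False
        then have \<xi>: "\<bar>\<xi>\<bar> \<ge> 1" by simp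
        have "c * (1 / (16 * \<xi>\<^sup>2)) * t \<le> c * decay_rate \<xi> * t"
          using rate_ge(2)[OF \<xi>] c t by (intro mult_right_mono mult_left_mono) auto
        then have "exp (- c * decay_rate \<xi> * t) \<le> exp (- (c / 16) * (1 / \<xi>\<^sup>2) * t)" by simp
        also have "\<dots> \<le> A2 * T * (\<bar>\<xi>\<bar> ^ l)\<^sup>2" unfolding T_def by (rule high[OF \<xi> t])
        finally have "(\<bar>\<xi>\<bar> ^ j)\<^sup>2 * (C * exp (- c * decay_rate \<xi> * t) * (norm (W0 \<xi>))\<^sup>2)
          \<le> (\<bar>\<xi>\<bar> ^ j)\<^sup>2 * (C * (A2 * T * (\<bar>\<xi>\<bar> ^ l)\<^sup>2) * (norm (W0 \<xi>))\<^sup>2)"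
          using C by (intro mult_left_mono mult_right_mono) auto
        also have "\<dots> = (C * A2 * T) * hi \<xi>" by (simp add: hi_def power_add power_mult_distrib mult_ac)
        finally have "(\<bar>\<xi>\<bar> ^ j * norm (W \<xi>))\<^sup>2 \<le> (C * A2 * T) * hi \<xi>" using 1 by linarith
        moreover have "0 \<le> (C * M\<^sup>2) * lo \<xi>" using C lo0 by simp
        ultimately show ?thesis by linarith
      qed
    qed
    have "(nn_moment j W)
      \<le> (\<integral>\<^sup>+\<xi>. ennreal (C * M\<^sup>2) * ennreal (lo \<xi>) + ennreal (C * A2 * T) * ennreal (hi \<xi>) \<partial>lborel)"
    proof (rule nn_integral_mono)
      fix \<xi>
      show "ennreal ((\<bar>\<xi>\<bar> ^ j * norm (W \<xi>))\<^sup>2) \<le> ennreal (C * M\<^sup>2) * ennreal (lo \<xi>) + ennreal (C * A2 * T) * ennreal (hi \<xi>)"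
        using ennreal_leI[OF point[of \<xi>]] C A2 T lo0 hi0 by (simp add: ennreal_plus ennreal_mult)
    qed
    also have "\<dots> = ennreal (C * M\<^sup>2) * (\<integral>\<^sup>+\<xi>. ennreal (lo \<xi>) \<partial>lborel) + ennreal (C * A2 * T) * (\<integral>\<^sup>+\<xi>. ennreal (hi \<xi>) \<partial>lborel)"
    proof -
      have [measurable]: "lo \<in> borel_measurable borel" "hi \<in> borel_measurable borel"
        unfolding lo_def[abs_def] hi_def[abs_def] by measurable
      show ?thesis by (simp add: nn_integral_add nn_integral_cmult)
    qed
    also have "\<dots> \<le> ennreal (C * M\<^sup>2) * ennreal (A1 * (1 + t) powr (- (1 + 2 * real j) / 6)) + ennreal (C * A2 * T) * ennreal G"
      using low[OF t] W0 unfolding lo_def hi_def by (intro add_mono mult_left_mono) auto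
    also have "\<dots> = ennreal (C * M\<^sup>2 * (A1 * (1 + t) powr (- (1 + 2 * real j) / 6)) + C * A2 * T * G)"
      using C A1 A2 T G by (simp add: ennreal_plus ennreal_mult)
    also have "\<dots> \<le> ennreal (C * (A1 + A2) * ((1 + t) powr (- (1 + 2 * real j) / 6) * M\<^sup>2 + T * G))"
    proof (rule ennreal_leI)
      define X where "X = (1 + t) powr (- (1 + 2 * real j) / 6) * M\<^sup>2"
      have "0 \<le> C * A2 * X" "0 \<le> C * A1 * (T * G)" using C A1 A2 T G by (auto simp: X_def)
      moreover have "C * (A1 + A2) * (X + T * G) = C * A1 * X + C * A2 * X + C * A1 * (T * G) + C * A2 * (T * G)"
        by (simp add: algebra_simps)
      moreover have "C * M\<^sup>2 * (A1 * (1 + t) powr (- (1 + 2 * real j) / 6)) = C * A1 * X" by (simp add: X_def)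
      ultimately show "C * M\<^sup>2 * (A1 * (1 + t) powr (- (1 + 2 * real j) / 6)) + C * A2 * T * G
        \<le> C * (A1 + A2) * ((1 + t) powr (- (1 + 2 * real j) / 6) * M\<^sup>2 + T * G)"
        unfolding X_def[symmetric] mult.assoc[of "C * A2" T G] by linarith
    qed
    finally show "(nn_moment j W)
        \<le> ennreal (C * (A1 + A2) * ((1 + t) powr (- (1 + 2 * real j) / 6) * M\<^sup>2 + (1 + t) powr (- real l) * G))"
      unfolding T_def .
  qed
qed


text \<open>The moment bound \<open>Q\<close> is used with \<open>G\<close> equal to
  \<open>2 * pi\<close> times the squared norm of the derivative of the data. That
  \<open>2 * pi\<close> cancels against the one in the bound for the derivative of \<open>u\<close>,
  while in the \<open>L1\<close> term a factor \<open>2 * pi \<ge> 1\<close> is given away. Taking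
  the root of \<open>A\<close> times a sum of squares, which is at most \<open>A\<close> times the
  square of the sum, halves the exponents and gives the constant \<open>sqrt A\<close>.\<close>

lemma weak_deriv_decay:
  fixes A :: real and j l N :: nat and U0 :: "real \<Rightarrow> complex ^ 'n"
  assumes F: "has_fourier_L2 u W" and A: "A > 0" and jl: "j + l \<le> N" and t: "t \<ge> 0"
    and U0: "U0 \<in> sobolev N"
    and Q: "\<And>G. G \<ge> 0 \<Longrightarrow> (nn_moment (j + l) (fourier U0)) \<le> ennreal G \<Longrightarrow>
      (nn_moment j W)
        \<le> ennreal (A * ((1 + t) powr (- (1 + 2 * real j) / 6) * (L1norm U0)\<^sup>2 + (1 + t) powr (- real l) * G))"
    and U0': "U0 \<in> L1"
  shows "u \<in> sobolev j \<and> L2norm (weak_deriv j u)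
    \<le> sqrt A * (1 + t) powr (- 1 / 12 - real j / 6) * L1norm U0
      + sqrt A * (1 + t) powr (- real l / 2) * L2norm (weak_deriv (j + l) U0)"
proof -
  obtain g where g: "g \<in> L2" "has_weak_deriv (j + l) U0 g"
    using U0 jl by (auto simp: sobolev_def)
  define G where "G = L2norm (weak_deriv (j + l) U0)"
  have G_eq: "L2norm g = G" unfolding G_def by (rule L2norm_weak_deriv[OF g(2,1), symmetric])
  have G0: "G \<ge> 0" by (simp add: G_def L2norm_def)
  have M0: "L1norm U0 \<ge> 0" by (simp add: L1norm_def)
  define R where "R = A * ((1 + t) powr (- (1 + 2 * real j) / 6) * (L1norm U0)\<^sup>2 + (1 + t) powr (- real l) * (2 * pi * G\<^sup>2))"
  have R0: "R \<ge> 0" using A by (simp add: R_def)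
  have U0i: "integrable lborel U0" using U0' by (simp add: L1_def)
  have R: "(nn_moment j W) \<le> ennreal R"
    unfolding R_def using fourier_weak_deriv_le[OF U0i g] by (intro Q) (simp_all add: G_eq)
  have u: "u \<in> L2" and W: "W \<in> L2" using F by (auto simp: has_fourier_L2_def)
  have [measurable]: "W \<in> borel_measurable borel" and W2: "square_integrable W"
    using W by (auto simp: L2_def)
  \<comment> \<open>Membership in \<open>sobolev j\<close> needs all lower derivatives too:
    \<open>|\<xi>|^n\<close> is at most the larger of 1 and \<open>|\<xi>|^j\<close>, so their
    moments are controlled by those of orders 0 and \<open>j\<close>.\<close>
  have "\<exists>h\<in>L2. has_weak_deriv n u h" if n: "n \<le> j" for n
  proof -
    have le: "(\<bar>\<xi>\<bar> ^ n * norm (W \<xi>))\<^sup>2 \<le> (norm (W \<xi>))\<^sup>2 + (\<bar>\<xi>\<bar> ^ j * norm (W \<xi>))\<^sup>2" for \<xi>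
    proof (cases "\<bar>\<xi>\<bar> \<le> 1")
      case True
      then have "\<bar>\<xi>\<bar> ^ n * norm (W \<xi>) \<le> 1 * norm (W \<xi>)" by (intro mult_right_mono power_le_one) auto
      then have "(\<bar>\<xi>\<bar> ^ n * norm (W \<xi>))\<^sup>2 \<le> (norm (W \<xi>))\<^sup>2" by (intro power_mono) auto
      then show ?thesis using zero_le_power2[of "\<bar>\<xi>\<bar> ^ j * norm (W \<xi>)"] by linarith
    next
      case False
      then have "\<bar>\<xi>\<bar> ^ n * norm (W \<xi>) \<le> \<bar>\<xi>\<bar> ^ j * norm (W \<xi>)" using n by (intro mult_right_mono power_increasing) auto
      then have "(\<bar>\<xi>\<bar> ^ n * norm (W \<xi>))\<^sup>2 \<le> (\<bar>\<xi>\<bar> ^ j * norm (W \<xi>))\<^sup>2" by (intro power_mono) auto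
      then show ?thesis using zero_le_power2[of "norm (W \<xi>)"] by linarith
    qed
    have "(nn_moment n W)
      \<le> (\<integral>\<^sup>+\<xi>. ennreal ((norm (W \<xi>))\<^sup>2) + ennreal ((\<bar>\<xi>\<bar> ^ j * norm (W \<xi>))\<^sup>2) \<partial>lborel)"
      using le by (intro nn_integral_mono) (simp flip: ennreal_plus)
    also have "\<dots> = (nn_energy W) + (nn_moment j W)"
      by (rule nn_integral_add) measurable
    also have "\<dots> \<le> ennreal (energy W) + ennreal R"
      unfolding nn_integral_square[OF W2] by (rule add_left_mono[OF R])
    also have "\<dots> = ennreal (energy W + R)"
      using R0 by (simp add: ennreal_plus)
    finally have fin: "(nn_moment n W) \<le> ennreal (energy W + R)" .
    have "0 \<le> energy W + R" using R0 by simp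
    from weak_deriv_of_fourier[OF F fin this] show ?thesis by blast
  qed
  then have sob: "u \<in> sobolev j" using u by (simp add: sobolev_def)
  obtain h where h: "h \<in> L2" "has_weak_deriv j u h" "2 * pi * (L2norm h)\<^sup>2 \<le> R"
    by (rule weak_deriv_of_fourier[OF F R R0]) blast
  have h_eq: "L2norm (weak_deriv j u) = L2norm h" by (rule L2norm_weak_deriv[OF h(2,1)])
  define p q where "p = (1 + t) powr (- 1 / 12 - real j / 6)" and "q = (1 + t) powr (- real l / 2)"
  have pq: "p \<ge> 0" "q \<ge> 0" by (auto simp: p_def q_def)
  have p2: "p\<^sup>2 = (1 + t) powr (- (1 + 2 * real j) / 6)"
  proof -
    have "(- 1 / 12 - real j / 6) + (- 1 / 12 - real j / 6) = - (1 + 2 * real j) / 6" by (simp add: field_simps)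
    then show ?thesis unfolding p_def power2_eq_square powr_add[symmetric] by (simp only:)
  qed
  have q2: "q\<^sup>2 = (1 + t) powr (- real l)"
    unfolding q_def power2_eq_square powr_add[symmetric] by simp
  have "2 * pi * (L2norm h)\<^sup>2 \<le> A * (p\<^sup>2 * (L1norm U0)\<^sup>2 + q\<^sup>2 * (2 * pi * G\<^sup>2))"
    using h(3) unfolding R_def p2 q2 .
  also have "\<dots> \<le> A * (2 * pi * (p\<^sup>2 * (L1norm U0)\<^sup>2) + q\<^sup>2 * (2 * pi * G\<^sup>2))"
  proof (intro mult_left_mono add_right_mono)
    have "1 * (p\<^sup>2 * (L1norm U0)\<^sup>2) \<le> 2 * pi * (p\<^sup>2 * (L1norm U0)\<^sup>2)"
      using pi_gt3 by (intro mult_right_mono) auto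
    then show "p\<^sup>2 * (L1norm U0)\<^sup>2 \<le> 2 * pi * (p\<^sup>2 * (L1norm U0)\<^sup>2)" by simp
  qed (use A in simp)
  also have "\<dots> = 2 * pi * (A * (p\<^sup>2 * (L1norm U0)\<^sup>2 + q\<^sup>2 * G\<^sup>2))" by (simp add: algebra_simps)
  finally have "(L2norm h)\<^sup>2 \<le> A * (p\<^sup>2 * (L1norm U0)\<^sup>2 + q\<^sup>2 * G\<^sup>2)"
    by (simp only: mult_le_cancel_left_pos[OF mult_pos_pos[OF zero_less_numeral pi_gt_zero]])
  also have "\<dots> \<le> A * (p * L1norm U0 + q * G)\<^sup>2"
    using A pq M0 G0 by (intro mult_left_mono) (auto simp: power2_sum power_mult_distrib)
  also have "\<dots> = (sqrt A * p * L1norm U0 + sqrt A * q * G)\<^sup>2"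
  proof -
    have "A = sqrt A * sqrt A" using A by simp
    moreover have "(s * p * L1norm U0 + s * q * G)\<^sup>2 = s * s * (p * L1norm U0 + q * G)\<^sup>2" for s by algebra
    ultimately show ?thesis by (simp only:)
  qed
  finally have "L2norm h \<le> sqrt A * p * L1norm U0 + sqrt A * q * G"
    by (rule power2_le_imp_le) (use A pq M0 G0 in simp)
  then show ?thesis using sob unfolding h_eq p_def q_def G_def by blast
qed

theorem theorem3p2:
  fixes k1 k2 k3 k4 \<gamma> :: real and N l :: nat
  assumes "k1 > 0" "k2 > 0" "k3 > 0" "k4 > 0" "\<gamma> > 0"
    and "k2 \<noteq> k3"
    and "1 \<le> l" "l \<le> N"
  shows "\<forall>j\<in>{0..N - l}. \<exists>c0>0.
    \<forall>(U0 :: real \<Rightarrow> complex ^ 7) (U :: real \<Rightarrow> real \<Rightarrow> complex ^ 7).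
      U0 \<in> sobolev N \<inter> L1 \<longrightarrow> is_solution k1 k2 k3 k4 \<gamma> U0 U \<longrightarrow>
      (\<forall>t\<ge>0. U t \<in> sobolev j \<and>
        L2norm (weak_deriv j (U t))
          \<le> c0 * (1 + t) powr (- 1 / 12 - real j / 6) * L1norm U0
            + c0 * (1 + t) powr (- real l / 2) * L2norm (weak_deriv (j + l) U0))"
proof
  fix j assume "j \<in> {0..N - l}"
  then have jl: "j + l \<le> N" using \<open>l \<le> N\<close> by auto
  obtain C c where C: "C > 0" and c: "c > 0"
    and ode: "\<And>\<xi> W t. fourier_system k1 k2 k3 k4 \<gamma> \<xi> W \<Longrightarrow> t \<ge> 0 \<Longrightarrow>
       (norm (W t))\<^sup>2 \<le> C * exp (- c * decay_rate \<xi> * t) * (norm (W 0))\<^sup>2"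
    by (rule fourier_system_decay[OF assms(1-6)]) blast
  \<comment> \<open>\<open>A\<close> is fixed before the data, the solution and the time, so
    \<open>sqrt A\<close> is one constant for all of them at the given \<open>j\<close>.\<close>
  obtain A where A: "A > 0"
    and decay: "\<And>(W :: real \<Rightarrow> complex ^ 7) (W0 :: real \<Rightarrow> complex ^ 7) M G t. W0 \<in> borel_measurable borel \<Longrightarrow> (\<And>\<xi>. norm (W0 \<xi>) \<le> M) \<Longrightarrow> t \<ge> 0 \<Longrightarrow> G \<ge> 0 \<Longrightarrow>
      (\<And>\<xi>. (norm (W \<xi>))\<^sup>2 \<le> C * exp (- c * decay_rate \<xi> * t) * (norm (W0 \<xi>))\<^sup>2) \<Longrightarrow>
      (nn_moment (j + l) W0) \<le> ennreal G \<Longrightarrow>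
      (nn_moment j W)
        \<le> ennreal (A * ((1 + t) powr (- (1 + 2 * real j) / 6) * M\<^sup>2 + (1 + t) powr (- real l) * G))"
    by (rule weighted_L2_decay[OF C c]) blast
  show "\<exists>c0>0. \<forall>(U0 :: real \<Rightarrow> complex ^ 7) (U :: real \<Rightarrow> real \<Rightarrow> complex ^ 7).
      U0 \<in> sobolev N \<inter> L1 \<longrightarrow> is_solution k1 k2 k3 k4 \<gamma> U0 U \<longrightarrow>
      (\<forall>t\<ge>0. U t \<in> sobolev j \<and>
        L2norm (weak_deriv j (U t))
          \<le> c0 * (1 + t) powr (- 1 / 12 - real j / 6) * L1norm U0
            + c0 * (1 + t) powr (- real l / 2) * L2norm (weak_deriv (j + l) U0))"
  proof (rule exI[of _ "sqrt A"], rule conjI, goal_cases)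
    case 2
    show ?case
    proof (intro allI impI)
      fix U0 :: "real \<Rightarrow> complex ^ 7" and U :: "real \<Rightarrow> real \<Rightarrow> complex ^ 7" and t :: real
      assume U0: "U0 \<in> sobolev N \<inter> L1" and sol: "is_solution k1 k2 k3 k4 \<gamma> U0 U" and t: "t \<ge> 0"
      from sol obtain W :: "real \<Rightarrow> real \<Rightarrow> complex ^ 7"
        where W: "\<And>\<xi>. W \<xi> 0 = fourier U0 \<xi>" "\<And>\<xi>. fourier_system k1 k2 k3 k4 \<gamma> \<xi> (W \<xi>)"
          and F: "has_fourier_L2 (U t) (\<lambda>\<xi>. W \<xi> t)"
        unfolding is_solution_def using t by blast
      have U0': "U0 \<in> sobolev N" "U0 \<in> L1" using U0 by auto
      then have "integrable lborel U0" by (simp add: L1_def)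
      then have [measurable]: "fourier U0 \<in> borel_measurable borel"
        by (intro borel_measurable_vecI) (simp add: fourier_nth ft_measurable integrable_vec_nth borel_measurable_integrable[unfolded measurable_lborel1])
      show "U t \<in> sobolev j \<and> L2norm (weak_deriv j (U t))
          \<le> sqrt A * (1 + t) powr (- 1 / 12 - real j / 6) * L1norm U0
            + sqrt A * (1 + t) powr (- real l / 2) * L2norm (weak_deriv (j + l) U0)"
      proof (rule weak_deriv_decay[OF F A jl t U0'(1) _ U0'(2)])
        fix G :: real
        assume "G \<ge> 0" "(nn_moment (j + l) (fourier U0)) \<le> ennreal G"
        then show "(\<integral>\<^sup>+\<xi>. ennreal ((\<bar>\<xi>\<bar> ^ j * norm (W \<xi> t))\<^sup>2) \<partial>lborel)
          \<le> ennreal (A * ((1 + t) powr (- (1 + 2 * real j) / 6) * (L1norm U0)\<^sup>2 + (1 + t) powr (- real l) * G))"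
          using ode[OF W(2) t] by (intro decay[where ?W0.0 = "fourier U0"]) (auto simp: W(1) norm_fourier_le t)
      qed
    qed
  qed (use A in simp)
qed

end
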